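(* Let $G$ be a countable sofic group with a sofic approximation sequence $\Sigma=\{\sigma_i:G\to\mathrm{Sym}(d_i)\}_{i=1}^\infty$, let $G$ act continuously on a compact metrizable space $X$, and let $\rho$ be a continuous pseudometric on $X$. Suppose that $\rho$ is dynamically generating, i.e. for any distinct points $x,y\in X$ one has $\rho(sx,sy)>0$ for some $s\in G$. Then $$h_\Sigma(X,G)=h_{\Sigma,2}(\rho)=h_{\Sigma,\infty}(\rho).$$
   Context: **Sofic approximation sequence.** $\mathrm{Sym}(d)$ is the permutation group of $\{1,\dots,d\}$. A sofic approximation sequence for a countable discrete group $G$ is a sequence of maps $\sigma_i: G\to\mathrm{Sym}(d_i)$, $s\mapsto\sigma_{i,s}$ (not necessarily homomorphisms), with $d_i\in\mathbb N$, $\lim_{i\to\infty} d_i=\infty$, such that $\lim_{i\to\infty}\frac1{d_i}|\{a:\sigma_{i,st}(a)=\sigma_{i,s}\sigma_{i,t}(a)\}|=1$ for all $s,t\in G$, and $\lim_{i\to\infty}\frac1{d_i}|\{a:\sigma_{i,s}(a)\ne\sigma_{i,t}(a)\}|=1$ for all distinct $s,t\in G$. **Separated sets.** For a pseudometric space $(Y,\rho)$ and $\varepsilon>0$, $N_\varepsilon(Y,\rho)$ is the maximal cardinality of a finite set $A\subseteq Y$ with $\rho(x,y)\ge\varepsilon$ for all distinct $x,y\in A$. **Sofic topological entropy $h_\Sigma(X,G)$.** Let $\alpha$ denote the action, and also the induced action on $C(X)$, $\alpha_s(f)(x)=f(s^{-1}x)$. For a map $\sigma:G\to\mathrm{Sym}(d)$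 write also $\sigma_s$ for the automorphism $\sigma_s(f)(a)=f(\sigma_s^{-1}(a))$ of $\mathbb C^d=C(\{1,\dots,d\})$. On $\mathbb C^d$ put $\|f\|_2=(\frac1d\sum_{a=1}^d|f(a)|^2)^{1/2}$. Let $\mathcal S=\{p_n\}_{n\in\mathbb N}$ be a sequence in the unit ball of $C_{\mathbb R}(X)$. For unital homomorphisms $\varphi,\psi:C(X)\to\mathbb C^d$ (homomorphisms of $C^*$-algebras) set $\rho_{\mathcal S,2}(\varphi,\psi)=\sum_{n=1}^\infty 2^{-n}\|\varphi(p_n)-\psi(p_n)\|_2$. For a nonempty finite $F\subseteq G$ and $\delta>0$, let $\mathrm{Hom}(\mathcal S,F,\delta,\sigma)$ be the set of unital homomorphisms $\varphi:C(X)\to\mathbb C^d$ with $\rho_{\mathcal S,2}(\varphi\circ\alpha_s,\sigma_s\circ\varphi)<\delta$ for all $s\in F$. Define $$h_\Sigma(\mathcal S)=\sup_{\varepsilon>0}\ \inf_F\ \inf_{\delta>0}\ \limsup_{i\to\infty}\frac1{d_i}\log N_\varepsilon(\mathrm{Hom}(\mathcal S,F,\delta,\sigma_i),\rho_{\mathcal S,2}),$$ with $F$ ranging over nonempty finite subsets of $G$ and $\log 0=-\infty$. $\mathcal S$ is dynamically generating if it is not contained in any proper $G$-invariant unital $C^*$-subalgebra of $C(X)$. It is known that $h_\Sigma(\mathcal S)$ is the same for all dynamically generating $\mathcal S$; $h_\Sigma(X,G)$ is this common value. **Spatial entropies.** For maps $\varphi,\psi:\{1,\dots,d\}\to X$ set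 $\rho_2(\varphi,\psi)=\big(\frac1d\sum_{a=1}^d\rho(\varphi(a),\psi(a))^2\big)^{1/2}$ and $\rho_\infty(\varphi,\psi)=\max_{1\le a\le d}\rho(\varphi(a),\psi(a))$. For nonempty finite $F\subseteq G$, $\delta>0$ and $\sigma:G\to\mathrm{Sym}(d)$, $\mathrm{Map}(\rho,F,\delta,\sigma)$ is the set of maps $\varphi:\{1,\dots,d\}\to X$ with $\rho_2(\varphi\circ\sigma_s,\alpha_s\circ\varphi)<\delta$ for all $s\in F$. For $\ast\in\{2,\infty\}$, $$h_{\Sigma,\ast}(\rho)=\sup_{\varepsilon>0}\ \inf_F\ \inf_{\delta>0}\ \limsup_{i\to\infty}\frac1{d_i}\log N_\varepsilon(\mathrm{Map}(\rho,F,\delta,\sigma_i),\rho_\ast),$$ $F$ ranging over nonempty finite subsets of $G$, $\log 0=-\infty$. (The set $\mathrm{Map}$ is defined with $\rho_2$ in both cases.) *)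

theory Defs
  imports
    "HOL-Analysis.Analysis"
    "HOL-Algebra.Group_Action"
    "HOL-Algebra.Sym_Groups"
begin

section \<open>Sofic approximation sequences\<close>

definition sofic_approximation ::
    "('g, 'b) monoid_scheme \<Rightarrow> (nat \<Rightarrow> nat) \<Rightarrow> (nat \<Rightarrow> 'g \<Rightarrow> nat \<Rightarrow> nat) \<Rightarrow> bool" where
  "sofic_approximation G d \<sigma> \<longleftrightarrow>
     (\<forall>i. \<sigma> i \<in> carrier G \<rightarrow> carrier (sym_group (d i))) \<and>
     filterlim d at_top sequentially \<and>
     (\<forall>s\<in>carrier G. \<forall>t\<in>carrier G.
        (\<lambda>i. real (card {a\<in>{1..d i}. \<sigma> i (s \<otimes>\<^bsub>G\<^esub> t) a = \<sigma> i s (\<sigma> i t a)}) / real (d i))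
          \<longlonglongrightarrow> 1) \<and>
     (\<forall>s\<in>carrier G. \<forall>t\<in>carrier G. s \<noteq> t \<longrightarrow>
        (\<lambda>i. real (card {a\<in>{1..d i}. \<sigma> i s a \<noteq> \<sigma> i t a}) / real (d i)) \<longlonglongrightarrow> 1)"


section \<open>Separated sets and exponential growth rates\<close>

text \<open>The value is \<open>\<infinity>\<close> if there are finite separated sets of arbitrarily large cardinality.\<close>

definition sep_num :: "real \<Rightarrow> 'm set \<Rightarrow> ('m \<Rightarrow> 'm \<Rightarrow> real) \<Rightarrow> ereal" where
  "sep_num \<epsilon> Y D =
     (SUP A \<in> {A. A \<subseteq> Y \<and> finite A \<and> (\<forall>x\<in>A. \<forall>y\<in>A. x \<noteq> y \<longrightarrow> D x y \<ge> \<epsilon>)}. ereal (real (card A)))"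

definition ereal_ln :: "ereal \<Rightarrow> ereal" where
  "ereal_ln x =
     (if x \<le> 0 then - \<infinity> else if x = \<infinity> then \<infinity> else ereal (ln (real_of_ereal x)))"

text \<open>
  The common shape of all the entropies below: \<open>Y F \<delta> i\<close> is the model space attached
  to \<open>\<sigma>\<^sub>i\<close>, equipped with the pseudometric \<open>D i\<close>.
\<close>

definition sofic_growth ::
    "('g, 'b) monoid_scheme \<Rightarrow> (nat \<Rightarrow> nat) \<Rightarrow> ('g set \<Rightarrow> real \<Rightarrow> nat \<Rightarrow> 'm set)
      \<Rightarrow> (nat \<Rightarrow> 'm \<Rightarrow> 'm \<Rightarrow> real) \<Rightarrow> ereal" where
  "sofic_growth G d Y D =
     (SUP \<epsilon> \<in> {0<..}. INF F \<in> {F. F \<subseteq> carrier G \<and> finite F \<and> F \<noteq> {}}. INF \<delta> \<in> {0<..}.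
        limsup (\<lambda>i. ereal (1 / real (d i)) * ereal_ln (sep_num \<epsilon> (Y F \<delta> i) (D i))))"


section \<open>Algebras of continuous functions\<close>

text \<open>
  The elements of \<open>C(X)\<close> are represented by functions that are \<open>undefined\<close> outside
  \<open>topspace X\<close>, so that equality of elements is equality of functions.
\<close>

definition cfun :: "'x topology \<Rightarrow> ('x \<Rightarrow> complex) set" where
  "cfun X = {f \<in> extensional (topspace X). continuous_map X euclidean f}"

text \<open>\<open>\<complex>\<^sup>d\<close> is the algebra of functions on the discrete space \<open>{1, \<dots>, d}\<close>.\<close>

abbreviation cpow :: "nat \<Rightarrow> (nat \<Rightarrow> complex) set" where
  "cpow d \<equiv> cfun (discrete_topology {1..d})"

definition unital_star_hom ::
    "'x topology \<Rightarrow> 'y topology \<Rightarrow> (('x \<Rightarrow> complex) \<Rightarrow> ('y \<Rightarrow> complex)) \<Rightarrow> bool" where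
  "unital_star_hom X Y \<phi> \<longleftrightarrow>
     \<phi> \<in> cfun X \<rightarrow>\<^sub>E cfun Y \<and>
     \<phi> (\<lambda>x\<in>topspace X. 1) = (\<lambda>y\<in>topspace Y. 1) \<and>
     (\<forall>f\<in>cfun X. \<forall>g\<in>cfun X. \<phi> (\<lambda>x\<in>topspace X. f x + g x) = (\<lambda>y\<in>topspace Y. \<phi> f y + \<phi> g y)) \<and>
     (\<forall>f\<in>cfun X. \<forall>g\<in>cfun X. \<phi> (\<lambda>x\<in>topspace X. f x * g x) = (\<lambda>y\<in>topspace Y. \<phi> f y * \<phi> g y)) \<and>
     (\<forall>c. \<forall>f\<in>cfun X. \<phi> (\<lambda>x\<in>topspace X. c * f x) = (\<lambda>y\<in>topspace Y. c * \<phi> f y)) \<and>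
     (\<forall>f\<in>cfun X. \<phi> (\<lambda>x\<in>topspace X. cnj (f x)) = (\<lambda>y\<in>topspace Y. cnj (\<phi> f y)))"

text \<open>\<open>C(X)\<close> carries the supremum norm, so norm-closedness is closure under uniform limits.\<close>

definition unital_cstar_subalgebra :: "'x topology \<Rightarrow> ('x \<Rightarrow> complex) set \<Rightarrow> bool" where
  "unital_cstar_subalgebra X A \<longleftrightarrow>
     A \<subseteq> cfun X \<and>
     (\<lambda>x\<in>topspace X. 1) \<in> A \<and>
     (\<forall>f\<in>A. \<forall>g\<in>A. (\<lambda>x\<in>topspace X. f x + g x) \<in> A) \<and>
     (\<forall>f\<in>A. \<forall>g\<in>A. (\<lambda>x\<in>topspace X. f x * g x) \<in> A) \<and>
     (\<forall>c. \<forall>f\<in>A. (\<lambda>x\<in>topspace X. c * f x) \<in> A) \<and>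
     (\<forall>f\<in>A. (\<lambda>x\<in>topspace X. cnj (f x)) \<in> A) \<and>
     (\<forall>u f. (\<forall>n. u n \<in> A) \<and> f \<in> cfun X \<and> uniform_limit (topspace X) u f sequentially
        \<longrightarrow> f \<in> A)"

definition cfun_act ::
    "('g, 'b) monoid_scheme \<Rightarrow> 'x topology \<Rightarrow> ('g \<Rightarrow> 'x \<Rightarrow> 'x) \<Rightarrow> 'g
      \<Rightarrow> ('x \<Rightarrow> complex) \<Rightarrow> ('x \<Rightarrow> complex)" where
  "cfun_act G X \<alpha> s f = (\<lambda>x\<in>topspace X. f (\<alpha> (inv\<^bsub>G\<^esub> s) x))"

definition perm_act :: "nat \<Rightarrow> (nat \<Rightarrow> nat) \<Rightarrow> (nat \<Rightarrow> complex) \<Rightarrow> (nat \<Rightarrow> complex)" where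
  "perm_act d \<pi> f = (\<lambda>a\<in>{1..d}. f (inv' \<pi> a))"

definition norm2 :: "nat \<Rightarrow> (nat \<Rightarrow> complex) \<Rightarrow> real" where
  "norm2 d f = sqrt ((\<Sum>a\<in>{1..d}. (cmod (f a))\<^sup>2) / real d)"


section \<open>Sofic topological entropy\<close>

definition real_unit_ball_seq :: "'x topology \<Rightarrow> (nat \<Rightarrow> 'x \<Rightarrow> complex) \<Rightarrow> bool" where
  "real_unit_ball_seq X p \<longleftrightarrow>
     (\<forall>n. p n \<in> cfun X \<and> (\<forall>x\<in>topspace X. p n x \<in> \<real> \<and> cmod (p n x) \<le> 1))"

text \<open>Sequences are indexed from \<open>0\<close>, hence the weights \<open>2\<^sup>-\<^sup>(\<^sup>n\<^sup>+\<^sup>1\<^sup>)\<close>.\<close>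

definition rho_seq ::
    "(nat \<Rightarrow> 'x \<Rightarrow> complex) \<Rightarrow> nat \<Rightarrow> (('x \<Rightarrow> complex) \<Rightarrow> nat \<Rightarrow> complex)
      \<Rightarrow> (('x \<Rightarrow> complex) \<Rightarrow> nat \<Rightarrow> complex) \<Rightarrow> real" where
  "rho_seq p d \<phi> \<psi> = (\<Sum>n. (1/2) ^ Suc n * norm2 d (\<lambda>a. \<phi> (p n) a - \<psi> (p n) a))"

definition Hom_space ::
    "('g, 'b) monoid_scheme \<Rightarrow> 'x topology \<Rightarrow> ('g \<Rightarrow> 'x \<Rightarrow> 'x) \<Rightarrow> (nat \<Rightarrow> 'x \<Rightarrow> complex)
      \<Rightarrow> 'g set \<Rightarrow> real \<Rightarrow> nat \<Rightarrow> ('g \<Rightarrow> nat \<Rightarrow> nat) \<Rightarrow> (('x \<Rightarrow> complex) \<Rightarrow> nat \<Rightarrow> complex) set" where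
  "Hom_space G X \<alpha> p F \<delta> d \<sigma> =
     {\<phi>. unital_star_hom X (discrete_topology {1..d}) \<phi> \<and>
         (\<forall>s\<in>F. rho_seq p d (\<phi> \<circ> cfun_act G X \<alpha> s) (perm_act d (\<sigma> s) \<circ> \<phi>) < \<delta>)}"

definition sofic_entropy_seq ::
    "('g, 'b) monoid_scheme \<Rightarrow> 'x topology \<Rightarrow> ('g \<Rightarrow> 'x \<Rightarrow> 'x) \<Rightarrow> (nat \<Rightarrow> nat)
      \<Rightarrow> (nat \<Rightarrow> 'g \<Rightarrow> nat \<Rightarrow> nat) \<Rightarrow> (nat \<Rightarrow> 'x \<Rightarrow> complex) \<Rightarrow> ereal" where
  "sofic_entropy_seq G X \<alpha> d \<sigma> p =
     sofic_growth G d (\<lambda>F \<delta> i. Hom_space G X \<alpha> p F \<delta> (d i) (\<sigma> i)) (\<lambda>i. rho_seq p (d i))"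

definition dyn_generating_seq ::
    "('g, 'b) monoid_scheme \<Rightarrow> 'x topology \<Rightarrow> ('g \<Rightarrow> 'x \<Rightarrow> 'x) \<Rightarrow> (nat \<Rightarrow> 'x \<Rightarrow> complex) \<Rightarrow> bool" where
  "dyn_generating_seq G X \<alpha> p \<longleftrightarrow>
     (\<forall>A. unital_cstar_subalgebra X A \<and> (\<forall>s\<in>carrier G. \<forall>f\<in>A. cfun_act G X \<alpha> s f \<in> A) \<and> range p \<subseteq> A
        \<longrightarrow> A = cfun X)"

text \<open>
  The common value over all dynamically generating sequences; \<open>the_elem\<close> is specified only
  if the set of values is a singleton.
\<close>

definition sofic_entropy ::
    "('g, 'b) monoid_scheme \<Rightarrow> 'x topology \<Rightarrow> ('g \<Rightarrow> 'x \<Rightarrow> 'x) \<Rightarrow> (nat \<Rightarrow> nat)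
      \<Rightarrow> (nat \<Rightarrow> 'g \<Rightarrow> nat \<Rightarrow> nat) \<Rightarrow> ereal" where
  "sofic_entropy G X \<alpha> d \<sigma> =
     the_elem (sofic_entropy_seq G X \<alpha> d \<sigma> ` {p. real_unit_ball_seq X p \<and> dyn_generating_seq G X \<alpha> p})"


section \<open>Spatial entropies\<close>

definition continuous_pseudometric :: "'x topology \<Rightarrow> ('x \<Rightarrow> 'x \<Rightarrow> real) \<Rightarrow> bool" where
  "continuous_pseudometric X \<rho> \<longleftrightarrow>
     (\<forall>x\<in>topspace X. \<rho> x x = 0) \<and>
     (\<forall>x\<in>topspace X. \<forall>y\<in>topspace X. 0 \<le> \<rho> x y \<and> \<rho> x y = \<rho> y x) \<and>
     (\<forall>x\<in>topspace X. \<forall>y\<in>topspace X. \<forall>z\<in>topspace X. \<rho> x z \<le> \<rho> x y + \<rho> y z) \<and>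
     continuous_map (prod_topology X X) euclideanreal (\<lambda>(x, y). \<rho> x y)"

definition dyn_generating_pseudometric ::
    "('g, 'b) monoid_scheme \<Rightarrow> 'x topology \<Rightarrow> ('g \<Rightarrow> 'x \<Rightarrow> 'x) \<Rightarrow> ('x \<Rightarrow> 'x \<Rightarrow> real) \<Rightarrow> bool" where
  "dyn_generating_pseudometric G X \<alpha> \<rho> \<longleftrightarrow>
     (\<forall>x\<in>topspace X. \<forall>y\<in>topspace X. x \<noteq> y \<longrightarrow> (\<exists>s\<in>carrier G. \<rho> (\<alpha> s x) (\<alpha> s y) > 0))"

definition rho2 :: "('x \<Rightarrow> 'x \<Rightarrow> real) \<Rightarrow> nat \<Rightarrow> (nat \<Rightarrow> 'x) \<Rightarrow> (nat \<Rightarrow> 'x) \<Rightarrow> real" where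
  "rho2 \<rho> d \<phi> \<psi> = sqrt ((\<Sum>a\<in>{1..d}. (\<rho> (\<phi> a) (\<psi> a))\<^sup>2) / real d)"

definition rho_max :: "('x \<Rightarrow> 'x \<Rightarrow> real) \<Rightarrow> nat \<Rightarrow> (nat \<Rightarrow> 'x) \<Rightarrow> (nat \<Rightarrow> 'x) \<Rightarrow> real" where
  "rho_max \<rho> d \<phi> \<psi> = Max ((\<lambda>a. \<rho> (\<phi> a) (\<psi> a)) ` {1..d})"

definition Map_space ::
    "'x topology \<Rightarrow> ('g \<Rightarrow> 'x \<Rightarrow> 'x) \<Rightarrow> ('x \<Rightarrow> 'x \<Rightarrow> real) \<Rightarrow> 'g set \<Rightarrow> real \<Rightarrow> nat
      \<Rightarrow> ('g \<Rightarrow> nat \<Rightarrow> nat) \<Rightarrow> (nat \<Rightarrow> 'x) set" where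
  "Map_space X \<alpha> \<rho> F \<delta> d \<sigma> =
     {\<phi> \<in> {1..d} \<rightarrow>\<^sub>E topspace X. \<forall>s\<in>F. rho2 \<rho> d (\<phi> \<circ> \<sigma> s) (\<alpha> s \<circ> \<phi>) < \<delta>}"

definition spatial_entropy_2 ::
    "('g, 'b) monoid_scheme \<Rightarrow> 'x topology \<Rightarrow> ('g \<Rightarrow> 'x \<Rightarrow> 'x) \<Rightarrow> (nat \<Rightarrow> nat)
      \<Rightarrow> (nat \<Rightarrow> 'g \<Rightarrow> nat \<Rightarrow> nat) \<Rightarrow> ('x \<Rightarrow> 'x \<Rightarrow> real) \<Rightarrow> ereal" where
  "spatial_entropy_2 G X \<alpha> d \<sigma> \<rho> =
     sofic_growth G d (\<lambda>F \<delta> i. Map_space X \<alpha> \<rho> F \<delta> (d i) (\<sigma> i)) (\<lambda>i. rho2 \<rho> (d i))"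

definition spatial_entropy_inf ::
    "('g, 'b) monoid_scheme \<Rightarrow> 'x topology \<Rightarrow> ('g \<Rightarrow> 'x \<Rightarrow> 'x) \<Rightarrow> (nat \<Rightarrow> nat)
      \<Rightarrow> (nat \<Rightarrow> 'g \<Rightarrow> nat \<Rightarrow> nat) \<Rightarrow> ('x \<Rightarrow> 'x \<Rightarrow> real) \<Rightarrow> ereal" where
  "spatial_entropy_inf G X \<alpha> d \<sigma> \<rho> =
     sofic_growth G d (\<lambda>F \<delta> i. Map_space X \<alpha> \<rho> F \<delta> (d i) (\<sigma> i)) (\<lambda>i. rho_max \<rho> (d i))"

end

(*
  Everything is measured up to a small proportion of coordinates: two maps into X are regarded as
  close if they are \<rho>-close outside a set of indices of small density. For bounded \<rho> this is
  uniformly equivalent to closeness in the l2-distance, and on unital homomorphisms C(X) -> C^d,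
  which are evaluations at d points of X, to closeness for the sequence pseudometric.

  By compactness, if \<rho> is dynamically generating then any continuous pseudometric is small on a
  pair of points as soon as \<rho> is small on finitely many translates of it. An approximately
  equivariant map transports these translates to other coordinates, and permutations preserve
  densities, so the approximately equivariant maps and the closeness of two of them do not depend
  on the choice of \<rho>. This gives the equality of all l2-entropies.

  For the maximum distance, a map that is l2-close to a given one is determined up to \<epsilon> by
  its coarse position on the few coordinates where it is far. The number of such data grows at an
  arbitrarily small exponential rate, by giving weight t < 1 to every bad coordinate.
*)
theory Submission
  imports Defs
begin

section \<open>Comparison of growth rates\<close>

text \<open>Two obstacles shape the argument. Closeness of two maps in one pseudometric controls
  closeness in another only if both maps are approximately equivariant. Comparing the separation
  scales therefore already fixes a finite set and a tolerance; they depend on \<epsilon> alone and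
  are added to the demands on the source maps. Moreover \<sigma> is multiplicative only in the
  limit, so inclusions between model spaces hold for large i only, which a limsup tolerates.
  Bounding the distance and the density of exceptions by one number turns every estimate into a
  union bound over finitely many bad sets. On the algebra side the actions on functions involve
  inverses. For evaluations at the points of \<phi>, the condition at s compares \<alpha>(s^-1) o
  \<phi> with \<phi> o \<sigma>(s)^-1. This is the spatial condition at s^-1, once \<sigma>(s)
  \<sigma>(s^-1) is known to fix most indices. Finally, the entropy is defined as the only element
  of a set of values, so a generating sequence has to be exhibited as well.\<close>

lemma ereal_ln_scaled_le:
  assumes "N \<le> ereal (exp (\<kappa> * real d)) * N'" and "d > 0" and "0 \<le> N'"
  shows "ereal (1 / real d) * ereal_ln N \<le> ereal (1 / real d) * ereal_ln N' + ereal \<kappa>"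
proof (cases "N \<le> 0")
  case True
  then show ?thesis
    using \<open>d > 0\<close> by (simp add: ereal_ln_def)
next
  case False
  show ?thesis
  proof (cases N')
    case (real r)
    with False assms have "\<not> ereal (exp (\<kappa> * real d) * r) \<le> 0"
      by (metis order_trans times_ereal.simps(1))
    then have r: "r > 0"
      by (simp add: zero_less_mult_iff not_le)
    obtain s where s: "N = ereal s" "s > 0" "s \<le> exp (\<kappa> * real d) * r"
      using False assms real by (cases N) auto
    have "ln s \<le> ln (exp (\<kappa> * real d) * r)"
      using s r by (subst ln_le_cancel_iff) auto
    also have "\<dots> = \<kappa> * real d + ln r"
      using r by (simp add: ln_mult)
    finally have "ln s / real d \<le> ln r / real d + \<kappa>"
      using \<open>d > 0\<close> by (simp add: field_simps)
    then show ?thesis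
      using s r real by (simp add: ereal_ln_def)
  next
    case PInf
    then show ?thesis
      using \<open>d > 0\<close> by (simp add: ereal_ln_def)
  qed (use assms in auto)
qed

lemma sep_num_nonneg: "0 \<le> sep_num \<epsilon> Y D"
  unfolding sep_num_def by (rule SUP_upper2[of "{}"]) auto

text \<open>\<open>S\<close> is injective on every \<epsilon>-separated set, so the image has the
  same cardinality. Distinctness of the images is a separate premise because \<open>D'\<close> is
  not assumed to vanish on the diagonal.\<close>

lemma sep_num_le_map:
  assumes "S ` Y \<subseteq> Y'"
    and "\<And>x y. x \<in> Y \<Longrightarrow> y \<in> Y \<Longrightarrow> x \<noteq> y \<Longrightarrow> D x y \<ge> \<epsilon> \<Longrightarrow> S x \<noteq> S y \<and> D' (S x) (S y) \<ge> \<epsilon>'"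
  shows "sep_num \<epsilon> Y D \<le> sep_num \<epsilon>' Y' D'"
  unfolding sep_num_def
proof (rule SUP_least)
  fix A assume "A \<in> {A. A \<subseteq> Y \<and> finite A \<and> (\<forall>x\<in>A. \<forall>y\<in>A. x \<noteq> y \<longrightarrow> \<epsilon> \<le> D x y)}"
  then have A: "A \<subseteq> Y" "finite A" "\<And>x y. x \<in> A \<Longrightarrow> y \<in> A \<Longrightarrow> x \<noteq> y \<Longrightarrow> \<epsilon> \<le> D x y"
    by auto
  have "inj_on S A"
    using A assms(2) by (meson inj_onI subsetD)
  then have "card (S ` A) = card A"
    by (rule card_image)
  moreover have "S ` A \<in> {A. A \<subseteq> Y' \<and> finite A \<and> (\<forall>x\<in>A. \<forall>y\<in>A. x \<noteq> y \<longrightarrow> \<epsilon>' \<le> D' x y)}"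
    using A assms by (auto simp: subset_iff) (metis)
  ultimately show "ereal (real (card A)) \<le>
     (SUP A\<in>{A. A \<subseteq> Y' \<and> finite A \<and> (\<forall>x\<in>A. \<forall>y\<in>A. x \<noteq> y \<longrightarrow> \<epsilon>' \<le> D' x y)}. ereal (real (card A)))"
    using SUP_upper[of "S ` A" _ "\<lambda>A. ereal (real (card A))"] by fastforce
qed

definition fin_subsets :: "('g, 'b) monoid_scheme \<Rightarrow> 'g set set" where
  "fin_subsets G = {F. F \<subseteq> carrier G \<and> finite F \<and> F \<noteq> {}}"

text \<open>A factor \<open>exp (\<kappa> * d i)\<close> costs only \<kappa> in the growth rate, and
  \<kappa> is arbitrary. The scale \<epsilon>' may depend on \<kappa> since the right-hand side is a
  supremum over scales, but it must be chosen before \<open>F'\<close> and \<delta>'.\<close>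

lemma sofic_growth_le_exp:
  assumes d: "filterlim d at_top sequentially"
    and *: "\<And>\<epsilon> \<kappa>. \<epsilon> > 0 \<Longrightarrow> \<kappa> > 0 \<Longrightarrow> \<exists>\<epsilon>'>0. \<forall>F' \<in> fin_subsets G. \<forall>\<delta>'>0.
       \<exists>F \<in> fin_subsets G. \<exists>\<delta>>0. \<forall>\<^sub>F i in sequentially. d i > 0 \<longrightarrow>
        sep_num \<epsilon> (Y F \<delta> i) (D i) \<le> ereal (exp (\<kappa> * real (d i))) * sep_num \<epsilon>' (Y' F' \<delta>' i) (D' i)"
  shows "sofic_growth G d Y D \<le> sofic_growth G d Y' D'"
  unfolding sofic_growth_def fin_subsets_def[symmetric]
proof (rule SUP_least, rule ereal_le_epsilon2)
  fix \<epsilon> \<kappa> :: real assume "\<epsilon> \<in> {0<..}" and \<kappa>: "0 < \<kappa>"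
  then have "\<epsilon> > 0" by simp
  let ?L = "\<lambda>F \<delta>. limsup (\<lambda>i. ereal (1 / real (d i)) * ereal_ln (sep_num \<epsilon> (Y F \<delta> i) (D i)))"
  let ?L' = "\<lambda>\<epsilon> F \<delta>. limsup (\<lambda>i. ereal (1 / real (d i)) * ereal_ln (sep_num \<epsilon> (Y' F \<delta> i) (D' i)))"
  let ?I = "INF F \<in> fin_subsets G. INF \<delta>\<in>{0<..}. ?L F \<delta>"
  obtain \<epsilon>' where "\<epsilon>' > 0" and \<epsilon>': "\<And>F' \<delta>'. F' \<in> fin_subsets G \<Longrightarrow> \<delta>' > 0 \<Longrightarrow>
       \<exists>F \<in> fin_subsets G. \<exists>\<delta>>0. \<forall>\<^sub>F i in sequentially. d i > 0 \<longrightarrow>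
        sep_num \<epsilon> (Y F \<delta> i) (D i) \<le> ereal (exp (\<kappa> * real (d i))) * sep_num \<epsilon>' (Y' F' \<delta>' i) (D' i)"
    using *[OF \<open>\<epsilon> > 0\<close> \<kappa>] by blast
  \<comment> \<open>With \<kappa> moved to the left, the infimum over \<open>F'\<close> and
    \<delta>' can be taken directly, without commuting it with an addition of extended
    reals.\<close>
  have "?I - ereal \<kappa> \<le> ?L' \<epsilon>' F' \<delta>'" if "F' \<in> fin_subsets G" "\<delta>' \<in> {0<..}" for F' \<delta>'
  proof -
    from \<epsilon>'[OF that(1)] that(2) obtain F \<delta> where F: "F \<in> fin_subsets G" "\<delta> > 0"
      and ev: "\<forall>\<^sub>F i in sequentially. d i > 0 \<longrightarrow>
        sep_num \<epsilon> (Y F \<delta> i) (D i) \<le> ereal (exp (\<kappa> * real (d i))) * sep_num \<epsilon>' (Y' F' \<delta>' i) (D' i)"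
      by (simp only: greaterThan_iff) blast
    have "\<forall>\<^sub>F i in sequentially. d i > 0"
      using d[unfolded filterlim_at_top, rule_format, of 1] by (simp add: Suc_le_eq)
    with ev have "\<forall>\<^sub>F i in sequentially. ereal (1 / real (d i)) * ereal_ln (sep_num \<epsilon> (Y F \<delta> i) (D i))
        \<le> ereal (1 / real (d i)) * ereal_ln (sep_num \<epsilon>' (Y' F' \<delta>' i) (D' i)) + ereal \<kappa>"
      by eventually_elim (rule ereal_ln_scaled_le, auto simp: sep_num_nonneg)
    then have "?L F \<delta> \<le> limsup (\<lambda>i. ereal (1 / real (d i)) * ereal_ln (sep_num \<epsilon>' (Y' F' \<delta>' i) (D' i)) + ereal \<kappa>)"
      by (rule Limsup_mono)
    also have "\<dots> = ?L' \<epsilon>' F' \<delta>' + ereal \<kappa>"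
      by (rule Limsup_add_ereal_right) auto
    finally have "?L F \<delta> \<le> ?L' \<epsilon>' F' \<delta>' + ereal \<kappa>" .
    moreover have "?I \<le> ?L F \<delta>"
      using F by (meson INF_lower2 greaterThan_iff order_refl)
    ultimately show ?thesis
      by (simp add: ereal_minus_le)
  qed
  then have "?I - ereal \<kappa> \<le> (INF F \<in> fin_subsets G. INF \<delta>\<in>{0<..}. ?L' \<epsilon>' F \<delta>)"
    by (intro INF_greatest)
  also have "\<dots> \<le> (SUP \<epsilon>\<in>{0<..}. INF F \<in> fin_subsets G. INF \<delta>\<in>{0<..}. ?L' \<epsilon> F \<delta>)"
    using \<open>\<epsilon>' > 0\<close> by (intro SUP_upper) auto
  finally show "?I \<le> (SUP \<epsilon>\<in>{0<..}. INF F \<in> fin_subsets G. INF \<delta>\<in>{0<..}. ?L' \<epsilon> F \<delta>) + ereal \<kappa>"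
    by (simp add: ereal_minus_le)
qed

text \<open>The case without exponential loss: separation numbers are nonnegative, so a factor at
  least 1 may be inserted.\<close>

lemma sofic_growth_le:
  fixes Y :: "'g set \<Rightarrow> real \<Rightarrow> nat \<Rightarrow> 'c set" and Y' :: "'g set \<Rightarrow> real \<Rightarrow> nat \<Rightarrow> 'd set"
  assumes d: "filterlim d at_top sequentially"
    and *: "\<And>\<epsilon>. \<epsilon> > 0 \<Longrightarrow> \<exists>\<epsilon>'>0. \<forall>F' \<in> fin_subsets G. \<forall>\<delta>'>0.
       \<exists>F \<in> fin_subsets G. \<exists>\<delta>>0. \<forall>\<^sub>F i in sequentially. d i > 0 \<longrightarrow>
        sep_num \<epsilon> (Y F \<delta> i) (D i) \<le> sep_num \<epsilon>' (Y' F' \<delta>' i) (D' i)"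
  shows "sofic_growth G d Y D \<le> sofic_growth G d Y' D'"
proof (rule sofic_growth_le_exp[OF d])
  fix \<epsilon> \<kappa> :: real assume "\<epsilon> > 0" "\<kappa> > 0"
  obtain \<epsilon>' where "\<epsilon>' > 0" and \<epsilon>': "\<And>F' \<delta>'. F' \<in> fin_subsets G \<Longrightarrow> \<delta>' > 0 \<Longrightarrow>
       \<exists>F \<in> fin_subsets G. \<exists>\<delta>>0. \<forall>\<^sub>F i in sequentially. d i > 0 \<longrightarrow>
        sep_num \<epsilon> (Y F \<delta> i) (D i) \<le> sep_num \<epsilon>' (Y' F' \<delta>' i) (D' i)"
    using *[OF \<open>\<epsilon> > 0\<close>] by blast
  have "sep_num \<epsilon>' V E \<le> ereal (exp (\<kappa> * real n)) * sep_num \<epsilon>' V E" for n V and E :: "'d \<Rightarrow> 'd \<Rightarrow> real"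
    using ereal_mult_right_mono[of 1 "ereal (exp (\<kappa> * real n))" "sep_num \<epsilon>' V E"] \<open>\<kappa> > 0\<close>
    by (simp add: sep_num_nonneg)
  then have le: "x \<le> sep_num \<epsilon>' V E \<Longrightarrow> x \<le> ereal (exp (\<kappa> * real n)) * sep_num \<epsilon>' V E"
    for x n V and E :: "'d \<Rightarrow> 'd \<Rightarrow> real"
    using order_trans by blast
  show "\<exists>\<epsilon>'>0. \<forall>F' \<in> fin_subsets G. \<forall>\<delta>'>0.
       \<exists>F \<in> fin_subsets G. \<exists>\<delta>>0. \<forall>\<^sub>F i in sequentially. d i > 0 \<longrightarrow>
        sep_num \<epsilon> (Y F \<delta> i) (D i) \<le> ereal (exp (\<kappa> * real (d i))) * sep_num \<epsilon>' (Y' F' \<delta>' i) (D' i)"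
  proof (intro exI conjI ballI allI impI)
    fix F' \<delta>' assume "F' \<in> fin_subsets G" "0 < (\<delta>' :: real)"
    then obtain F \<delta> where "F \<in> fin_subsets G" "\<delta> > 0" and
      ev: "\<forall>\<^sub>F i in sequentially. d i > 0 \<longrightarrow>
        sep_num \<epsilon> (Y F \<delta> i) (D i) \<le> sep_num \<epsilon>' (Y' F' \<delta>' i) (D' i)"
      using \<epsilon>' by blast
    moreover from ev have "\<forall>\<^sub>F i in sequentially. d i > 0 \<longrightarrow>
        sep_num \<epsilon> (Y F \<delta> i) (D i) \<le> ereal (exp (\<kappa> * real (d i))) * sep_num \<epsilon>' (Y' F' \<delta>' i) (D' i)"
      by (rule eventually_mono) (auto intro: le)
    ultimately show "\<exists>F \<in> fin_subsets G. \<exists>\<delta>>0. \<forall>\<^sub>F i in sequentially. d i > 0 \<longrightarrow>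
        sep_num \<epsilon> (Y F \<delta> i) (D i) \<le> ereal (exp (\<kappa> * real (d i))) * sep_num \<epsilon>' (Y' F' \<delta>' i) (D' i)"
      by blast
  qed fact
qed

section \<open>Closeness in measure\<close>

text \<open>Normalized counting measure. For \<open>d = 0\<close> its value is 0 for every
  \<open>P\<close>, hence the condition \<open>d > 0\<close> in the complement rule.\<close>

definition proportion :: "nat \<Rightarrow> (nat \<Rightarrow> bool) \<Rightarrow> real" where
  "proportion d P = real (card {a \<in> {1..d}. P a}) / real d"

lemma proportion_nonneg: "0 \<le> proportion d P"
  by (simp add: proportion_def)

lemma proportion_mono: "(\<And>a. a \<in> {1..d} \<Longrightarrow> P a \<Longrightarrow> Q a) \<Longrightarrow> proportion d P \<le> proportion d Q"
  unfolding proportion_def by (intro divide_right_mono of_nat_mono card_mono) auto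

lemma proportion_not:
  assumes "d > 0"
  shows "proportion d (\<lambda>a. \<not> P a) = 1 - proportion d P"
proof -
  have "{a \<in> {1..d}. \<not> P a} = {1..d} - {a \<in> {1..d}. P a}"
    by auto
  moreover have "card ({1..d} - {a \<in> {1..d}. P a}) = d - card {a \<in> {1..d}. P a}"
    by (subst card_Diff_subset) auto
  moreover have "card {a \<in> {1..d}. P a} \<le> d"
    using card_mono[of "{1..d}" "{a \<in> {1..d}. P a}"] by (simp add: subset_iff)
  ultimately show ?thesis
    using assms by (simp add: proportion_def of_nat_diff diff_divide_distrib)
qed

lemma proportion_disj: "proportion d (\<lambda>a. P a \<or> Q a) \<le> proportion d P + proportion d Q"
proof -
  have "{a \<in> {1..d}. P a \<or> Q a} = {a \<in> {1..d}. P a} \<union> {a \<in> {1..d}. Q a}"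
    by auto
  then have "real (card {a \<in> {1..d}. P a \<or> Q a}) \<le> real (card {a \<in> {1..d}. P a}) + real (card {a \<in> {1..d}. Q a})"
    by (simp only: of_nat_add[symmetric] of_nat_le_iff card_Un_le)
  then show ?thesis
    unfolding proportion_def add_divide_distrib[symmetric] by (intro divide_right_mono) auto
qed

lemma proportion_bex:
  assumes "finite K"
  shows "proportion d (\<lambda>a. \<exists>s\<in>K. P s a) \<le> (\<Sum>s\<in>K. proportion d (P s))"
  using assms
proof induction
  case empty
  then show ?case by (simp add: proportion_def)
next
  case (insert s K)
  have "proportion d (\<lambda>a. \<exists>s\<in>insert s K. P s a) \<le> proportion d (P s) + proportion d (\<lambda>a. \<exists>s\<in>K. P s a)"
    using proportion_disj[of d "P s"] by simp
  with insert show ?case by simp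
qed

lemma proportion_permutes:
  assumes "\<pi> permutes {1..d}"
  shows "proportion d (\<lambda>a. P (\<pi> a)) = proportion d P"
proof -
  have "\<pi> ` {a \<in> {1..d}. P (\<pi> a)} = {a \<in> {1..d}. P a}"
    using permutes_image[OF assms] by (force simp del: atLeastAtMost_iff)
  moreover have "inj_on \<pi> {a \<in> {1..d}. P (\<pi> a)}"
    using permutes_inj[OF assms] by (rule inj_on_subset) auto
  then have "card (\<pi> ` {a \<in> {1..d}. P (\<pi> a)}) = card {a \<in> {1..d}. P (\<pi> a)}"
    by (rule card_image)
  ultimately have "card {a \<in> {1..d}. P a} = card {a \<in> {1..d}. P (\<pi> a)}"
    by simp
  then show ?thesis by (simp add: proportion_def)
qed

lemma proportion_markov:
  assumes "\<And>a. a \<in> {1..d} \<Longrightarrow> 0 \<le> f a" 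
  shows "\<eta> * proportion d (\<lambda>a. \<eta> \<le> f a) \<le> (\<Sum>a\<in>{1..d}. f a) / real d"
proof -
  have "\<eta> * real (card {a \<in> {1..d}. \<eta> \<le> f a}) = (\<Sum>a | a \<in> {1..d} \<and> \<eta> \<le> f a. \<eta>)"
    by simp
  also have "\<dots> \<le> (\<Sum>a | a \<in> {1..d} \<and> \<eta> \<le> f a. f a)"
    by (rule sum_mono) auto
  also have "\<dots> \<le> (\<Sum>a\<in>{1..d}. f a)"
    by (rule sum_mono2) (use assms in auto)
  finally show ?thesis
    unfolding proportion_def by (simp add: divide_right_mono)
qed

text \<open>The converse of Markov's inequality for functions bounded above: pointwise,
  \<open>f\<close> is at most \<eta> plus \<open>C\<close> times the indicator of the set where
  \<eta> \<le> \<open>f\<close>.\<close>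

lemma mean_le_proportion:
  assumes f: "\<And>a. a \<in> {1..d} \<Longrightarrow> f a \<le> C" and "0 \<le> \<eta>" "0 \<le> C"
  shows "(\<Sum>a\<in>{1..d}. f a) / real d \<le> \<eta> + C * proportion d (\<lambda>a. \<eta> \<le> f a)"
proof (cases "d = 0")
  case False
  have "(\<Sum>a\<in>{1..d}. f a) \<le> (\<Sum>a\<in>{1..d}. \<eta> + (if \<eta> \<le> f a then C else 0))"
    using f \<open>0 \<le> \<eta>\<close> \<open>0 \<le> C\<close> by (intro sum_mono) (force intro: add_increasing)
  also have "\<dots> = real d * \<eta> + C * real (card {a \<in> {1..d}. \<eta> \<le> f a})"
    by (simp add: sum.distrib sum.If_cases Int_def)
  finally have "(\<Sum>a\<in>{1..d}. f a) / real d \<le> (real d * \<eta> + C * real (card {a \<in> {1..d}. \<eta> \<le> f a})) / real d"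
    by (rule divide_right_mono) simp
  then show ?thesis
    using False by (simp add: proportion_def add_divide_distrib)
qed (use assms in \<open>simp add: proportion_def\<close>)

text \<open>The balls of the Ky Fan metric, which metrizes convergence in measure: the same \<eta>
  bounds the distance at good indices and the density of bad ones. The condition forces \<eta> >
  0.\<close>

definition close_in_measure :: "('x \<Rightarrow> 'x \<Rightarrow> real) \<Rightarrow> nat \<Rightarrow> real \<Rightarrow> (nat \<Rightarrow> 'x) \<Rightarrow> (nat \<Rightarrow> 'x) \<Rightarrow> bool" where
  "close_in_measure \<rho> d \<eta> \<phi> \<psi> \<longleftrightarrow> proportion d (\<lambda>a. \<eta> \<le> \<rho> (\<phi> a) (\<psi> a)) < \<eta>"

lemma close_in_measure_mono:
  assumes "close_in_measure \<rho> d \<eta> \<phi> \<psi>" "\<eta> \<le> \<eta>'"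
  shows "close_in_measure \<rho> d \<eta>' \<phi> \<psi>"
proof -
  have "proportion d (\<lambda>a. \<eta>' \<le> \<rho> (\<phi> a) (\<psi> a)) \<le> proportion d (\<lambda>a. \<eta> \<le> \<rho> (\<phi> a) (\<psi> a))"
    using assms(2) by (intro proportion_mono) auto
  with assms show ?thesis unfolding close_in_measure_def by linarith
qed

lemma rho2_imp_close:
  assumes "\<eta> > 0"
  shows "\<exists>\<delta>>0. \<forall>d \<phi> \<psi>. rho2 \<rho> d \<phi> \<psi> < \<delta> \<longrightarrow> close_in_measure \<rho> d \<eta> \<phi> \<psi>"
proof (intro exI conjI allI impI)
  \<comment> \<open>Markov's inequality is applied to the squared distance at level
    \<open>\<eta>^2\<close>; the remaining factor \<eta> is the permitted density.\<close>
  show "sqrt (\<eta>^2 * \<eta>) > 0"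
    using assms by simp
  fix d \<phi> \<psi> assume "rho2 \<rho> d \<phi> \<psi> < sqrt (\<eta>^2 * \<eta>)"
  then have *: "(\<Sum>a\<in>{1..d}. (\<rho> (\<phi> a) (\<psi> a))\<^sup>2) / real d < \<eta>^2 * \<eta>"
    unfolding rho2_def by simp
  have "\<eta>^2 * proportion d (\<lambda>a. \<eta> \<le> \<rho> (\<phi> a) (\<psi> a)) \<le> \<eta>^2 * proportion d (\<lambda>a. \<eta>^2 \<le> (\<rho> (\<phi> a) (\<psi> a))^2)"
    using assms by (intro mult_left_mono proportion_mono power_mono) auto
  also have "\<dots> \<le> (\<Sum>a\<in>{1..d}. (\<rho> (\<phi> a) (\<psi> a))\<^sup>2) / real d"
    by (rule proportion_markov) auto
  finally have "\<eta>^2 * proportion d (\<lambda>a. \<eta> \<le> \<rho> (\<phi> a) (\<psi> a)) < \<eta>^2 * \<eta>"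
    using * by simp
  then show "close_in_measure \<rho> d \<eta> \<phi> \<psi>"
    using assms unfolding close_in_measure_def by simp
qed

lemma close_imp_rho2:
  assumes "\<epsilon> > 0" and "0 \<le> C"
  shows "\<exists>\<eta>>0. \<forall>d \<phi> \<psi>. (\<forall>a\<in>{1..d}. 0 \<le> \<rho> (\<phi> a) (\<psi> a) \<and> \<rho> (\<phi> a) (\<psi> a) \<le> C) \<longrightarrow>
     close_in_measure \<rho> d \<eta> \<phi> \<psi> \<longrightarrow> rho2 \<rho> d \<phi> \<psi> < \<epsilon>"
proof -
  \<comment> \<open>Good indices contribute at most \<open>\<eta>^2 \<le> \<epsilon>^2 / 4\<close>
    to the mean square, bad ones at most \<open>C^2 * \<eta> \<le> \<epsilon>^2 / 2\<close>. The
    summand 1 keeps the denominator positive when \<open>C = 0\<close>.\<close>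
  define \<eta> where "\<eta> = min (\<epsilon> / 2) (\<epsilon>^2 / 2 / (C^2 + 1))"
  have C: "C^2 + 1 > 0" by (simp add: add_nonneg_pos)
  have \<eta>: "\<eta> > 0" "\<eta> \<le> \<epsilon> / 2" "\<eta> \<le> \<epsilon>^2 / 2 / (C^2 + 1)"
    using assms C unfolding \<eta>_def by (simp_all only: min_less_iff_conj min.cobounded1 min.cobounded2) simp
  have "rho2 \<rho> d \<phi> \<psi> < \<epsilon>"
    if nn: "\<forall>a\<in>{1..d}. 0 \<le> \<rho> (\<phi> a) (\<psi> a) \<and> \<rho> (\<phi> a) (\<psi> a) \<le> C"
      and cl: "close_in_measure \<rho> d \<eta> \<phi> \<psi>" for d \<phi> \<psi>
  proof -
    have "(\<Sum>a\<in>{1..d}. (\<rho> (\<phi> a) (\<psi> a))^2) / real d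
        \<le> \<eta>^2 + C^2 * proportion d (\<lambda>a. \<eta>^2 \<le> (\<rho> (\<phi> a) (\<psi> a))^2)"
      using nn by (intro mean_le_proportion power_mono) auto
    also have "proportion d (\<lambda>a. \<eta>^2 \<le> (\<rho> (\<phi> a) (\<psi> a))^2) \<le> proportion d (\<lambda>a. \<eta> \<le> \<rho> (\<phi> a) (\<psi> a))"
      using nn by (intro proportion_mono) (auto intro: power2_le_imp_le)
    also have "\<dots> \<le> \<eta>"
      using cl by (simp add: close_in_measure_def)
    also have "\<eta>^2 + C^2 * \<eta> < \<epsilon>^2"
    proof -
      have "\<eta>^2 \<le> (\<epsilon>/2)^2"
        using \<eta> by (intro power_mono) auto
      then have "\<eta>^2 \<le> \<epsilon>^2 / 4"
        by (simp add: power_divide)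
      moreover have "\<eta> * (C^2 + 1) \<le> \<epsilon>^2 / 2"
        using \<eta>(3) pos_le_divide_eq[OF C] by blast
      then have "C^2 * \<eta> + \<eta> \<le> \<epsilon>^2 / 2"
        by (simp add: algebra_simps)
      moreover have "\<epsilon>^2 > 0" using assms by simp
      ultimately show ?thesis using \<eta>(1) by linarith
    qed
    finally have "(\<Sum>a\<in>{1..d}. (\<rho> (\<phi> a) (\<psi> a))^2) / real d < \<epsilon>^2"
      by (simp add: mult_left_mono)
    then show ?thesis
      unfolding rho2_def using assms(1) by (metis abs_of_pos real_sqrt_abs real_sqrt_less_iff)
  qed
  with \<eta>(1) show ?thesis by blast
qed

section \<open>Continuous pseudometrics on a compact space\<close>

lemma pseudometric_self:
  "continuous_pseudometric X \<rho> \<Longrightarrow> x \<in> topspace X \<Longrightarrow> \<rho> x x = 0"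
  by (simp add: continuous_pseudometric_def)

lemma pseudometric_nonneg:
  "continuous_pseudometric X \<rho> \<Longrightarrow> x \<in> topspace X \<Longrightarrow> y \<in> topspace X \<Longrightarrow> 0 \<le> \<rho> x y"
  by (simp add: continuous_pseudometric_def)

lemma pseudometric_commute:
  "continuous_pseudometric X \<rho> \<Longrightarrow> x \<in> topspace X \<Longrightarrow> y \<in> topspace X \<Longrightarrow> \<rho> x y = \<rho> y x"
  unfolding continuous_pseudometric_def by blast

lemma pseudometric_triangle:
  "continuous_pseudometric X \<rho> \<Longrightarrow> x \<in> topspace X \<Longrightarrow> y \<in> topspace X \<Longrightarrow> z \<in> topspace X
    \<Longrightarrow> \<rho> x z \<le> \<rho> x y + \<rho> y z"
  unfolding continuous_pseudometric_def by blast

lemma pseudometric_continuous_right: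
  assumes "continuous_pseudometric X \<rho>" "c \<in> topspace X"
  shows "continuous_map X euclideanreal (\<rho> c)"
proof -
  have "continuous_map X (prod_topology X X) (\<lambda>x. (c, x))"
    using assms(2) by (simp add: continuous_map_pairwise o_def)
  moreover have "continuous_map (prod_topology X X) euclideanreal (\<lambda>(x, y). \<rho> x y)"
    using assms(1) by (simp add: continuous_pseudometric_def)
  ultimately show ?thesis
    using continuous_map_compose by (fastforce simp: o_def)
qed

lemma continuous_pseudometric_bounded:
  assumes "compact_space X" "continuous_pseudometric X \<rho>"
  obtains C where "C \<ge> 0" "\<And>x y. x \<in> topspace X \<Longrightarrow> y \<in> topspace X \<Longrightarrow> \<rho> x y \<le> C"
proof -
  have "compact_space (prod_topology X X)"
    using assms(1) by (simp add: compact_space_prod_topology)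
  then have "compactin (prod_topology X X) (topspace X \<times> topspace X)"
    by (simp add: compact_space_def)
  then have "compactin euclideanreal ((\<lambda>(x, y). \<rho> x y) ` (topspace X \<times> topspace X))"
    using assms(2) unfolding continuous_pseudometric_def by (blast intro: image_compactin)
  then have "bounded ((\<lambda>(x, y). \<rho> x y) ` (topspace X \<times> topspace X))"
    by (simp add: compact_imp_bounded)
  then obtain C where C: "\<And>z. z \<in> (\<lambda>(x, y). \<rho> x y) ` (topspace X \<times> topspace X) \<Longrightarrow> norm z \<le> C"
    by (meson bounded_iff)
  show thesis
  proof (rule that[of "\<bar>C\<bar>"])
    show "\<rho> x y \<le> \<bar>C\<bar>" if "x \<in> topspace X" "y \<in> topspace X" for x y
      using C[of "\<rho> x y"] that by force
  qed simp
qed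

text \<open>The closed set where \<rho>' is at least \<eta> avoids the diagonal, so it is covered by
  the open sets \<open>r s > 1 / (n + 1)\<close>. A finite subcover yields both the finite
  \<open>K\<close> and the uniform \<theta>. The family is kept abstract: it will be the translates
  of \<rho> by the group, and later a single metric.\<close>

lemma separating_family_uniform:
  assumes X: "compact_space X" and \<rho>': "continuous_pseudometric X \<rho>'"
    and r: "\<And>s. s \<in> I \<Longrightarrow> continuous_map (prod_topology X X) euclideanreal (\<lambda>z. r s (fst z) (snd z))"
    and sep: "\<And>x y. x \<in> topspace X \<Longrightarrow> y \<in> topspace X \<Longrightarrow> x \<noteq> y \<Longrightarrow> \<exists>s\<in>I. r s x y > 0"
    and "\<eta> > 0"
  obtains K \<theta> where "K \<subseteq> I" "finite K" "\<theta> > 0"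
    "\<And>x y. x \<in> topspace X \<Longrightarrow> y \<in> topspace X \<Longrightarrow> \<forall>s\<in>K. r s x y < \<theta> \<Longrightarrow> \<rho>' x y < \<eta>"
proof -
  let ?P = "prod_topology X X"
  define Z where "Z = {z \<in> topspace ?P. (\<lambda>(x, y). \<rho>' x y) z \<in> {\<eta>..}}"
  define U where "U = (\<lambda>(s, n). {z \<in> topspace ?P. r s (fst z) (snd z) \<in> {1 / real (Suc n)<..}})"
  have "closedin ?P Z"
    unfolding Z_def by (rule closedin_continuous_map_preimage[where Y = euclideanreal])
      (use \<rho>' in \<open>auto simp: continuous_pseudometric_def\<close>)
  moreover have "compact_space ?P"
    using X by (simp add: compact_space_prod_topology)
  ultimately have "compactin ?P Z"
    by (rule closedin_compact_space[rotated])
  moreover have "openin ?P (U i)" if "i \<in> I \<times> UNIV" for i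
  proof -
    obtain s n where i: "i = (s, n)" "s \<in> I"
      using \<open>i \<in> I \<times> UNIV\<close> by auto
    have "openin euclideanreal {1 / real (Suc n)<..}"
      by simp
    with openin_continuous_map_preimage[OF r[OF i(2)]]
    show ?thesis
      unfolding U_def i(1) prod.case by blast
  qed
  moreover have "Z \<subseteq> \<Union> (U ` (I \<times> UNIV))"
  proof
    fix z assume z: "z \<in> Z"
    then obtain x y where xy: "z = (x, y)" "x \<in> topspace X" "y \<in> topspace X" "\<eta> \<le> \<rho>' x y"
      by (auto simp: Z_def)
    with \<rho>' \<open>\<eta> > 0\<close> have "x \<noteq> y"
      by (auto simp: continuous_pseudometric_def)
    with sep xy obtain s where s: "s \<in> I" "r s x y > 0"
      by blast
    then obtain n where "1 / real (Suc n) < r s x y"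
      using reals_Archimedean by (metis inverse_eq_divide)
    with s xy show "z \<in> \<Union> (U ` (I \<times> UNIV))"
      by (auto simp: U_def intro!: bexI[of _ s] exI[of _ n])
  qed
  ultimately obtain \<F> where "finite \<F>" "\<F> \<subseteq> U ` (I \<times> UNIV)" "Z \<subseteq> \<Union>\<F>"
    using compactinD[of ?P Z "U ` (I \<times> UNIV)"] by (metis (no_types, lifting) imageE)
  then obtain J where J: "finite J" "J \<subseteq> I \<times> UNIV" "Z \<subseteq> \<Union> (U ` J)"
    by (metis finite_subset_image)
  \<comment> \<open>The largest \<open>n\<close> of the subcover gives the smallest threshold;
    inserting 0 makes \<open>Max\<close> meaningful for an empty subcover.\<close>
  define N where "N = Max (insert 0 (snd ` J))"
  define K where "K = fst ` J"
  have "K \<subseteq> I" "finite K"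
    using J by (auto simp: K_def)
  moreover have "\<rho>' x y < \<eta>" if xy: "x \<in> topspace X" "y \<in> topspace X"
    and less: "\<forall>s\<in>K. r s x y < 1 / real (Suc N)" for x y
  proof (rule ccontr)
    assume "\<not> \<rho>' x y < \<eta>"
    then have "(x, y) \<in> Z" using xy by (auto simp: Z_def)
    then obtain s n where sn: "(s, n) \<in> J" "1 / real (Suc n) < r s x y"
      using J(3) by (auto simp: U_def)
    then have "s \<in> K" by (force simp: K_def)
    moreover have "n \<le> N"
      using sn J(1) by (auto simp: N_def intro!: Max_ge image_eqI[of _ _ "(s, n)"])
    then have "1 / real (Suc N) \<le> 1 / real (Suc n)"
      by (simp add: frac_le)
    ultimately show False using less sn by force
  qed
  ultimately show thesis
    by (intro that[of K "1 / real (Suc N)"]) auto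
qed

section \<open>Independence of the pseudometric\<close>

locale sofic_action =
  fixes G :: "('g, 'b) monoid_scheme"
    and X :: "'x topology"
    and \<alpha> :: "'g \<Rightarrow> 'x \<Rightarrow> 'x"
    and d :: "nat \<Rightarrow> nat"
    and \<sigma> :: "nat \<Rightarrow> 'g \<Rightarrow> nat \<Rightarrow> nat"
  assumes is_group: "group G"
    and sofic: "sofic_approximation G d \<sigma>"
    and compact: "compact_space X"
    and action: "group_action G (topspace X) \<alpha>"
    and continuous_action: "\<And>s. s \<in> carrier G \<Longrightarrow> continuous_map X X (\<alpha> s)"
begin

sublocale group G by (rule is_group)

lemma act_closed [simp]: "s \<in> carrier G \<Longrightarrow> x \<in> topspace X \<Longrightarrow> \<alpha> s x \<in> topspace X"
  using group_action.element_image[OF action] by blast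

lemma act_mult: "s \<in> carrier G \<Longrightarrow> t \<in> carrier G \<Longrightarrow> x \<in> topspace X \<Longrightarrow> \<alpha> (s \<otimes>\<^bsub>G\<^esub> t) x = \<alpha> s (\<alpha> t x)"
  using group_action.composition_rule[OF action] by blast

lemma act_one: "x \<in> topspace X \<Longrightarrow> \<alpha> \<one>\<^bsub>G\<^esub> x = x"
  using group_action.id_eq_one[OF action] by (metis restrict_apply)

lemma d_at_top: "filterlim d at_top sequentially"
  using sofic by (simp add: sofic_approximation_def)

lemma d_pos: "\<forall>\<^sub>F i in sequentially. d i > 0"
  using d_at_top[unfolded filterlim_at_top, rule_format, of 1] by (simp add: Suc_le_eq)

lemma permutes:
  assumes "s \<in> carrier G"
  shows "\<sigma> i s permutes {1..d i}"
proof -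
  have "\<sigma> i \<in> carrier G \<rightarrow> carrier (sym_group (d i))"
    using sofic[unfolded sofic_approximation_def, THEN conjunct1] by (rule spec)
  then have "\<sigma> i s \<in> carrier (sym_group (d i))"
    using assms by (rule Pi_mem)
  then show ?thesis
    unfolding sym_group_carrier .
qed

lemma permutes_closed: "s \<in> carrier G \<Longrightarrow> a \<in> {1..d i} \<Longrightarrow> \<sigma> i s a \<in> {1..d i}"
  using permutes_in_image[OF permutes] by blast

section \<open>Identities of the permutations outside sets of vanishing density\<close>

lemma proportion_mult_defect:
  assumes "s \<in> carrier G" "t \<in> carrier G"
  shows "(\<lambda>i. proportion (d i) (\<lambda>a. \<sigma> i (s \<otimes>\<^bsub>G\<^esub> t) a \<noteq> \<sigma> i s (\<sigma> i t a))) \<longlonglongrightarrow> 0"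
proof -
  have "(\<lambda>i. proportion (d i) (\<lambda>a. \<sigma> i (s \<otimes>\<^bsub>G\<^esub> t) a = \<sigma> i s (\<sigma> i t a))) \<longlonglongrightarrow> 1"
    using sofic assms by (simp add: sofic_approximation_def proportion_def)
  then have "(\<lambda>i. 1 - proportion (d i) (\<lambda>a. \<sigma> i (s \<otimes>\<^bsub>G\<^esub> t) a = \<sigma> i s (\<sigma> i t a))) \<longlonglongrightarrow> 1 - 1"
    by (intro tendsto_intros)
  moreover have "\<forall>\<^sub>F i in sequentially. 1 - proportion (d i) (\<lambda>a. \<sigma> i (s \<otimes>\<^bsub>G\<^esub> t) a = \<sigma> i s (\<sigma> i t a))
      = proportion (d i) (\<lambda>a. \<sigma> i (s \<otimes>\<^bsub>G\<^esub> t) a \<noteq> \<sigma> i s (\<sigma> i t a))"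
    using d_pos by eventually_elim (simp add: proportion_not)
  ultimately show ?thesis
    by (simp add: tendsto_cong)
qed

text \<open>Multiplicativity at the pair of units together with injectivity of the permutation of
  the unit shows that this permutation fixes most indices. Multiplicativity at \<open>s\<close> and
  its inverse then identifies it with the composition in question. \<open>U\<close> and
  \<open>V\<close> are the two exceptional sets.\<close>

lemma proportion_inv_defect:
  assumes "s \<in> carrier G"
  shows "(\<lambda>i. proportion (d i) (\<lambda>a. \<sigma> i s (\<sigma> i (inv\<^bsub>G\<^esub> s) a) \<noteq> a)) \<longlonglongrightarrow> 0"
proof -
  define U where "U i a \<longleftrightarrow> \<sigma> i \<one>\<^bsub>G\<^esub> a \<noteq> \<sigma> i \<one>\<^bsub>G\<^esub> (\<sigma> i \<one>\<^bsub>G\<^esub> a)" for i a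
  define V where "V i a \<longleftrightarrow> \<sigma> i \<one>\<^bsub>G\<^esub> a \<noteq> \<sigma> i s (\<sigma> i (inv\<^bsub>G\<^esub> s) a)" for i a
  have "(\<lambda>i. proportion (d i) (U i)) \<longlonglongrightarrow> 0"
    using proportion_mult_defect[of "\<one>\<^bsub>G\<^esub>" "\<one>\<^bsub>G\<^esub>"] by (simp add: U_def[abs_def])
  moreover have "(\<lambda>i. proportion (d i) (V i)) \<longlonglongrightarrow> 0"
    using proportion_mult_defect[of s "inv\<^bsub>G\<^esub> s"] assms by (simp add: V_def[abs_def])
  ultimately have lim: "(\<lambda>i. proportion (d i) (U i) + proportion (d i) (V i)) \<longlonglongrightarrow> 0"
    using tendsto_add[of _ 0 _ _ 0] by fastforce
  have "proportion (d i) (\<lambda>a. \<sigma> i s (\<sigma> i (inv\<^bsub>G\<^esub> s) a) \<noteq> a) \<le> proportion (d i) (U i) + proportion (d i) (V i)" for i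
  proof -
    have "proportion (d i) (\<lambda>a. \<sigma> i s (\<sigma> i (inv\<^bsub>G\<^esub> s) a) \<noteq> a) \<le> proportion (d i) (\<lambda>a. U i a \<or> V i a)"
    proof (rule proportion_mono)
      fix a assume "\<sigma> i s (\<sigma> i (inv\<^bsub>G\<^esub> s) a) \<noteq> a"
      then show "U i a \<or> V i a"
        unfolding U_def V_def using permutes_inj[OF permutes[OF one_closed]] by (metis injD)
    qed
    also have "\<dots> \<le> proportion (d i) (U i) + proportion (d i) (V i)"
      by (rule proportion_disj)
    finally show ?thesis .
  qed
  with lim show ?thesis
    by (intro tendsto_sandwich[OF _ _ tendsto_const lim]) (auto simp: proportion_nonneg)
qed

lemma continuous_map_pseudometric_orbit:
  assumes "continuous_pseudometric X \<rho>" "s \<in> carrier G"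
  shows "continuous_map (prod_topology X X) euclideanreal (\<lambda>z. \<rho> (\<alpha> s (fst z)) (\<alpha> s (snd z)))"
proof -
  have 1: "continuous_map (prod_topology X X) (prod_topology X X) (\<lambda>z. (\<alpha> s (fst z), \<alpha> s (snd z)))"
    using continuous_action[OF assms(2)]
    by (auto simp: continuous_map_pairwise o_def
        intro: continuous_map_compose[OF continuous_map_fst, unfolded o_def]
        continuous_map_compose[OF continuous_map_snd, unfolded o_def])
  have "continuous_map (prod_topology X X) euclideanreal (\<lambda>(x, y). \<rho> x y)"
    using assms(1) by (simp add: continuous_pseudometric_def)
  from continuous_map_compose[OF 1 this] show ?thesis
    by (simp add: o_def)
qed

lemma dyn_generating_uniform:
  assumes \<rho>: "continuous_pseudometric X \<rho>" and gen: "dyn_generating_pseudometric G X \<alpha> \<rho>"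
    and \<rho>': "continuous_pseudometric X \<rho>'" and "\<eta> > 0"
  shows "\<exists>K\<in>fin_subsets G. \<exists>\<theta>>0. \<forall>x\<in>topspace X. \<forall>y\<in>topspace X.
     (\<forall>s\<in>K. \<rho> (\<alpha> s x) (\<alpha> s y) < \<theta>) \<longrightarrow> \<rho>' x y < \<eta>"
proof -
  obtain K \<theta> where "K \<subseteq> carrier G" "finite K" "\<theta> > 0" and
    K: "\<And>x y. x \<in> topspace X \<Longrightarrow> y \<in> topspace X \<Longrightarrow> \<forall>s\<in>K. \<rho> (\<alpha> s x) (\<alpha> s y) < \<theta> \<Longrightarrow> \<rho>' x y < \<eta>"
  proof (rule separating_family_uniform[OF compact \<rho>' _ _ \<open>\<eta> > 0\<close>, where I = "carrier G" and r = "\<lambda>s x y. \<rho> (\<alpha> s x) (\<alpha> s y)"])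
    show "\<exists>s\<in>carrier G. 0 < \<rho> (\<alpha> s x) (\<alpha> s y)"
      if "x \<in> topspace X" "y \<in> topspace X" "x \<noteq> y" for x y
      using gen that by (simp add: dyn_generating_pseudometric_def)
  qed (use continuous_map_pseudometric_orbit[OF \<rho>] in auto)
  then show ?thesis
    \<comment> \<open>The unit is added because members of \<open>fin_subsets\<close> are nonempty;
      this only strengthens the smallness premise.\<close>
    by (intro bexI[of _ "insert \<one>\<^bsub>G\<^esub> K"] exI[of _ \<theta>]) (auto simp: fin_subsets_def)
qed

text \<open>The variant of \<open>Map_space\<close> in which equivariance is required in measure. It
  serves as the common parameter space of all model spaces.\<close>

definition approx_maps :: "('x \<Rightarrow> 'x \<Rightarrow> real) \<Rightarrow> 'g set \<Rightarrow> real \<Rightarrow> nat \<Rightarrow> (nat \<Rightarrow> 'x) set" where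
  "approx_maps \<rho> F \<eta> i =
     {\<phi> \<in> {1..d i} \<rightarrow>\<^sub>E topspace X. \<forall>s\<in>F. close_in_measure \<rho> (d i) \<eta> (\<phi> \<circ> \<sigma> i s) (\<alpha> s \<circ> \<phi>)}"

lemma approx_maps_antimono:
  "F' \<subseteq> F \<Longrightarrow> \<eta> \<le> \<eta>' \<Longrightarrow> approx_maps \<rho> F \<eta> i \<subseteq> approx_maps \<rho> F' \<eta>' i"
  unfolding approx_maps_def using close_in_measure_mono by blast

text \<open>For \<open>t\<close> in \<open>F'\<close> the points \<phi>(\<sigma>(t) a) and
  \<alpha>(t) \<phi>(a) must be \<rho>'-close. It suffices that their translates by each
  \<open>s\<close> in \<open>K\<close> are \<rho>-close, and both translates are near
  \<phi>(\<sigma>(s) \<sigma>(t) a): the first by equivariance at \<open>s\<close>, the second by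
  equivariance at the product \<open>st\<close> and multiplicativity of \<sigma>.\<close>

lemma approx_maps_change:
  assumes \<rho>: "continuous_pseudometric X \<rho>" and gen: "dyn_generating_pseudometric G X \<alpha> \<rho>"
    and \<rho>': "continuous_pseudometric X \<rho>'" and F': "F' \<in> fin_subsets G" and "\<eta>' > 0"
  shows "\<exists>F\<in>fin_subsets G. \<exists>\<eta>>0. \<forall>\<^sub>F i in sequentially. approx_maps \<rho> F \<eta> i \<subseteq> approx_maps \<rho>' F' \<eta>' i"
proof -
  obtain K \<theta> where K: "K \<in> fin_subsets G" and "\<theta> > 0"
    and K\<theta>: "\<And>x y. x \<in> topspace X \<Longrightarrow> y \<in> topspace X \<Longrightarrow> \<forall>s\<in>K. \<rho> (\<alpha> s x) (\<alpha> s y) < \<theta> \<Longrightarrow> \<rho>' x y < \<eta>'"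
    using dyn_generating_uniform[OF \<rho> gen \<rho>' \<open>\<eta>' > 0\<close>] by metis
  \<comment> \<open>Equivariance is used at \<open>s\<close> and at the products \<open>st\<close>,
    with \<open>s\<close> in \<open>K\<close> and \<open>t\<close> in \<open>F'\<close>.\<close>
  define F where "F = K \<union> (\<lambda>(s, t). s \<otimes>\<^bsub>G\<^esub> t) ` (K \<times> F')"
  \<comment> \<open>Two errors below \<eta> add up to less than \<theta>. Three bad sets for each
    \<open>s\<close> in \<open>K\<close> have total density at most 3/4 of \<eta>'.\<close>
  define \<eta> where "\<eta> = min (\<theta> / 2) (\<eta>' / (4 * real (card K)))"
  have cK: "real (card K) > 0" and finK: "finite K" and KG: "K \<subseteq> carrier G"
    using K by (auto simp: fin_subsets_def card_gt_0_iff)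
  have \<eta>: "\<eta> > 0" "\<eta> \<le> \<theta> / 2" "\<eta> \<le> \<eta>' / (4 * real (card K))"
    using \<open>\<theta> > 0\<close> \<open>\<eta>' > 0\<close> cK unfolding \<eta>_def by (simp_all only: min_less_iff_conj min.cobounded1 min.cobounded2) simp
  have FG: "F \<in> fin_subsets G"
    using K F' by (auto simp: F_def fin_subsets_def)
  \<comment> \<open>The only place of the comparison where \<open>i\<close> must be large: finitely
    many pairs have to be almost multiplicative at once.\<close>
  have "\<forall>\<^sub>F i in sequentially. \<forall>s\<in>K. \<forall>t\<in>F'. proportion (d i) (\<lambda>a. \<sigma> i (s \<otimes>\<^bsub>G\<^esub> t) a \<noteq> \<sigma> i s (\<sigma> i t a)) < \<eta>"
    using K F' order_tendstoD(2)[OF proportion_mult_defect \<eta>(1)]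
    by (intro eventually_ball_finite ballI) (auto simp: fin_subsets_def)
  then have "\<forall>\<^sub>F i in sequentially. approx_maps \<rho> F \<eta> i \<subseteq> approx_maps \<rho>' F' \<eta>' i"
  proof eventually_elim
    case (elim i)
    show ?case
    proof
      fix \<phi> assume \<phi>: "\<phi> \<in> approx_maps \<rho> F \<eta> i"
      then have \<phi>X: "\<And>a. a \<in> {1..d i} \<Longrightarrow> \<phi> a \<in> topspace X"
        by (auto simp: approx_maps_def)
      have "close_in_measure \<rho>' (d i) \<eta>' (\<phi> \<circ> \<sigma> i t) (\<alpha> t \<circ> \<phi>)" if t: "t \<in> F'" for t
      proof -
        have tG: "t \<in> carrier G" using t F' by (auto simp: fin_subsets_def)
        \<comment> \<open>Bad events: \<open>A\<close> is failure of equivariance at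
          \<open>s\<close>, observed at the index moved by \<open>t\<close>; \<open>B\<close> is
          failure of multiplicativity; \<open>E\<close> is failure of equivariance at the
          product.\<close>
        define A where "A s a \<longleftrightarrow> \<eta> \<le> \<rho> (\<phi> (\<sigma> i s (\<sigma> i t a))) (\<alpha> s (\<phi> (\<sigma> i t a)))" for s a
        define B where "B s a \<longleftrightarrow> \<sigma> i (s \<otimes>\<^bsub>G\<^esub> t) a \<noteq> \<sigma> i s (\<sigma> i t a)" for s a
        define E where "E s a \<longleftrightarrow> \<eta> \<le> \<rho> (\<phi> (\<sigma> i (s \<otimes>\<^bsub>G\<^esub> t) a)) (\<alpha> (s \<otimes>\<^bsub>G\<^esub> t) (\<phi> a))" for s a
        have "proportion (d i) (\<lambda>a. \<eta>' \<le> \<rho>' (\<phi> (\<sigma> i t a)) (\<alpha> t (\<phi> a)))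
            \<le> proportion (d i) (\<lambda>a. \<exists>s\<in>K. A s a \<or> B s a \<or> E s a)"
        proof (rule proportion_mono)
          fix a assume a: "a \<in> {1..d i}" and bad: "\<eta>' \<le> \<rho>' (\<phi> (\<sigma> i t a)) (\<alpha> t (\<phi> a))"
          have x: "\<phi> (\<sigma> i t a) \<in> topspace X" "\<phi> a \<in> topspace X"
            using \<phi>X a permutes_closed[OF tG] by auto
          with bad K\<theta>[of "\<phi> (\<sigma> i t a)" "\<alpha> t (\<phi> a)"] tG obtain s
            where s: "s \<in> K" and far: "\<theta> \<le> \<rho> (\<alpha> s (\<phi> (\<sigma> i t a))) (\<alpha> s (\<alpha> t (\<phi> a)))"
            by (meson act_closed not_le)
          have sG: "s \<in> carrier G" using s KG by auto
          have "A s a \<or> B s a \<or> E s a"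
          proof (rule ccontr)
            assume c: "\<not> (A s a \<or> B s a \<or> E s a)"
            let ?y = "\<phi> (\<sigma> i s (\<sigma> i t a))"
            have y: "?y \<in> topspace X"
              using \<phi>X a permutes_closed[OF tG] permutes_closed[OF sG] by blast
            have 1: "\<rho> ?y (\<alpha> s (\<phi> (\<sigma> i t a))) < \<eta>" and 2: "\<rho> ?y (\<alpha> s (\<alpha> t (\<phi> a))) < \<eta>"
              using c act_mult[OF sG tG x(2)] by (auto simp: A_def B_def E_def)
            have "\<rho> (\<alpha> s (\<phi> (\<sigma> i t a))) (\<alpha> s (\<alpha> t (\<phi> a)))
               \<le> \<rho> (\<alpha> s (\<phi> (\<sigma> i t a))) ?y + \<rho> ?y (\<alpha> s (\<alpha> t (\<phi> a)))"
              using \<rho> x y sG tG by (intro pseudometric_triangle) auto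
            also have "\<rho> (\<alpha> s (\<phi> (\<sigma> i t a))) ?y = \<rho> ?y (\<alpha> s (\<phi> (\<sigma> i t a)))"
              using \<rho> x y sG tG by (intro pseudometric_commute) auto
            finally show False using far 1 2 \<eta>(2) by linarith
          qed
          then show "\<exists>s\<in>K. A s a \<or> B s a \<or> E s a" using s by blast
        qed
        also have "\<dots> \<le> (\<Sum>s\<in>K. proportion (d i) (\<lambda>a. A s a \<or> B s a \<or> E s a))"
          by (rule proportion_bex[OF finK])
        also have "\<dots> \<le> (\<Sum>s\<in>K. 3 * \<eta>)"
        proof (rule sum_mono)
          fix s assume s: "s \<in> K"
          then have sG: "s \<in> carrier G" and "s \<in> F" and st: "s \<otimes>\<^bsub>G\<^esub> t \<in> F"
            using KG t by (auto simp: F_def)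
          \<comment> \<open>\<open>A s\<close> is the preimage under the permutation of
            \<open>t\<close> of the bad set of \<phi> at \<open>s\<close>, so it has the same
            density.\<close>
          have "proportion (d i) (A s) = proportion (d i) (\<lambda>a. \<eta> \<le> \<rho> (\<phi> (\<sigma> i s a)) (\<alpha> s (\<phi> a)))"
            unfolding A_def by (rule proportion_permutes[OF permutes[OF tG], where P = "\<lambda>a. \<eta> \<le> \<rho> (\<phi> (\<sigma> i s a)) (\<alpha> s (\<phi> a))"])
          also have "\<dots> < \<eta>"
            using \<phi> \<open>s \<in> F\<close> by (auto simp: approx_maps_def close_in_measure_def)
          finally have 1: "proportion (d i) (A s) < \<eta>" .
          have 2: "proportion (d i) (B s) < \<eta>"
            using elim s t unfolding B_def by blast
          have 3: "proportion (d i) (E s) < \<eta>"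
            using \<phi> st unfolding E_def by (auto simp: approx_maps_def close_in_measure_def)
          have "proportion (d i) (\<lambda>a. A s a \<or> B s a \<or> E s a)
              \<le> proportion (d i) (A s) + (proportion (d i) (B s) + proportion (d i) (E s))"
            by (rule order_trans[OF proportion_disj]) (intro add_left_mono proportion_disj)
          with 1 2 3 show "proportion (d i) (\<lambda>a. A s a \<or> B s a \<or> E s a) \<le> 3 * \<eta>"
            by linarith
        qed
        also have "\<dots> = 3 * (real (card K) * \<eta>)"
          by simp
        also have "real (card K) * \<eta> \<le> \<eta>' / 4"
          using \<eta>(3) cK by (simp add: field_simps)
        finally show ?thesis
          using \<open>\<eta>' > 0\<close> by (simp add: close_in_measure_def)
      qed
      with \<phi> show "\<phi> \<in> approx_maps \<rho>' F' \<eta>' i"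
        by (auto simp: approx_maps_def)
    qed
  qed
  with FG \<eta>(1) show ?thesis by blast
qed

text \<open>The chain \<alpha>(s) \<phi>(a), \<phi>(\<sigma>(s) a), \<psi>(\<sigma>(s) a),
  \<alpha>(s) \<psi>(a) has small steps for most \<open>a\<close>: the outer ones by equivariance,
  the middle one because \<sigma>(s) preserves densities. Hence \<rho> is small on all translates by
  \<open>K\<close> of the pair \<phi>(a), \<psi>(a). Products in the group do not occur, so the
  result holds for every \<open>i\<close>.\<close>

lemma close_in_measure_change:
  assumes \<rho>: "continuous_pseudometric X \<rho>" and gen: "dyn_generating_pseudometric G X \<alpha> \<rho>"
    and \<rho>': "continuous_pseudometric X \<rho>'" and "\<epsilon> > 0"
  shows "\<exists>F\<in>fin_subsets G. \<exists>\<eta>>0. \<forall>i. \<forall>\<phi>\<in>approx_maps \<rho> F \<eta> i. \<forall>\<psi>\<in>approx_maps \<rho> F \<eta> i.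
     close_in_measure \<rho> (d i) \<eta> \<phi> \<psi> \<longrightarrow> close_in_measure \<rho>' (d i) \<epsilon> \<phi> \<psi>"
proof -
  obtain K \<theta> where K: "K \<in> fin_subsets G" and "\<theta> > 0"
    and K\<theta>: "\<And>x y. x \<in> topspace X \<Longrightarrow> y \<in> topspace X \<Longrightarrow> \<forall>s\<in>K. \<rho> (\<alpha> s x) (\<alpha> s y) < \<theta> \<Longrightarrow> \<rho>' x y < \<epsilon>"
    using dyn_generating_uniform[OF \<rho> gen \<rho>' \<open>\<epsilon> > 0\<close>] by metis
  \<comment> \<open>Three steps of the chain share \<theta>; three bad sets for each
    \<open>s\<close> share \<epsilon>, the 4 leaving a strict inequality.\<close>
  define \<eta> where "\<eta> = min (\<theta> / 3) (\<epsilon> / (4 * real (card K)))"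
  have cK: "real (card K) > 0" and finK: "finite K" and KG: "K \<subseteq> carrier G"
    using K by (auto simp: fin_subsets_def card_gt_0_iff)
  have \<eta>: "\<eta> > 0" "\<eta> \<le> \<theta> / 3" "\<eta> \<le> \<epsilon> / (4 * real (card K))"
    using \<open>\<theta> > 0\<close> \<open>\<epsilon> > 0\<close> cK unfolding \<eta>_def by (simp_all only: min_less_iff_conj min.cobounded1 min.cobounded2) simp
  have "close_in_measure \<rho>' (d i) \<epsilon> \<phi> \<psi>"
    if \<phi>: "\<phi> \<in> approx_maps \<rho> K \<eta> i" and \<psi>: "\<psi> \<in> approx_maps \<rho> K \<eta> i"
      and cl: "close_in_measure \<rho> (d i) \<eta> \<phi> \<psi>" for i \<phi> \<psi>
  proof -
    have X: "\<phi> a \<in> topspace X" "\<psi> a \<in> topspace X" if "a \<in> {1..d i}" for a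
      using \<phi> \<psi> that by (auto simp: approx_maps_def)
    define A where "A s a \<longleftrightarrow> \<eta> \<le> \<rho> (\<phi> (\<sigma> i s a)) (\<alpha> s (\<phi> a))" for s a
    define B where "B s a \<longleftrightarrow> \<eta> \<le> \<rho> (\<psi> (\<sigma> i s a)) (\<alpha> s (\<psi> a))" for s a
    define E where "E s a \<longleftrightarrow> \<eta> \<le> \<rho> (\<phi> (\<sigma> i s a)) (\<psi> (\<sigma> i s a))" for s a
    have "proportion (d i) (\<lambda>a. \<epsilon> \<le> \<rho>' (\<phi> a) (\<psi> a)) \<le> proportion (d i) (\<lambda>a. \<exists>s\<in>K. A s a \<or> B s a \<or> E s a)"
    proof (rule proportion_mono)
      fix a assume a: "a \<in> {1..d i}" and bad: "\<epsilon> \<le> \<rho>' (\<phi> a) (\<psi> a)"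
      with K\<theta>[of "\<phi> a" "\<psi> a"] X obtain s
        where s: "s \<in> K" and far: "\<theta> \<le> \<rho> (\<alpha> s (\<phi> a)) (\<alpha> s (\<psi> a))"
        by (meson not_le)
      have sG: "s \<in> carrier G" using s KG by auto
      have a': "\<sigma> i s a \<in> {1..d i}"
        using permutes_closed[OF sG a] .
      have "A s a \<or> B s a \<or> E s a"
      proof (rule ccontr)
        assume c: "\<not> (A s a \<or> B s a \<or> E s a)"
        have "\<rho> (\<alpha> s (\<phi> a)) (\<alpha> s (\<psi> a)) \<le> \<rho> (\<alpha> s (\<phi> a)) (\<phi> (\<sigma> i s a)) + \<rho> (\<phi> (\<sigma> i s a)) (\<alpha> s (\<psi> a))"
          using \<rho> X[OF a] X[OF a'] sG by (intro pseudometric_triangle) auto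
        also have "\<rho> (\<phi> (\<sigma> i s a)) (\<alpha> s (\<psi> a)) \<le> \<rho> (\<phi> (\<sigma> i s a)) (\<psi> (\<sigma> i s a)) + \<rho> (\<psi> (\<sigma> i s a)) (\<alpha> s (\<psi> a))"
          using \<rho> X[OF a] X[OF a'] sG by (intro pseudometric_triangle) auto
        also have "\<rho> (\<alpha> s (\<phi> a)) (\<phi> (\<sigma> i s a)) = \<rho> (\<phi> (\<sigma> i s a)) (\<alpha> s (\<phi> a))"
          using \<rho> X[OF a] X[OF a'] sG by (intro pseudometric_commute) auto
        finally show False
          using far c \<eta>(2) unfolding A_def B_def E_def by linarith
      qed
      then show "\<exists>s\<in>K. A s a \<or> B s a \<or> E s a" using s by blast
    qed
    also have "\<dots> \<le> (\<Sum>s\<in>K. proportion (d i) (\<lambda>a. A s a \<or> B s a \<or> E s a))"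
      by (rule proportion_bex[OF finK])
    also have "\<dots> \<le> (\<Sum>s\<in>K. 3 * \<eta>)"
    proof (rule sum_mono)
      fix s assume s: "s \<in> K"
      then have sG: "s \<in> carrier G" using KG by auto
      have "proportion (d i) (E s) = proportion (d i) (\<lambda>a. \<eta> \<le> \<rho> (\<phi> a) (\<psi> a))"
        unfolding E_def by (rule proportion_permutes[OF permutes[OF sG], where P = "\<lambda>a. \<eta> \<le> \<rho> (\<phi> a) (\<psi> a)"])
      also have "\<dots> < \<eta>"
        using cl by (simp add: close_in_measure_def)
      finally have 1: "proportion (d i) (E s) < \<eta>" .
      have 2: "proportion (d i) (A s) < \<eta>" and 3: "proportion (d i) (B s) < \<eta>"
        using \<phi> \<psi> s unfolding A_def B_def by (auto simp: approx_maps_def close_in_measure_def)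
      have "proportion (d i) (\<lambda>a. A s a \<or> B s a \<or> E s a)
          \<le> proportion (d i) (A s) + (proportion (d i) (B s) + proportion (d i) (E s))"
        by (rule order_trans[OF proportion_disj]) (intro add_left_mono proportion_disj)
      with 1 2 3 show "proportion (d i) (\<lambda>a. A s a \<or> B s a \<or> E s a) \<le> 3 * \<eta>"
        by linarith
    qed
    also have "\<dots> = 3 * (real (card K) * \<eta>)"
      by simp
    also have "real (card K) * \<eta> \<le> \<epsilon> / 4"
      using \<eta>(3) cK by (simp add: field_simps)
    finally show ?thesis
      using \<open>\<epsilon> > 0\<close> by (simp add: close_in_measure_def)
  qed
  with K \<eta>(1) show ?thesis by blast
qed

section \<open>Model spaces parametrized by approximately equivariant maps\<close>

text \<open>
  The model spaces \<open>Y\<close> are, up to changing \<open>F\<close> and \<open>\<delta>\<close>, the images under \<open>R\<close> of the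
  maps that are approximately equivariant in measure, and \<open>R\<close> and its inverse are uniformly
  continuous.
\<close>

definition represented ::
    "('x \<Rightarrow> 'x \<Rightarrow> real) \<Rightarrow> ('g set \<Rightarrow> real \<Rightarrow> nat \<Rightarrow> 'm set) \<Rightarrow> (nat \<Rightarrow> 'm \<Rightarrow> 'm \<Rightarrow> real)
      \<Rightarrow> (nat \<Rightarrow> (nat \<Rightarrow> 'x) \<Rightarrow> 'm) \<Rightarrow> bool" where
  "represented \<rho> Y D R \<longleftrightarrow>
     (\<forall>F'\<in>fin_subsets G. \<forall>\<eta>>0. \<exists>F\<in>fin_subsets G. \<exists>\<delta>>0.
        \<forall>\<^sub>F i in sequentially. Y F \<delta> i \<subseteq> R i ` approx_maps \<rho> F' \<eta> i) \<and>
     (\<forall>F'\<in>fin_subsets G. \<forall>\<delta>>0. \<exists>F\<in>fin_subsets G. \<exists>\<eta>>0.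
        \<forall>\<^sub>F i in sequentially. R i ` approx_maps \<rho> F \<eta> i \<subseteq> Y F' \<delta> i) \<and>
     (\<forall>\<eta>>0. \<exists>\<epsilon>>0. \<forall>i. \<forall>\<phi>\<in>{1..d i} \<rightarrow>\<^sub>E topspace X. \<forall>\<psi>\<in>{1..d i} \<rightarrow>\<^sub>E topspace X.
        D i (R i \<phi>) (R i \<psi>) < \<epsilon> \<longrightarrow> close_in_measure \<rho> (d i) \<eta> \<phi> \<psi>) \<and>
     (\<forall>\<epsilon>>0. \<exists>\<eta>>0. \<forall>i. \<forall>\<phi>\<in>{1..d i} \<rightarrow>\<^sub>E topspace X. \<forall>\<psi>\<in>{1..d i} \<rightarrow>\<^sub>E topspace X.
        close_in_measure \<rho> (d i) \<eta> \<phi> \<psi> \<longrightarrow> D i (R i \<phi>) (R i \<psi>) < \<epsilon>)"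

lemma represented_subset_image:
  assumes "represented \<rho> Y D R" "F' \<in> fin_subsets G" "\<eta> > 0"
  obtains F \<delta> where "F \<in> fin_subsets G" "\<delta> > 0"
    "\<forall>\<^sub>F i in sequentially. Y F \<delta> i \<subseteq> R i ` approx_maps \<rho> F' \<eta> i"
  using assms(1)[unfolded represented_def, THEN conjunct1, rule_format, OF assms(2,3)] by blast

lemma represented_image_subset:
  assumes "represented \<rho> Y D R" "F' \<in> fin_subsets G" "\<delta> > 0"
  obtains F \<eta> where "F \<in> fin_subsets G" "\<eta> > 0"
    "\<forall>\<^sub>F i in sequentially. R i ` approx_maps \<rho> F \<eta> i \<subseteq> Y F' \<delta> i"
  using assms(1)[unfolded represented_def, THEN conjunct2, THEN conjunct1, rule_format, OF assms(2,3)] by blast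

lemma represented_imp_close:
  assumes "represented \<rho> Y D R" "\<eta> > 0"
  obtains \<epsilon> where "\<epsilon> > 0"
    "\<And>i \<phi> \<psi>. \<phi> \<in> {1..d i} \<rightarrow>\<^sub>E topspace X \<Longrightarrow> \<psi> \<in> {1..d i} \<rightarrow>\<^sub>E topspace X \<Longrightarrow>
        D i (R i \<phi>) (R i \<psi>) < \<epsilon> \<Longrightarrow> close_in_measure \<rho> (d i) \<eta> \<phi> \<psi>"
  using assms(1)[unfolded represented_def, THEN conjunct2, THEN conjunct2, THEN conjunct1, THEN spec, THEN mp, OF assms(2)]
  apply (elim exE conjE)
  apply (rule that, assumption)
  apply (drule spec, drule (1) bspec, drule (1) bspec, erule (1) mp)
  done

lemma close_imp_represented:
  assumes "represented \<rho> Y D R" "\<epsilon> > 0"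
  obtains \<eta> where "\<eta> > 0"
    "\<And>i \<phi> \<psi>. \<phi> \<in> {1..d i} \<rightarrow>\<^sub>E topspace X \<Longrightarrow> \<psi> \<in> {1..d i} \<rightarrow>\<^sub>E topspace X \<Longrightarrow>
        close_in_measure \<rho> (d i) \<eta> \<phi> \<psi> \<Longrightarrow> D i (R i \<phi>) (R i \<psi>) < \<epsilon>"
  using assms(1)[unfolded represented_def, THEN conjunct2, THEN conjunct2, THEN conjunct2, THEN spec, THEN mp, OF assms(2)]
  apply (elim exE conjE)
  apply (rule that, assumption)
  apply (drule spec, drule (1) bspec, drule (1) bspec, erule (1) mp)
  done

lemma close_in_measure_self:
  assumes "continuous_pseudometric X \<rho>" "\<phi> \<in> {1..d i} \<rightarrow>\<^sub>E topspace X" "\<eta> > 0"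
  shows "close_in_measure \<rho> (d i) \<eta> \<phi> \<phi>"
proof -
  have "proportion (d i) (\<lambda>a. \<eta> \<le> \<rho> (\<phi> a) (\<phi> a)) \<le> proportion (d i) (\<lambda>a. False)"
    using assms by (intro proportion_mono) (auto simp: pseudometric_self PiE_iff)
  with assms(3) show ?thesis
    by (simp add: close_in_measure_def proportion_def)
qed

text \<open>A model in \<open>Y\<close> is pulled back to an approximately equivariant map and
  pushed forward to \<open>Y'\<close>. If two images were \<epsilon>'-close, the maps would be close
  in measure for \<rho>', hence for \<rho>, and the original models \<epsilon>-close. Exchanging the
  roles gives the reverse inequality.\<close>

theorem sofic_growth_le_represented:
  assumes \<rho>: "continuous_pseudometric X \<rho>" and gen: "dyn_generating_pseudometric G X \<alpha> \<rho>"
    and \<rho>': "continuous_pseudometric X \<rho>'" and gen': "dyn_generating_pseudometric G X \<alpha> \<rho>'"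
    and R: "represented \<rho> Y D R" and R': "represented \<rho>' Y' D' R'"
  shows "sofic_growth G d Y D \<le> sofic_growth G d Y' D'"
proof (rule sofic_growth_le[OF d_at_top])
  fix \<epsilon> :: real assume "\<epsilon> > 0"
  with R obtain \<eta>1 where "\<eta>1 > 0"
    and \<eta>1: "\<And>i \<phi> \<psi>. \<phi> \<in> {1..d i} \<rightarrow>\<^sub>E topspace X \<Longrightarrow> \<psi> \<in> {1..d i} \<rightarrow>\<^sub>E topspace X \<Longrightarrow>
        close_in_measure \<rho> (d i) \<eta>1 \<phi> \<psi> \<Longrightarrow> D i (R i \<phi>) (R i \<psi>) < \<epsilon>"
    by (rule close_imp_represented) blast
  \<comment> \<open>\<open>F2\<close> and \<eta>2 depend on \<epsilon> only, and therefore so does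
    \<epsilon>', as the order of quantifiers demands.\<close>
  obtain F2 \<eta>2 where F2: "F2 \<in> fin_subsets G" "\<eta>2 > 0"
    and close: "\<And>i \<phi> \<psi>. \<phi> \<in> approx_maps \<rho>' F2 \<eta>2 i \<Longrightarrow> \<psi> \<in> approx_maps \<rho>' F2 \<eta>2 i \<Longrightarrow>
     close_in_measure \<rho>' (d i) \<eta>2 \<phi> \<psi> \<Longrightarrow> close_in_measure \<rho> (d i) \<eta>1 \<phi> \<psi>"
    using close_in_measure_change[OF \<rho>' gen' \<rho> \<open>\<eta>1 > 0\<close>] by metis
  from R' \<open>\<eta>2 > 0\<close> obtain \<epsilon>' where "\<epsilon>' > 0"
    and \<epsilon>': "\<And>i \<phi> \<psi>. \<phi> \<in> {1..d i} \<rightarrow>\<^sub>E topspace X \<Longrightarrow> \<psi> \<in> {1..d i} \<rightarrow>\<^sub>E topspace X \<Longrightarrow>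
        D' i (R' i \<phi>) (R' i \<psi>) < \<epsilon>' \<Longrightarrow> close_in_measure \<rho>' (d i) \<eta>2 \<phi> \<psi>"
    by (rule represented_imp_close) blast
  \<comment> \<open>Needed only to see that \<open>D'\<close> is below \<epsilon>' on the diagonal,
    so that far images are distinct.\<close>
  from R' \<open>\<epsilon>' > 0\<close> obtain \<eta>0 where "\<eta>0 > 0"
    and \<eta>0: "\<And>i \<phi> \<psi>. \<phi> \<in> {1..d i} \<rightarrow>\<^sub>E topspace X \<Longrightarrow> \<psi> \<in> {1..d i} \<rightarrow>\<^sub>E topspace X \<Longrightarrow>
        close_in_measure \<rho>' (d i) \<eta>0 \<phi> \<psi> \<Longrightarrow> D' i (R' i \<phi>) (R' i \<psi>) < \<epsilon>'"
    by (rule close_imp_represented) blast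
  show "\<exists>\<epsilon>'>0. \<forall>F'\<in>fin_subsets G. \<forall>\<delta>'>0. \<exists>F\<in>fin_subsets G. \<exists>\<delta>>0.
       \<forall>\<^sub>F i in sequentially. d i > 0 \<longrightarrow> sep_num \<epsilon> (Y F \<delta> i) (D i) \<le> sep_num \<epsilon>' (Y' F' \<delta>' i) (D' i)"
  proof (intro exI conjI ballI allI impI)
    fix F' \<delta>' assume F': "F' \<in> fin_subsets G" and "0 < (\<delta>' :: real)"
    then obtain F3 \<eta>3 where F3: "F3 \<in> fin_subsets G" "\<eta>3 > 0"
      and ev3: "\<forall>\<^sub>F i in sequentially. R' i ` approx_maps \<rho>' F3 \<eta>3 i \<subseteq> Y' F' \<delta>' i"
        using represented_image_subset[OF R'] by blast
    \<comment> \<open>The pulled back maps must meet two demands: those of \<open>F2\<close>, which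
      make their distances comparable, and those of \<open>F3\<close>, which send them into
      \<open>Y'\<close>.\<close>
    have F4: "F2 \<union> F3 \<in> fin_subsets G" and "min \<eta>2 \<eta>3 > 0"
      using F2 F3 by (auto simp: fin_subsets_def)
    obtain F5 \<eta>5 where F5: "F5 \<in> fin_subsets G" "\<eta>5 > 0"
      and ev5: "\<forall>\<^sub>F i in sequentially. approx_maps \<rho> F5 \<eta>5 i \<subseteq> approx_maps \<rho>' (F2 \<union> F3) (min \<eta>2 \<eta>3) i"
      using approx_maps_change[OF \<rho> gen \<rho>' F4 \<open>min \<eta>2 \<eta>3 > 0\<close>] by metis
    obtain F \<delta> where F: "F \<in> fin_subsets G" "\<delta> > 0"
      and ev: "\<forall>\<^sub>F i in sequentially. Y F \<delta> i \<subseteq> R i ` approx_maps \<rho> F5 \<eta>5 i"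
        using represented_subset_image[OF R F5] by blast
    from ev ev3 ev5 have "\<forall>\<^sub>F i in sequentially. d i > 0 \<longrightarrow> sep_num \<epsilon> (Y F \<delta> i) (D i) \<le> sep_num \<epsilon>' (Y' F' \<delta>' i) (D' i)"
    proof eventually_elim
      case (elim i)
      have sub2: "approx_maps \<rho>' (F2 \<union> F3) (min \<eta>2 \<eta>3) i \<subseteq> approx_maps \<rho>' F2 \<eta>2 i"
        and sub3: "approx_maps \<rho>' (F2 \<union> F3) (min \<eta>2 \<eta>3) i \<subseteq> approx_maps \<rho>' F3 \<eta>3 i"
        by (intro approx_maps_antimono; simp)+
      \<comment> \<open>Any choice of preimages will do: two preimages of distinct models are
        compared only through their images under \<open>R\<close>.\<close>
      define g where "g = inv_into (approx_maps \<rho> F5 \<eta>5 i) (R i)"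
      have g: "g x \<in> approx_maps \<rho> F5 \<eta>5 i" and Rg: "R i (g x) = x" if "x \<in> Y F \<delta> i" for x
        using subsetD[OF elim(1) that] unfolding g_def by (rule inv_into_into, rule f_inv_into_f)
      have g2: "g x \<in> approx_maps \<rho>' F2 \<eta>2 i" and g3: "g x \<in> approx_maps \<rho>' F3 \<eta>3 i"
        if "x \<in> Y F \<delta> i" for x
        using g[OF that] elim(3) sub2 sub3 by blast+
      have gX: "g x \<in> {1..d i} \<rightarrow>\<^sub>E topspace X" if "x \<in> Y F \<delta> i" for x
        using g2[OF that] by (simp add: approx_maps_def)
      have far: "D' i (R' i (g x)) (R' i (g y)) \<ge> \<epsilon>'"
        if xy: "x \<in> Y F \<delta> i" "y \<in> Y F \<delta> i" and D: "D i x y \<ge> \<epsilon>" for x y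
      proof (rule ccontr)
        assume "\<not> D' i (R' i (g x)) (R' i (g y)) \<ge> \<epsilon>'"
        then have "close_in_measure \<rho>' (d i) \<eta>2 (g x) (g y)"
          by (intro \<epsilon>' gX xy) simp
        then have "D i (R i (g x)) (R i (g y)) < \<epsilon>"
          by (intro \<eta>1 gX close g2 xy)
        with D show False by (simp add: Rg xy)
      qed
      have "sep_num \<epsilon> (Y F \<delta> i) (D i) \<le> sep_num \<epsilon>' (Y' F' \<delta>' i) (D' i)"
      proof (rule sep_num_le_map[of "\<lambda>x. R' i (g x)"])
        show "(\<lambda>x. R' i (g x)) ` Y F \<delta> i \<subseteq> Y' F' \<delta>' i"
          using elim(2) g3 by blast
        fix x y assume xy: "x \<in> Y F \<delta> i" "y \<in> Y F \<delta> i" "x \<noteq> y" "D i x y \<ge> \<epsilon>"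
        have "D' i (R' i (g x)) (R' i (g x)) < \<epsilon>'"
          by (intro \<eta>0 gX xy close_in_measure_self \<rho>' \<open>\<eta>0 > 0\<close>)
        with far[of x y] xy show "R' i (g x) \<noteq> R' i (g y) \<and> \<epsilon>' \<le> D' i (R' i (g x)) (R' i (g y))"
          by auto
      qed
      then show ?case ..
    qed
    with F show "\<exists>F\<in>fin_subsets G. \<exists>\<delta>>0. \<forall>\<^sub>F i in sequentially. d i > 0 \<longrightarrow>
        sep_num \<epsilon> (Y F \<delta> i) (D i) \<le> sep_num \<epsilon>' (Y' F' \<delta>' i) (D' i)"
      by blast
  qed (rule \<open>\<epsilon>' > 0\<close>)
qed

lemma represented_Map_space:
  assumes \<rho>: "continuous_pseudometric X \<rho>"
  shows "represented \<rho> (\<lambda>F \<delta> i. Map_space X \<alpha> \<rho> F \<delta> (d i) (\<sigma> i)) (\<lambda>i. rho2 \<rho> (d i)) (\<lambda>i \<phi>. \<phi>)"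
proof -
  obtain C where "C \<ge> 0" and C: "\<And>x y. x \<in> topspace X \<Longrightarrow> y \<in> topspace X \<Longrightarrow> \<rho> x y \<le> C"
    using continuous_pseudometric_bounded[OF compact \<rho>] by blast
  have sub: "\<exists>\<delta>>0. \<forall>i F. Map_space X \<alpha> \<rho> F \<delta> (d i) (\<sigma> i) \<subseteq> approx_maps \<rho> F \<eta> i" if "\<eta> > 0" for \<eta>
    using rho2_imp_close[OF that, of \<rho>] unfolding Map_space_def approx_maps_def by fast
  \<comment> \<open>Stated for all functions into the space, not just extensional ones, because it
    is also applied to \<phi> composed with a permutation and to \<alpha>(s) o \<phi>.\<close>
  have close: "\<exists>\<eta>>0. \<forall>i. \<forall>\<phi>\<in>{1..d i} \<rightarrow> topspace X. \<forall>\<psi>\<in>{1..d i} \<rightarrow> topspace X.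
      close_in_measure \<rho> (d i) \<eta> \<phi> \<psi> \<longrightarrow> rho2 \<rho> (d i) \<phi> \<psi> < \<epsilon>" if "\<epsilon> > 0" for \<epsilon>
  proof -
    note \<epsilon> = that
    obtain \<eta> where "\<eta> > 0" and \<eta>: "\<forall>d \<phi> \<psi>. (\<forall>a\<in>{1..d}. 0 \<le> \<rho> (\<phi> a) (\<psi> a) \<and> \<rho> (\<phi> a) (\<psi> a) \<le> C) \<longrightarrow>
     close_in_measure \<rho> d \<eta> \<phi> \<psi> \<longrightarrow> rho2 \<rho> d \<phi> \<psi> < \<epsilon>"
      using close_imp_rho2[OF \<epsilon> \<open>C \<ge> 0\<close>, of \<rho>] by blast
    show ?thesis
    proof (intro exI[of _ \<eta>] conjI allI ballI impI \<open>\<eta> > 0\<close>)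
      fix i \<phi> \<psi> assume "\<phi> \<in> {1..d i} \<rightarrow> topspace X" "\<psi> \<in> {1..d i} \<rightarrow> topspace X"
        and "close_in_measure \<rho> (d i) \<eta> \<phi> \<psi>"
      moreover from this have "\<forall>a\<in>{1..d i}. 0 \<le> \<rho> (\<phi> a) (\<psi> a) \<and> \<rho> (\<phi> a) (\<psi> a) \<le> C"
        using C pseudometric_nonneg[OF \<rho>] by (auto simp: Pi_iff)
      ultimately show "rho2 \<rho> (d i) \<phi> \<psi> < \<epsilon>"
        using \<eta> by blast
    qed
  qed
  have sup: "\<exists>\<eta>>0. \<forall>i. \<forall>F \<subseteq> carrier G. approx_maps \<rho> F \<eta> i \<subseteq> Map_space X \<alpha> \<rho> F \<delta> (d i) (\<sigma> i)"
    if "\<delta> > 0" for \<delta>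
  proof -
    obtain \<eta> where "\<eta> > 0" and \<eta>: "\<And>i \<phi> \<psi>. \<phi> \<in> {1..d i} \<rightarrow> topspace X \<Longrightarrow> \<psi> \<in> {1..d i} \<rightarrow> topspace X \<Longrightarrow>
      close_in_measure \<rho> (d i) \<eta> \<phi> \<psi> \<Longrightarrow> rho2 \<rho> (d i) \<phi> \<psi> < \<delta>"
      using close[OF \<open>\<delta> > 0\<close>] by metis
    show ?thesis
    proof (intro exI[of _ \<eta>] conjI allI impI subsetI \<open>\<eta> > 0\<close>)
      fix i F \<phi> assume F: "F \<subseteq> carrier G" and \<phi>: "\<phi> \<in> approx_maps \<rho> F \<eta> i"
      then have X: "\<phi> \<in> {1..d i} \<rightarrow>\<^sub>E topspace X"
        by (simp add: approx_maps_def)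
      have "rho2 \<rho> (d i) (\<phi> \<circ> \<sigma> i s) (\<alpha> s \<circ> \<phi>) < \<delta>" if "s \<in> F" for s
      proof (rule \<eta>)
        show "\<phi> \<circ> \<sigma> i s \<in> {1..d i} \<rightarrow> topspace X"
          using X permutes_closed[of s _ i] F that unfolding Pi_iff o_def by (blast dest: PiE_mem)
        show "\<alpha> s \<circ> \<phi> \<in> {1..d i} \<rightarrow> topspace X"
          using X F that by (auto simp: PiE_iff)
        show "close_in_measure \<rho> (d i) \<eta> (\<phi> \<circ> \<sigma> i s) (\<alpha> s \<circ> \<phi>)"
          using \<phi> that by (simp add: approx_maps_def)
      qed
      with X show "\<phi> \<in> Map_space X \<alpha> \<rho> F \<delta> (d i) (\<sigma> i)"
        by (simp add: Map_space_def)
    qed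
  qed
  show ?thesis
    unfolding represented_def image_ident
  proof (intro conjI ballI allI impI)
    fix F' and \<eta> :: real assume "F' \<in> fin_subsets G" "\<eta> > 0"
    with sub show "\<exists>F\<in>fin_subsets G. \<exists>\<delta>>0. \<forall>\<^sub>F i in sequentially.
        Map_space X \<alpha> \<rho> F \<delta> (d i) (\<sigma> i) \<subseteq> approx_maps \<rho> F' \<eta> i"
      by (metis (no_types, lifting) always_eventually)
  next
    fix F' and \<delta> :: real assume "F' \<in> fin_subsets G" "\<delta> > 0"
    moreover from this have "F' \<subseteq> carrier G" by (simp add: fin_subsets_def)
    ultimately show "\<exists>F\<in>fin_subsets G. \<exists>\<eta>>0. \<forall>\<^sub>F i in sequentially.
        approx_maps \<rho> F \<eta> i \<subseteq> Map_space X \<alpha> \<rho> F' \<delta> (d i) (\<sigma> i)"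
      using sup[of \<delta>] by (metis (no_types, lifting) always_eventually)
  next
    fix \<eta> :: real assume "\<eta> > 0"
    then show "\<exists>\<epsilon>>0. \<forall>i. \<forall>\<phi>\<in>{1..d i} \<rightarrow>\<^sub>E topspace X. \<forall>\<psi>\<in>{1..d i} \<rightarrow>\<^sub>E topspace X.
        rho2 \<rho> (d i) \<phi> \<psi> < \<epsilon> \<longrightarrow> close_in_measure \<rho> (d i) \<eta> \<phi> \<psi>"
      using rho2_imp_close[of \<eta> \<rho>] by blast
  next
    fix \<epsilon> :: real assume "\<epsilon> > 0"
    from close[OF this] obtain \<eta> where "\<eta> > 0" and \<eta>: "\<forall>i. \<forall>\<phi>\<in>{1..d i} \<rightarrow> topspace X.
        \<forall>\<psi>\<in>{1..d i} \<rightarrow> topspace X. close_in_measure \<rho> (d i) \<eta> \<phi> \<psi> \<longrightarrow> rho2 \<rho> (d i) \<phi> \<psi> < \<epsilon>"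
      by blast
    then show "\<exists>\<eta>>0. \<forall>i. \<forall>\<phi>\<in>{1..d i} \<rightarrow>\<^sub>E topspace X. \<forall>\<psi>\<in>{1..d i} \<rightarrow>\<^sub>E topspace X.
        close_in_measure \<rho> (d i) \<eta> \<phi> \<psi> \<longrightarrow> rho2 \<rho> (d i) \<phi> \<psi> < \<epsilon>"
      by (intro exI[of _ \<eta>]) (simp add: PiE_def)
  qed
qed

end

section \<open>The maximum distance\<close>

lemma continuous_pseudometric_totally_bounded:
  assumes "compact_space X" and \<rho>: "continuous_pseudometric X \<rho>" and "r > 0"
  obtains C where "finite C" "C \<subseteq> topspace X" "\<And>x. x \<in> topspace X \<Longrightarrow> \<exists>c\<in>C. \<rho> c x < r"
proof -
  define U where "U c = {x \<in> topspace X. \<rho> c x \<in> {..<r}}" for c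
  have "openin X (U c)" if "c \<in> topspace X" for c
    unfolding U_def using pseudometric_continuous_right[OF \<rho> that]
    by (rule openin_continuous_map_preimage) auto
  moreover have "topspace X \<subseteq> \<Union> (U ` topspace X)"
    using pseudometric_self[OF \<rho>] \<open>r > 0\<close> by (auto simp: U_def)
  moreover have "compactin X (topspace X)"
    using assms(1) by (simp add: compact_space_def)
  ultimately obtain \<F> where "finite \<F>" "\<F> \<subseteq> U ` topspace X" "topspace X \<subseteq> \<Union>\<F>"
    using compactinD[of X "topspace X" "U ` topspace X"] by (metis (no_types, lifting) imageE)
  then obtain C where C: "finite C" "C \<subseteq> topspace X" "topspace X \<subseteq> \<Union> (U ` C)"
    by (metis finite_subset_image)
  show thesis
    using C by (intro that[of C]) (auto simp: U_def)
qed

lemma rho2_le_rho_max: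
  assumes \<rho>: "continuous_pseudometric X \<rho>"
    and "\<phi> \<in> {1..d} \<rightarrow> topspace X" "\<psi> \<in> {1..d} \<rightarrow> topspace X" and "d > 0"
  shows "rho2 \<rho> d \<phi> \<psi> \<le> rho_max \<rho> d \<phi> \<psi>"
proof -
  let ?m = "rho_max \<rho> d \<phi> \<psi>"
  have le: "0 \<le> \<rho> (\<phi> a) (\<psi> a) \<and> \<rho> (\<phi> a) (\<psi> a) \<le> ?m" if "a \<in> {1..d}" for a
    using that assms unfolding rho_max_def by (auto intro!: pseudometric_nonneg[OF \<rho>] Max_ge simp: Pi_iff)
  have "0 \<le> ?m"
    using le[of 1] \<open>d > 0\<close> by simp
  have "(\<Sum>a\<in>{1..d}. (\<rho> (\<phi> a) (\<psi> a))\<^sup>2) \<le> (\<Sum>a\<in>{1..d}. ?m\<^sup>2)"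
    by (intro sum_mono power_mono) (use le in auto)
  then have "(\<Sum>a\<in>{1..d}. (\<rho> (\<phi> a) (\<psi> a))\<^sup>2) / real d \<le> ?m\<^sup>2"
    using \<open>d > 0\<close> by (simp add: field_simps)
  with \<open>0 \<le> ?m\<close> show ?thesis
    unfolding rho2_def by (simp add: real_le_lsqrt)
qed

text \<open>A maximal subset without \<open>P\<close>-related distinct elements cannot be enlarged.
  The disjunction appears because \<open>P\<close> need not be symmetric.\<close>

lemma maximal_separated_subset:
  assumes "finite A"
  obtains B where "B \<subseteq> A" "\<And>x y. x \<in> B \<Longrightarrow> y \<in> B \<Longrightarrow> x \<noteq> y \<Longrightarrow> \<not> P x y"
    "\<And>x. x \<in> A \<Longrightarrow> x \<notin> B \<Longrightarrow> \<exists>y\<in>B. P x y \<or> P y x"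
proof -
  let ?S = "{B. B \<subseteq> A \<and> (\<forall>x\<in>B. \<forall>y\<in>B. x \<noteq> y \<longrightarrow> \<not> P x y)}"
  have fin: "finite ?S" and ne: "?S \<noteq> {}"
    using assms by auto
  obtain B where B: "B \<in> ?S" and max: "\<forall>B'\<in>?S. B \<subseteq> B' \<longrightarrow> B = B'"
    using finite_has_maximal[OF fin ne] by (rule bexE)
  show thesis
  proof (rule that)
    fix x assume x: "x \<in> A" "x \<notin> B"
    show "\<exists>y\<in>B. P x y \<or> P y x"
    proof (rule ccontr)
      assume "\<not> ?thesis"
      with B x have "insert x B \<in> ?S" by auto
      from bspec[OF max this] x show False by blast
    qed
  qed (use B in auto)
qed

text \<open>A maximal \<epsilon>'-separated subset for \<open>rho2\<close> splits a
  \<open>rho_max\<close>-separated set into fibres, each of at most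
  \<open>exp (\<kappa> * d)\<close> elements. The fibre bound is a generating function estimate: all
  codes together weigh \<open>(1 + t * M) ^ d\<close>, at most
  \<open>exp (\<kappa> / 2 * d)\<close>, while each code that occurs weighs at least
  \<open>exp (- (\<kappa> / 2) * d)\<close>. No binomial coefficient has to be estimated.\<close>

lemma sep_num_rho_max_le:
  assumes X: "compact_space X" and \<rho>: "continuous_pseudometric X \<rho>" and "\<epsilon> > 0" "\<kappa> > 0"
  shows "\<exists>\<epsilon>'>0. \<forall>d Y. d > 0 \<longrightarrow> Y \<subseteq> {1..d} \<rightarrow>\<^sub>E topspace X \<longrightarrow>
    sep_num \<epsilon> Y (rho_max \<rho> d) \<le> ereal (exp (\<kappa> * real d)) * sep_num \<epsilon>' Y (rho2 \<rho> d)"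
proof -
  obtain C where "finite C" and CX: "C \<subseteq> topspace X" and C: "\<And>x. x \<in> topspace X \<Longrightarrow> \<exists>c\<in>C. \<rho> c x < \<epsilon> / 2"
    using continuous_pseudometric_totally_bounded[OF X \<rho>, of "\<epsilon> / 2"] \<open>\<epsilon> > 0\<close> by (metis half_gt_zero)
  define cell where "cell x = (SOME c. c \<in> C \<and> \<rho> c x < \<epsilon> / 2)" for x
  have cell: "cell x \<in> C" "\<rho> (cell x) x < \<epsilon> / 2" if "x \<in> topspace X" for x
    using someI_ex[of "\<lambda>c. c \<in> C \<and> \<rho> c x < \<epsilon> / 2"] C[OF that] unfolding cell_def by blast+
  define M where "M = real (card C)"
  \<comment> \<open>Half of \<kappa> is spent on the total weight:
    \<open>1 + t * M \<le> exp (\<kappa> / 2)\<close>. Using \<open>M + 1\<close> covers the case of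
    no cells.\<close>
  define t where "t = min 1 (\<kappa> / (2 * (M + 1)))"
  have "M \<ge> 0" by (simp add: M_def)
  have t: "t > 0" "t \<le> 1" "t * M \<le> \<kappa> / 2"
  proof -
    show "t > 0" "t \<le> 1"
      using \<open>\<kappa> > 0\<close> \<open>M \<ge> 0\<close> by (auto simp: t_def)
    have "t * M \<le> \<kappa> / (2 * (M + 1)) * (M + 1)"
      using \<open>\<kappa> > 0\<close> \<open>M \<ge> 0\<close> by (intro mult_mono) (auto simp: t_def)
    also have "\<dots> = \<kappa> / 2"
      using \<open>M \<ge> 0\<close> by (simp add: field_simps)
    finally show "t * M \<le> \<kappa> / 2" .
  qed
  \<comment> \<open>The other half is spent on bad coordinates: with density at most
    \<open>l\<close> they contribute at least \<open>exp (- (\<kappa> / 2) * d)\<close>. Since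
    \<open>t\<close> may be 1, the denominator contains \<open>1 - ln t\<close> in place of
    \<open>- ln t\<close>.\<close>
  define l where "l = \<kappa> / (2 * (1 - ln t))"
  have "ln t \<le> 0" using t by simp
  then have l: "l > 0" "- (\<kappa> / 2) \<le> l * ln t"
    using \<open>\<kappa> > 0\<close> by (auto simp: l_def field_simps)
  \<comment> \<open>The bound \<epsilon>/4 keeps two maps with the same good coordinate within
    \<epsilon>/2 there; \<open>l\<close> limits the density of bad coordinates.\<close>
  define \<eta> where "\<eta> = min (\<epsilon> / 4) l"
  have "\<eta> > 0" using l \<open>\<epsilon> > 0\<close> by (simp add: \<eta>_def)
  have \<eta>: "\<eta> \<le> \<epsilon> / 4" "\<eta> \<le> l" by (simp_all add: \<eta>_def)
  obtain \<epsilon>' where "\<epsilon>' > 0" and \<epsilon>': "\<And>d \<phi> \<psi>. rho2 \<rho> d \<phi> \<psi> < \<epsilon>' \<Longrightarrow> close_in_measure \<rho> d \<eta> \<phi> \<psi>"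
    using rho2_imp_close[OF \<open>\<eta> > 0\<close>, of \<rho>] by blast
  have fibre: "real (card S) \<le> exp (\<kappa> * real d)"
    if "d > 0" and "finite S" and SX: "S \<subseteq> {1..d} \<rightarrow>\<^sub>E topspace X" and \<psi>: "\<psi> \<in> {1..d} \<rightarrow>\<^sub>E topspace X"
      and sep: "\<And>\<phi> \<phi>'. \<phi> \<in> S \<Longrightarrow> \<phi>' \<in> S \<Longrightarrow> \<phi> \<noteq> \<phi>' \<Longrightarrow> \<epsilon> \<le> rho_max \<rho> d \<phi> \<phi>'"
      and near: "\<And>\<phi>. \<phi> \<in> S \<Longrightarrow> close_in_measure \<rho> d \<eta> \<phi> \<psi>" for d S \<psi>
  proof -
    \<comment> \<open>Good coordinates are pinned down by \<psi> and need no record; at a bad one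
      the center of a ball of radius \<epsilon>/2 is kept. Equal codes thus force distance below
      \<epsilon> at every coordinate, so the code is injective on \<open>S\<close>.\<close>
    define code where "code \<phi> = (\<lambda>a\<in>{1..d}. if \<eta> \<le> \<rho> (\<phi> a) (\<psi> a) then Some (cell (\<phi> a)) else None)" for \<phi>
    define w where "w v = (if v = None then 1 else t)" for v :: "'a option"
    let ?V = "insert None (Some ` C)"
    have mem: "\<phi> a \<in> topspace X" "\<psi> a \<in> topspace X" if "\<phi> \<in> S" "a \<in> {1..d}" for \<phi> a
      using PiE_mem[OF subsetD[OF SX that(1)] that(2)] PiE_mem[OF \<psi> that(2)] .
    have "inj_on code S"
    proof (rule inj_onI, rule ccontr)
      fix \<phi> \<phi>' assume S: "\<phi> \<in> S" "\<phi>' \<in> S" and eq: "code \<phi> = code \<phi>'" and ne: "\<phi> \<noteq> \<phi>'"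
      have "\<rho> (\<phi> a) (\<phi>' a) < \<epsilon>" if a: "a \<in> {1..d}" for a
      proof (cases "\<eta> \<le> \<rho> (\<phi> a) (\<psi> a)")
        case True
        then have c: "cell (\<phi> a) = cell (\<phi>' a)"
          using fun_cong[OF eq, of a] a by (auto simp: code_def split: if_splits)
        have "\<rho> (\<phi> a) (\<phi>' a) \<le> \<rho> (\<phi> a) (cell (\<phi> a)) + \<rho> (cell (\<phi> a)) (\<phi>' a)"
          using mem S a cell CX by (intro pseudometric_triangle[OF \<rho>]) auto
        also have "\<rho> (\<phi> a) (cell (\<phi> a)) = \<rho> (cell (\<phi> a)) (\<phi> a)"
          using mem S a cell CX by (intro pseudometric_commute[OF \<rho>]) auto
        finally show ?thesis
          using cell(2)[of "\<phi> a"] cell(2)[of "\<phi>' a"] mem S a c by fastforce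
      next
        case False
        then have F': "\<not> \<eta> \<le> \<rho> (\<phi>' a) (\<psi> a)"
          using fun_cong[OF eq, of a] a by (auto simp: code_def split: if_splits)
        have "\<rho> (\<phi> a) (\<phi>' a) \<le> \<rho> (\<phi> a) (\<psi> a) + \<rho> (\<psi> a) (\<phi>' a)"
          using mem S a by (intro pseudometric_triangle[OF \<rho>]) auto
        also have "\<rho> (\<psi> a) (\<phi>' a) = \<rho> (\<phi>' a) (\<psi> a)"
          using mem S a by (intro pseudometric_commute[OF \<rho>]) auto
        finally show ?thesis
          using False F' \<eta>(1) \<open>\<epsilon> > 0\<close> by linarith
      qed
      then have "rho_max \<rho> d \<phi> \<phi>' < \<epsilon>"
        unfolding rho_max_def using \<open>d > 0\<close> by (subst Max_less_iff) auto
      with sep[OF S ne] show False by simp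
    qed
    have codeE: "code ` S \<subseteq> PiE {1..d} (\<lambda>_. ?V)"
      using mem cell by (auto simp: code_def)
    have weight: "exp (- (\<kappa> / 2) * real d) \<le> (\<Prod>a\<in>{1..d}. w (code \<phi> a))" if "\<phi> \<in> S" for \<phi>
    proof -
      let ?J = "{a \<in> {1..d}. \<eta> \<le> \<rho> (\<phi> a) (\<psi> a)}"
      have "(\<Prod>a\<in>{1..d}. w (code \<phi> a)) = (\<Prod>a\<in>{1..d}. if \<eta> \<le> \<rho> (\<phi> a) (\<psi> a) then t else 1)"
        by (intro prod.cong) (auto simp: code_def w_def)
      also have "\<dots> = t ^ card ?J"
        by (simp add: prod.If_cases Int_def)
      also have "\<dots> = exp (real (card ?J) * ln t)"
        using t by (simp add: exp_of_nat_mult)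
      finally have eq: "(\<Prod>a\<in>{1..d}. w (code \<phi> a)) = exp (real (card ?J) * ln t)" .
      have "proportion d (\<lambda>a. \<eta> \<le> \<rho> (\<phi> a) (\<psi> a)) \<le> l"
        using near[OF that] \<eta> by (simp add: close_in_measure_def)
      then have "real (card ?J) \<le> l * real d"
        using \<open>d > 0\<close> by (simp add: proportion_def field_simps)
      then have "l * real d * ln t \<le> real (card ?J) * ln t"
        using \<open>ln t \<le> 0\<close> by (rule mult_right_mono_neg)
      moreover have "- (\<kappa> / 2) * real d \<le> l * ln t * real d"
        using l by (intro mult_right_mono) auto
      ultimately show ?thesis
        unfolding eq by (simp add: mult_ac)
    qed
    \<comment> \<open>The weights of the occurring codes are dominated by those of all words over
      \<open>?V\<close>, whose sum factorizes over the coordinates.\<close>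
    have "real (card S) * exp (- (\<kappa> / 2) * real d) = (\<Sum>\<phi>\<in>S. exp (- (\<kappa> / 2) * real d))"
      by simp
    also have "\<dots> \<le> (\<Sum>\<phi>\<in>S. \<Prod>a\<in>{1..d}. w (code \<phi> a))"
      by (intro sum_mono weight)
    also have "\<dots> = (\<Sum>g\<in>code ` S. \<Prod>a\<in>{1..d}. w (g a))"
      using \<open>inj_on code S\<close> by (simp add: sum.reindex)
    also have "\<dots> \<le> (\<Sum>g\<in>PiE {1..d} (\<lambda>_. ?V). \<Prod>a\<in>{1..d}. w (g a))"
      using codeE \<open>finite C\<close> t by (intro sum_mono2 prod_nonneg) (auto simp: w_def intro!: finite_PiE)
    also have "\<dots> = (\<Prod>a\<in>{1..d}. \<Sum>v\<in>?V. w v)"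
      using \<open>finite C\<close> by (subst prod_sum_PiE) auto
    also have "(\<Sum>v\<in>?V. w v) = 1 + t * M"
      using \<open>finite C\<close> by (simp add: w_def M_def sum.reindex image_iff)
    also have "(\<Prod>a\<in>{1..d}. 1 + t * M) \<le> (\<Prod>a\<in>{1..d}. exp (\<kappa> / 2))"
    proof (rule prod_mono)
      have "1 + t * M \<le> exp (t * M)" by (rule exp_ge_add_one_self)
      also have "\<dots> \<le> exp (\<kappa> / 2)" using t by simp
      finally show "0 \<le> 1 + t * M \<and> 1 + t * M \<le> exp (\<kappa> / 2)"
        using t \<open>M \<ge> 0\<close> by simp
    qed
    also have "\<dots> = exp (real d * (\<kappa> / 2))"
      by (simp only: prod_constant card_atLeastAtMost exp_of_nat_mult) simp
    finally have "real (card S) \<le> exp (real d * (\<kappa> / 2)) / exp (- (\<kappa> / 2) * real d)"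
      by (simp add: pos_le_divide_eq)
    also have "\<dots> = exp (\<kappa> * real d)"
      by (simp add: exp_diff[symmetric] field_simps)
    finally show ?thesis .
  qed
  have "sep_num \<epsilon> Y (rho_max \<rho> d) \<le> ereal (exp (\<kappa> * real d)) * sep_num \<epsilon>' Y (rho2 \<rho> d)"
    if "d > 0" and Y: "Y \<subseteq> {1..d} \<rightarrow>\<^sub>E topspace X" for d Y
    unfolding sep_num_def[of \<epsilon>]
  proof (rule SUP_least)
    fix A assume "A \<in> {A. A \<subseteq> Y \<and> finite A \<and> (\<forall>x\<in>A. \<forall>y\<in>A. x \<noteq> y \<longrightarrow> \<epsilon> \<le> rho_max \<rho> d x y)}"
    then have A: "A \<subseteq> Y" "finite A" and sep: "\<And>x y. x \<in> A \<Longrightarrow> y \<in> A \<Longrightarrow> x \<noteq> y \<Longrightarrow> \<epsilon> \<le> rho_max \<rho> d x y"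
      by auto
    obtain B where B: "B \<subseteq> A" and Bsep: "\<And>x y. x \<in> B \<Longrightarrow> y \<in> B \<Longrightarrow> x \<noteq> y \<Longrightarrow> \<not> rho2 \<rho> d x y < \<epsilon>'"
      and Bmax: "\<And>x. x \<in> A \<Longrightarrow> x \<notin> B \<Longrightarrow> \<exists>y\<in>B. rho2 \<rho> d x y < \<epsilon>' \<or> rho2 \<rho> d y x < \<epsilon>'"
      using maximal_separated_subset[OF A(2), of "\<lambda>x y. rho2 \<rho> d x y < \<epsilon>'"] by blast
    have mem: "x a \<in> topspace X" if "x \<in> A" "a \<in> {1..d}" for x a
      using that A Y by (meson PiE_mem subsetD)
    have commute: "rho2 \<rho> d x y = rho2 \<rho> d y x" if "x \<in> A" "y \<in> A" for x y
    proof -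
      have "(\<Sum>a\<in>{1..d}. (\<rho> (x a) (y a))\<^sup>2) = (\<Sum>a\<in>{1..d}. (\<rho> (y a) (x a))\<^sup>2)"
        using pseudometric_commute[OF \<rho> mem mem] that by (intro sum.cong) auto
      then show ?thesis by (simp add: rho2_def)
    qed
    define N where "N y = {x \<in> A. rho2 \<rho> d x y < \<epsilon>'}" for y
    have "rho2 \<rho> d x x = 0" if "x \<in> A" for x
      using mem[OF that] pseudometric_self[OF \<rho>] by (simp add: rho2_def)
    note self = this
    have "A \<subseteq> (\<Union>y\<in>B. N y)"
    proof
      fix x assume x: "x \<in> A"
      show "x \<in> (\<Union>y\<in>B. N y)"
      proof (cases "x \<in> B")
        case True
        then show ?thesis
          using self[OF x] x \<open>\<epsilon>' > 0\<close> by (intro UN_I[of x]) (simp_all add: N_def)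
      next
        case False
        with Bmax[OF x] obtain y where y: "y \<in> B" "rho2 \<rho> d x y < \<epsilon>' \<or> rho2 \<rho> d y x < \<epsilon>'"
          by blast
        moreover have "rho2 \<rho> d y x = rho2 \<rho> d x y"
          using y B x by (intro commute) auto
        ultimately show ?thesis
          using x by (intro UN_I[of y]) (simp_all add: N_def)
      qed
    qed
    moreover have "finite B"
      using B A finite_subset by blast
    moreover have "finite (N y)" for y
      using A by (simp add: N_def)
    ultimately have "card A \<le> (\<Sum>y\<in>B. card (N y))"
      by (intro order_trans[OF card_mono card_UN_le]) auto
    then have "real (card A) \<le> (\<Sum>y\<in>B. real (card (N y)))"
      by (metis of_nat_le_iff of_nat_sum)
    also have "\<dots> \<le> (\<Sum>y\<in>B. exp (\<kappa> * real d))"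
    proof (rule sum_mono, rule fibre[OF \<open>d > 0\<close>])
      fix y assume "y \<in> B"
      then show "y \<in> {1..d} \<rightarrow>\<^sub>E topspace X" using A B Y by auto
    qed (use A Y sep \<epsilon>' in \<open>auto simp: N_def\<close>)
    finally have le: "ereal (real (card A)) \<le> ereal (exp (\<kappa> * real d)) * ereal (real (card B))"
      by (simp add: mult.commute)
    have "B \<in> {A. A \<subseteq> Y \<and> finite A \<and> (\<forall>x\<in>A. \<forall>y\<in>A. x \<noteq> y \<longrightarrow> \<epsilon>' \<le> rho2 \<rho> d x y)}"
      using A B Bsep \<open>finite B\<close> by (auto simp: not_less)
    then have "ereal (real (card B)) \<le> sep_num \<epsilon>' Y (rho2 \<rho> d)"
      unfolding sep_num_def by (rule SUP_upper)
    then have "ereal (exp (\<kappa> * real d)) * ereal (real (card B)) \<le> ereal (exp (\<kappa> * real d)) * sep_num \<epsilon>' Y (rho2 \<rho> d)"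
      by (intro ereal_mult_left_mono) auto
    with le show "ereal (real (card A)) \<le> ereal (exp (\<kappa> * real d)) * sep_num \<epsilon>' Y (rho2 \<rho> d)"
      by (rule order_trans)
  qed
  with \<open>\<epsilon>' > 0\<close> show ?thesis by blast
qed

context sofic_action begin

text \<open>Both entropies use the same model spaces, so \<open>F\<close> and \<delta> are kept and
  only the separation numbers are compared: in one direction by \<open>rho2 \<le> rho_max\<close>,
  in the other with a factor of arbitrarily small exponential rate.\<close>

theorem spatial_entropy_2_eq_inf:
  assumes \<rho>: "continuous_pseudometric X \<rho>"
  shows "spatial_entropy_2 G X \<alpha> d \<sigma> \<rho> = spatial_entropy_inf G X \<alpha> d \<sigma> \<rho>"
  unfolding spatial_entropy_2_def spatial_entropy_inf_def
proof (rule antisym)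
  have sub: "Map_space X \<alpha> \<rho> F \<delta> (d i) (\<sigma> i) \<subseteq> {1..d i} \<rightarrow>\<^sub>E topspace X" for F \<delta> i
    by (auto simp: Map_space_def)
  show "sofic_growth G d (\<lambda>F \<delta> i. Map_space X \<alpha> \<rho> F \<delta> (d i) (\<sigma> i)) (\<lambda>i. rho2 \<rho> (d i))
      \<le> sofic_growth G d (\<lambda>F \<delta> i. Map_space X \<alpha> \<rho> F \<delta> (d i) (\<sigma> i)) (\<lambda>i. rho_max \<rho> (d i))"
  proof (rule sofic_growth_le[OF d_at_top], intro exI conjI ballI allI impI)
    fix \<epsilon> :: real and F' and \<delta>' :: real assume \<epsilon>: "\<epsilon> > 0" and F': "F' \<in> fin_subsets G" "\<delta>' > 0"
    let ?Y = "\<lambda>i. Map_space X \<alpha> \<rho> F' \<delta>' (d i) (\<sigma> i)"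
    have "sep_num \<epsilon> (?Y i) (rho2 \<rho> (d i)) \<le> sep_num \<epsilon> (?Y i) (rho_max \<rho> (d i))" if "d i > 0" for i
    proof (rule sep_num_le_map[of "\<lambda>x. x"])
      fix x y assume "x \<in> ?Y i" "y \<in> ?Y i" and xy: "x \<noteq> y" "\<epsilon> \<le> rho2 \<rho> (d i) x y"
      then have "rho2 \<rho> (d i) x y \<le> rho_max \<rho> (d i) x y"
        using sub[of F' \<delta>' i] that by (intro rho2_le_rho_max[OF \<rho>]) (auto simp: PiE_iff)
      with xy show "x \<noteq> y \<and> \<epsilon> \<le> rho_max \<rho> (d i) x y" by simp
    qed simp
    with F' show "\<exists>F\<in>fin_subsets G. \<exists>\<delta>>0. \<forall>\<^sub>F i in sequentially. 0 < d i \<longrightarrow>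
        sep_num \<epsilon> (Map_space X \<alpha> \<rho> F \<delta> (d i) (\<sigma> i)) (rho2 \<rho> (d i)) \<le> sep_num \<epsilon> (?Y i) (rho_max \<rho> (d i))"
      by (intro bexI[of _ F'] exI[of _ \<delta>'] conjI always_eventually allI impI) auto
  qed
  show "sofic_growth G d (\<lambda>F \<delta> i. Map_space X \<alpha> \<rho> F \<delta> (d i) (\<sigma> i)) (\<lambda>i. rho_max \<rho> (d i))
      \<le> sofic_growth G d (\<lambda>F \<delta> i. Map_space X \<alpha> \<rho> F \<delta> (d i) (\<sigma> i)) (\<lambda>i. rho2 \<rho> (d i))"
  proof (rule sofic_growth_le_exp[OF d_at_top])
    fix \<epsilon> \<kappa> :: real assume "\<epsilon> > 0" "\<kappa> > 0"
    from sep_num_rho_max_le[OF compact \<rho> this] obtain \<epsilon>' where "\<epsilon>' > 0"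
      and \<epsilon>': "\<And>d Y. d > 0 \<Longrightarrow> Y \<subseteq> {1..d} \<rightarrow>\<^sub>E topspace X \<Longrightarrow>
        sep_num \<epsilon> Y (rho_max \<rho> d) \<le> ereal (exp (\<kappa> * real d)) * sep_num \<epsilon>' Y (rho2 \<rho> d)"
      by blast
    show "\<exists>\<epsilon>'>0. \<forall>F'\<in>fin_subsets G. \<forall>\<delta>'>0. \<exists>F\<in>fin_subsets G. \<exists>\<delta>>0. \<forall>\<^sub>F i in sequentially. 0 < d i \<longrightarrow>
        sep_num \<epsilon> (Map_space X \<alpha> \<rho> F \<delta> (d i) (\<sigma> i)) (rho_max \<rho> (d i))
        \<le> ereal (exp (\<kappa> * real (d i))) * sep_num \<epsilon>' (Map_space X \<alpha> \<rho> F' \<delta>' (d i) (\<sigma> i)) (rho2 \<rho> (d i))"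
    proof (intro exI[of _ \<epsilon>'] conjI ballI allI impI)
      fix F' \<delta>' assume "F' \<in> fin_subsets G" "0 < (\<delta>' :: real)"
      then show "\<exists>F\<in>fin_subsets G. \<exists>\<delta>>0. \<forall>\<^sub>F i in sequentially. 0 < d i \<longrightarrow>
        sep_num \<epsilon> (Map_space X \<alpha> \<rho> F \<delta> (d i) (\<sigma> i)) (rho_max \<rho> (d i))
        \<le> ereal (exp (\<kappa> * real (d i))) * sep_num \<epsilon>' (Map_space X \<alpha> \<rho> F' \<delta>' (d i) (\<sigma> i)) (rho2 \<rho> (d i))"
        by (intro bexI[of _ F'] exI[of _ \<delta>'] conjI always_eventually allI impI \<epsilon>' sub)
    qed fact
  qed
qed

end

section \<open>The pseudometric of a sequence of functions\<close>

lemma restrict_in_cfun: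
  assumes "continuous_map X euclidean f"
  shows "(\<lambda>x\<in>topspace X. f x) \<in> cfun X"
  unfolding cfun_def using continuous_map_eq[OF assms, of "\<lambda>x\<in>topspace X. f x"] by simp

lemma cfun_continuous: "f \<in> cfun X \<Longrightarrow> continuous_map X euclidean f"
  by (simp add: cfun_def)

lemma cfun_add: "f \<in> cfun X \<Longrightarrow> g \<in> cfun X \<Longrightarrow> (\<lambda>x\<in>topspace X. f x + g x) \<in> cfun X"
  by (intro restrict_in_cfun continuous_map_add cfun_continuous)

lemma cfun_mult: "f \<in> cfun X \<Longrightarrow> g \<in> cfun X \<Longrightarrow> (\<lambda>x\<in>topspace X. f x * g x) \<in> cfun X"
  by (intro restrict_in_cfun) (auto simp: cfun_def continuous_map_atin intro: tendsto_mult)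

lemma cfun_scale: "f \<in> cfun X \<Longrightarrow> (\<lambda>x\<in>topspace X. c * f x) \<in> cfun X"
  by (intro restrict_in_cfun) (auto simp: cfun_def continuous_map_atin intro: tendsto_mult)

lemma cfun_cnj: "f \<in> cfun X \<Longrightarrow> (\<lambda>x\<in>topspace X. cnj (f x)) \<in> cfun X"
  by (intro restrict_in_cfun) (auto simp: cfun_def continuous_map_atin intro: tendsto_cnj)

lemma cfun_const: "(\<lambda>x\<in>topspace X. c) \<in> cfun X"
  by (intro restrict_in_cfun) simp

lemma cfun_of_real:
  assumes "continuous_map X euclideanreal f"
  shows "(\<lambda>x\<in>topspace X. complex_of_real (f x)) \<in> cfun X"
  by (intro restrict_in_cfun) (use assms in \<open>auto simp: continuous_map_atin intro: tendsto_of_real\<close>)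

text \<open>The value of \<open>rho_seq\<close> for \<open>d = 1\<close> on the evaluations at
  \<open>x\<close> and \<open>y\<close>. It allows the sequence to be treated as a pseudometric on
  the space.\<close>

definition seq_pseudometric :: "(nat \<Rightarrow> 'x \<Rightarrow> complex) \<Rightarrow> 'x \<Rightarrow> 'x \<Rightarrow> real" where
  "seq_pseudometric p x y = (\<Sum>n. (1/2) ^ Suc n * cmod (p n x - p n y))"

lemma sums_half: "(\<lambda>n. (1/2 :: real) ^ Suc n * c) sums c"
  using sums_mult[OF power_half_series, of c] by (simp add: mult_ac)

lemma summable_half:
  assumes "\<And>n. 0 \<le> c n" "\<And>n. c n \<le> (2 :: real)"
  shows "summable (\<lambda>n. (1/2) ^ Suc n * c n)" and "(\<Sum>n. (1/2) ^ Suc n * c n) \<le> 2"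
proof -
  show s: "summable (\<lambda>n. (1/2) ^ Suc n * c n)"
  proof (rule summable_comparison_test')
    show "summable (\<lambda>n. (1/2 :: real) ^ Suc n * 2)"
      using sums_half sums_summable by blast
    show "norm ((1/2) ^ Suc n * c n) \<le> (1/2) ^ Suc n * 2" for n
      using assms[of n] by (simp add: abs_mult)
  qed
  have "(\<Sum>n. (1/2) ^ Suc n * c n) \<le> (\<Sum>n. (1/2 :: real) ^ Suc n * 2)"
    using assms s sums_half sums_summable by (intro suminf_le) (auto intro!: mult_left_mono)
  also have "\<dots> = 2"
    using sums_half by (rule sums_unique[symmetric])
  finally show "(\<Sum>n. (1/2) ^ Suc n * c n) \<le> 2" .
qed

context
  fixes X :: "'x topology" and p :: "nat \<Rightarrow> 'x \<Rightarrow> complex"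
  assumes p: "real_unit_ball_seq X p"
begin

lemma unit_ball_seq_diff_le: "x \<in> topspace X \<Longrightarrow> y \<in> topspace X \<Longrightarrow> cmod (p n x - p n y) \<le> 2"
  using p norm_triangle_ineq4[of "p n x" "p n y"] unfolding real_unit_ball_seq_def by (smt (verit))

lemma seq_pseudometric_summable:
  "x \<in> topspace X \<Longrightarrow> y \<in> topspace X \<Longrightarrow> summable (\<lambda>n. (1/2) ^ Suc n * cmod (p n x - p n y))"
  by (rule summable_half) (auto intro: unit_ball_seq_diff_le)

lemma seq_pseudometric_le_2: "x \<in> topspace X \<Longrightarrow> y \<in> topspace X \<Longrightarrow> seq_pseudometric p x y \<le> 2"
  unfolding seq_pseudometric_def by (rule summable_half) (auto intro: unit_ball_seq_diff_le)

lemma continuous_pseudometric_seq: "continuous_pseudometric X (seq_pseudometric p)"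
  unfolding continuous_pseudometric_def
proof (intro conjI ballI)
  let ?P = "prod_topology X X"
  let ?f = "\<lambda>n z. (1/2) ^ Suc n * cmod (p n (fst z) - p n (snd z))"
  show "seq_pseudometric p x x = 0" for x
    by (simp add: seq_pseudometric_def)
  show "0 \<le> seq_pseudometric p x y" if "x \<in> topspace X" "y \<in> topspace X" for x y
    unfolding seq_pseudometric_def using seq_pseudometric_summable[OF that] by (intro suminf_nonneg) auto
  show "seq_pseudometric p x y = seq_pseudometric p y x" for x y
    by (simp add: seq_pseudometric_def norm_minus_commute)
  show "seq_pseudometric p x z \<le> seq_pseudometric p x y + seq_pseudometric p y z"
    if "x \<in> topspace X" "y \<in> topspace X" "z \<in> topspace X" for x y z
  proof -
    have "(1/2) ^ Suc n * cmod (p n x - p n z) \<le> (1/2) ^ Suc n * cmod (p n x - p n y) + (1/2) ^ Suc n * cmod (p n y - p n z)" for n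
      unfolding distrib_left[symmetric] using norm_triangle_ineq[of "p n x - p n y" "p n y - p n z"]
      by (intro mult_left_mono) auto
    then have "seq_pseudometric p x z \<le> (\<Sum>n. (1/2) ^ Suc n * cmod (p n x - p n y) + (1/2) ^ Suc n * cmod (p n y - p n z))"
      unfolding seq_pseudometric_def using that
      by (intro suminf_le summable_add seq_pseudometric_summable)
    also have "\<dots> = seq_pseudometric p x y + seq_pseudometric p y z"
      unfolding seq_pseudometric_def using that
      by (intro suminf_add[symmetric] seq_pseudometric_summable)
    finally show ?thesis .
  qed
  have "continuous_map ?P euclideanreal (\<lambda>z. seq_pseudometric p (fst z) (snd z))"
  proof -
    have unif: "uniform_limit (topspace ?P) (\<lambda>k z. \<Sum>n<k. ?f n z) (\<lambda>z. \<Sum>n. ?f n z) sequentially"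
    proof (rule Weierstrass_m_test)
      show "summable (\<lambda>n. (1/2 :: real) ^ Suc n * 2)"
        using sums_half sums_summable by blast
      show "norm (?f n z) \<le> (1/2) ^ Suc n * 2" if "z \<in> topspace ?P" for n z
        using that unit_ball_seq_diff_le[of "fst z" "snd z" n] by (auto simp: abs_mult)
    qed
    have cts: "continuous_map ?P euclideanreal (?f n)" for n
    proof -
      have pn: "continuous_map X euclidean (p n)"
        using p by (simp add: real_unit_ball_seq_def cfun_def)
      show ?thesis
        using continuous_map_compose[OF continuous_map_fst pn] continuous_map_compose[OF continuous_map_snd pn]
        by (intro continuous_map_real_mult_left continuous_map_norm continuous_map_diff) (auto simp: o_def)
    qed
    \<comment> \<open>The domain is an abstract topology and the target a metric space, so
      continuity passes to the limit through the metric of the reals.\<close>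
    have "continuous_map ?P Met_TC.mtopology (\<lambda>z. \<Sum>n. ?f n z)"
    proof (rule Met_TC.continuous_map_uniform_limit)
      show "\<forall>\<^sub>F k in sequentially. continuous_map ?P Met_TC.mtopology (\<lambda>z. \<Sum>n<k. ?f n z)"
        using cts by (intro always_eventually allI) (auto intro!: continuous_map_sum)
      show "\<forall>\<^sub>F k in sequentially. \<forall>z\<in>topspace ?P. (\<Sum>n. ?f n z) \<in> UNIV \<and> dist (\<Sum>n<k. ?f n z) (\<Sum>n. ?f n z) < \<epsilon>"
        if "0 < \<epsilon>" for \<epsilon>
        using unif that by (simp add: uniform_limit_iff)
    qed simp
    then show ?thesis
      by (simp add: seq_pseudometric_def)
  qed
  then show "continuous_map ?P euclideanreal (\<lambda>(x, y). seq_pseudometric p x y)"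
    by (simp add: case_prod_beta')
qed

text \<open>Only the values on the sequence enter, and they are those of evaluations at \<phi> and
  \<psi>. This covers homomorphisms as well as their compositions with the two actions.\<close>

context
  fixes \<Phi> \<Psi> :: "('x \<Rightarrow> complex) \<Rightarrow> nat \<Rightarrow> complex" and \<phi> \<psi> :: "nat \<Rightarrow> 'x" and d :: nat
  assumes \<phi>: "\<phi> \<in> {1..d} \<rightarrow> topspace X" and \<psi>: "\<psi> \<in> {1..d} \<rightarrow> topspace X"
    and \<Phi>: "\<And>n a. a \<in> {1..d} \<Longrightarrow> \<Phi> (p n) a = p n (\<phi> a)"
    and \<Psi>: "\<And>n a. a \<in> {1..d} \<Longrightarrow> \<Psi> (p n) a = p n (\<psi> a)"
begin

private abbreviation "diff n a \<equiv> cmod (p n (\<phi> a) - p n (\<psi> a))"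

private lemma mem: "a \<in> {1..d} \<Longrightarrow> \<phi> a \<in> topspace X" "a \<in> {1..d} \<Longrightarrow> \<psi> a \<in> topspace X"
  using \<phi> \<psi> by (blast dest: Pi_mem)+

private lemma norm2_diff:
  "norm2 d (\<lambda>a. \<Phi> (p n) a - \<Psi> (p n) a) = sqrt ((\<Sum>a\<in>{1..d}. (diff n a)\<^sup>2) / real d)"
  unfolding norm2_def by (intro arg_cong[of _ _ sqrt] arg_cong2[of _ _ _ _ "(/)"] sum.cong) (auto simp: \<Phi> \<Psi>)

private lemma diff_le: "a \<in> {1..d} \<Longrightarrow> diff n a \<le> 2"
  using mem by (intro unit_ball_seq_diff_le)

private lemma norm2_diff_le: "norm2 d (\<lambda>a. \<Phi> (p n) a - \<Psi> (p n) a) \<le> 2"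
proof -
  have "(\<Sum>a\<in>{1..d}. (diff n a)\<^sup>2) \<le> (\<Sum>a\<in>{1..d}. 2\<^sup>2)"
    by (intro sum_mono power_mono diff_le) auto
  then have "(\<Sum>a\<in>{1..d}. (diff n a)\<^sup>2) / real d \<le> 2\<^sup>2"
    by (cases "d = 0") (auto simp: field_simps)
  then show ?thesis
    unfolding norm2_diff by (intro real_le_lsqrt) auto
qed

private lemma mean_diff_sums:
  "(\<lambda>n. (1/2) ^ Suc n * ((\<Sum>a\<in>{1..d}. diff n a) / real d)) sums
     ((\<Sum>a\<in>{1..d}. seq_pseudometric p (\<phi> a) (\<psi> a)) / real d)"
proof -
  have "(\<lambda>n. \<Sum>a\<in>{1..d}. (1/2) ^ Suc n * diff n a) sums (\<Sum>a\<in>{1..d}. seq_pseudometric p (\<phi> a) (\<psi> a))"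
    unfolding seq_pseudometric_def using mem
    by (intro sums_sum summable_sums seq_pseudometric_summable)
  from sums_divide[OF this, of "real d"] show ?thesis
    by (simp add: sum_distrib_left)
qed

private lemma rho_seq_summable:
  "summable (\<lambda>n. (1/2) ^ Suc n * norm2 d (\<lambda>a. \<Phi> (p n) a - \<Psi> (p n) a))"
proof (rule summable_half(1))
  show "0 \<le> norm2 d (\<lambda>a. \<Phi> (p n) a - \<Psi> (p n) a)" for n
    by (simp add: norm2_def sum_nonneg)
qed (rule norm2_diff_le)

text \<open>For each \<open>n\<close> the mean of the absolute values is at most the quadratic mean,
  by Cauchy-Schwarz. The finite mean is then exchanged with the series.\<close>

lemma mean_le_rho_seq:
  "(\<Sum>a\<in>{1..d}. seq_pseudometric p (\<phi> a) (\<psi> a)) / real d \<le> rho_seq p d \<Phi> \<Psi>"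
proof -
  have "(\<Sum>a\<in>{1..d}. diff n a) / real d \<le> norm2 d (\<lambda>a. \<Phi> (p n) a - \<Psi> (p n) a)" for n
  proof -
    have "((\<Sum>a\<in>{1..d}. diff n a) / real d)\<^sup>2 \<le> (\<Sum>a\<in>{1..d}. (diff n a)\<^sup>2) / real d"
      using sum_squared_le_sum_of_squares[of "\<lambda>a. diff n a" "{1..d}"]
      by (cases "d = 0") (auto simp: power_divide power2_eq_square divide_simps)
    then show ?thesis
      unfolding norm2_diff by (intro real_le_rsqrt)
  qed
  then have "(\<Sum>n. (1/2) ^ Suc n * ((\<Sum>a\<in>{1..d}. diff n a) / real d)) \<le> rho_seq p d \<Phi> \<Psi>"
    unfolding rho_seq_def using sums_summable[OF mean_diff_sums] rho_seq_summable
    by (intro suminf_le mult_left_mono) auto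
  then show ?thesis
    using mean_diff_sums by (simp add: sums_iff)
qed

text \<open>AM-GM: \<open>u \<le> \<tau>/2 + u\<^sup>2/(2\<tau>)\<close> for \<open>u = norm2\<close>, and \<open>u\<^sup>2\<close> is at most twice the \<open>\<ell>\<^sup>1\<close>-mean.\<close>

lemma rho_seq_le_mean:
  assumes "\<tau> > 0"
  shows "rho_seq p d \<Phi> \<Psi> \<le> \<tau> / 2 + (\<Sum>a\<in>{1..d}. seq_pseudometric p (\<phi> a) (\<psi> a)) / real d / \<tau>"
proof -
  have bound: "norm2 d (\<lambda>a. \<Phi> (p n) a - \<Psi> (p n) a) \<le> \<tau> / 2 + ((\<Sum>a\<in>{1..d}. diff n a) / real d) / \<tau>" (is "?u \<le> _") for n
  proof -
    have "(\<Sum>a\<in>{1..d}. (diff n a)\<^sup>2) \<le> (\<Sum>a\<in>{1..d}. 2 * diff n a)"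
      using diff_le[of _ n] by (intro sum_mono) (simp add: power2_eq_square mult_right_mono)
    then have "?u\<^sup>2 \<le> 2 * ((\<Sum>a\<in>{1..d}. diff n a) / real d)"
      unfolding norm2_diff by (simp add: sum_nonneg sum_distrib_left[symmetric] divide_right_mono)
    moreover have "2 * \<tau> * ?u \<le> \<tau>\<^sup>2 + ?u\<^sup>2"
      using zero_le_power2[of "?u - \<tau>"] by (simp add: power2_diff mult_ac)
    ultimately have "?u * (2 * \<tau>) \<le> \<tau>\<^sup>2 + 2 * ((\<Sum>a\<in>{1..d}. diff n a) / real d)"
      by (simp only: mult_ac)
    then have "?u \<le> (\<tau>\<^sup>2 + 2 * ((\<Sum>a\<in>{1..d}. diff n a) / real d)) / (2 * \<tau>)"
      using assms by (subst pos_le_divide_eq) auto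
    also have "\<dots> = \<tau> / 2 + ((\<Sum>a\<in>{1..d}. diff n a) / real d) / \<tau>"
      using assms by (simp add: add_divide_distrib power2_eq_square)
    finally show ?thesis .
  qed
  let ?m = "(\<Sum>a\<in>{1..d}. seq_pseudometric p (\<phi> a) (\<psi> a)) / real d"
  have "(\<lambda>n. (1/2) ^ Suc n * (\<tau> / 2) + (1/2) ^ Suc n * ((\<Sum>a\<in>{1..d}. diff n a) / real d) / \<tau>) sums (\<tau> / 2 + ?m / \<tau>)"
    by (intro sums_add sums_half sums_divide mean_diff_sums)
  moreover have "(1/2) ^ Suc n * norm2 d (\<lambda>a. \<Phi> (p n) a - \<Psi> (p n) a) \<le>
     (1/2) ^ Suc n * (\<tau> / 2) + (1/2) ^ Suc n * ((\<Sum>a\<in>{1..d}. diff n a) / real d) / \<tau>" for n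
    using mult_left_mono[OF bound[of n], of "(1/2) ^ Suc n"] by (simp add: distrib_left)
  ultimately show ?thesis
    unfolding rho_seq_def using rho_seq_summable by (metis (no_types, lifting) suminf_le sums_iff)
qed

text \<open>Markov's inequality for the mean of \<open>seq_pseudometric\<close>: a mean below
  \<open>\<eta>\<^sup>2\<close> leaves density below \<eta> at level \<eta>.\<close>

lemma rho_seq_imp_close:
  assumes "rho_seq p d \<Phi> \<Psi> < \<eta>\<^sup>2" "\<eta> > 0"
  shows "close_in_measure (seq_pseudometric p) d \<eta> \<phi> \<psi>"
proof -
  have "\<eta> * proportion d (\<lambda>a. \<eta> \<le> seq_pseudometric p (\<phi> a) (\<psi> a))
      \<le> (\<Sum>a\<in>{1..d}. seq_pseudometric p (\<phi> a) (\<psi> a)) / real d"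
    by (intro proportion_markov pseudometric_nonneg[OF continuous_pseudometric_seq] mem)
  also note mean_le_rho_seq
  also note assms(1)
  finally show ?thesis
    using assms(2) by (simp add: close_in_measure_def power2_eq_square)
qed

text \<open>The pseudometric is bounded by 2, so the mean is below three times
  \<open>\<epsilon>\<^sup>2 / 12\<close>, that is \<open>\<epsilon>\<^sup>2 / 4\<close>. The
  estimate of \<open>rho_seq\<close> by the mean with \<tau> = \<epsilon> then gives \<epsilon>/2 +
  \<epsilon>/4.\<close>

lemma close_imp_rho_seq:
  assumes "close_in_measure (seq_pseudometric p) d (\<epsilon>\<^sup>2 / 12) \<phi> \<psi>" "\<epsilon> > 0"
  shows "rho_seq p d \<Phi> \<Psi> < \<epsilon>"
proof -
  let ?m = "(\<Sum>a\<in>{1..d}. seq_pseudometric p (\<phi> a) (\<psi> a)) / real d"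
  have "?m \<le> \<epsilon>\<^sup>2 / 12 + 2 * proportion d (\<lambda>a. \<epsilon>\<^sup>2 / 12 \<le> seq_pseudometric p (\<phi> a) (\<psi> a))"
    by (intro mean_le_proportion seq_pseudometric_le_2 mem) auto
  also have "\<dots> < \<epsilon>\<^sup>2 / 12 + 2 * (\<epsilon>\<^sup>2 / 12)"
    using assms(1) by (simp add: close_in_measure_def)
  finally have "?m / \<epsilon> < \<epsilon>\<^sup>2 / 4 / \<epsilon>"
    using assms(2) by (intro divide_strict_right_mono) auto
  moreover have "\<epsilon>\<^sup>2 / 4 / \<epsilon> = \<epsilon> / 4"
    using assms(2) by (simp add: power2_eq_square)
  ultimately show ?thesis
    using rho_seq_le_mean[OF assms(2)] assms(2) by linarith
qed

end

end

section \<open>From dynamically generating sequences to dynamically generating pseudometrics\<close>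

lemma metrizable_continuous_pseudometric:
  assumes "metrizable_space X"
  obtains m where "continuous_pseudometric X m"
    "\<And>x y. x \<in> topspace X \<Longrightarrow> y \<in> topspace X \<Longrightarrow> x \<noteq> y \<Longrightarrow> m x y > 0"
proof -
  obtain M m where M: "Metric_space M m" and X: "X = Metric_space.mtopology M m"
    using assms by (auto simp: metrizable_space_def)
  interpret Metric_space M m by (rule M)
  have "continuous_map (prod_topology X X) euclideanreal (\<lambda>z. m (fst z) (snd z))"
    using continuous_map_metric[of "metric (M, m)"] M
    by (simp add: X mtopology_of_def mspace_metric mdist_metric case_prod_beta')
  then have "continuous_pseudometric X m"
    by (auto simp: continuous_pseudometric_def X case_prod_beta' commute triangle)
  then show thesis
    by (rule that) (auto simp: X mdist_pos_eq)
qed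

context sofic_action begin

lemma cfun_act_closed: "s \<in> carrier G \<Longrightarrow> f \<in> cfun X \<Longrightarrow> cfun_act G X \<alpha> s f \<in> cfun X"
  unfolding cfun_act_def
  using continuous_map_compose[OF continuous_action cfun_continuous, of "inv\<^bsub>G\<^esub> s" f]
  by (intro restrict_in_cfun) (auto simp: o_def)

text \<open>All operations and uniform limits are evaluated pointwise. With \<open>E\<close> the
  orbit of a pair of points, this is the subalgebra that refutes generation.\<close>

lemma unital_cstar_subalgebra_equalizer:
  assumes E: "\<And>x y. (x, y) \<in> E \<Longrightarrow> x \<in> topspace X \<and> y \<in> topspace X"
  shows "unital_cstar_subalgebra X {f \<in> cfun X. \<forall>x y. (x, y) \<in> E \<longrightarrow> f x = f y}" (is "unital_cstar_subalgebra X ?A")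
proof -
  have I: "h \<in> ?A" if "h \<in> cfun X" "\<And>x y. (x, y) \<in> E \<Longrightarrow> h x = h y" for h
    using that by blast
  have D: "h x = h y" if "h \<in> ?A" "(x, y) \<in> E" for h x y
    using that by blast
  have C: "h \<in> cfun X" if "h \<in> ?A" for h
    using that by blast
  show ?thesis
    unfolding unital_cstar_subalgebra_def
  proof (intro conjI allI ballI impI)
    show "(\<lambda>x\<in>topspace X. 1) \<in> ?A"
      by (rule I[OF cfun_const]) (use E in simp)
    fix f assume f: "f \<in> ?A"
    show "(\<lambda>x\<in>topspace X. c * f x) \<in> ?A" for c
      by (rule I[OF cfun_scale[OF C[OF f]]]) (use E D[OF f] in simp)
    show "(\<lambda>x\<in>topspace X. cnj (f x)) \<in> ?A"
      by (rule I[OF cfun_cnj[OF C[OF f]]]) (use E D[OF f] in simp)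
    fix g assume g: "g \<in> ?A"
    show "(\<lambda>x\<in>topspace X. f x + g x) \<in> ?A"
    proof (rule I[OF cfun_add[OF C[OF f] C[OF g]]])
      fix x y assume "(x, y) \<in> E"
      with D[OF f this] D[OF g this] E[OF this]
      show "(\<lambda>x\<in>topspace X. f x + g x) x = (\<lambda>x\<in>topspace X. f x + g x) y" by simp
    qed
    show "(\<lambda>x\<in>topspace X. f x * g x) \<in> ?A"
    proof (rule I[OF cfun_mult[OF C[OF f] C[OF g]]])
      fix x y assume "(x, y) \<in> E"
      with D[OF f this] D[OF g this] E[OF this]
      show "(\<lambda>x\<in>topspace X. f x * g x) x = (\<lambda>x\<in>topspace X. f x * g x) y" by simp
    qed
  next
    fix u f assume *: "(\<forall>n. u n \<in> ?A) \<and> f \<in> cfun X \<and> uniform_limit (topspace X) u f sequentially"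
    then have u: "u n \<in> ?A" for n by blast
    show "f \<in> ?A"
    proof (rule I)
      fix x y assume xy: "(x, y) \<in> E"
      show "f x = f y"
      proof (rule LIMSEQ_unique)
        show "(\<lambda>n. u n x) \<longlonglongrightarrow> f x"
          using * E[OF xy] by (intro tendsto_uniform_limitI[where S = "topspace X"]) auto
        show "(\<lambda>n. u n x) \<longlonglongrightarrow> f y"
          unfolding D[OF u xy]
          using * E[OF xy] by (intro tendsto_uniform_limitI[where S = "topspace X"]) auto
      qed
    qed (use * in blast)
  qed blast
qed

text \<open>If the orbits of two distinct points were not separated, the functions agreeing along
  both orbits would form an invariant subalgebra containing the sequence, hence all of
  \<open>cfun X\<close>. The distance to the first point separates the two, a contradiction.\<close>

lemma dyn_generating_seq_pseudometric:
  assumes p: "real_unit_ball_seq X p" and gen: "dyn_generating_seq G X \<alpha> p"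
    and X: "metrizable_space X"
  shows "dyn_generating_pseudometric G X \<alpha> (seq_pseudometric p)"
  unfolding dyn_generating_pseudometric_def
proof (intro ballI impI, rule ccontr)
  fix x y assume xy: "x \<in> topspace X" "y \<in> topspace X" "x \<noteq> y"
    and "\<not> (\<exists>s\<in>carrier G. 0 < seq_pseudometric p (\<alpha> s x) (\<alpha> s y))"
  then have le0: "seq_pseudometric p (\<alpha> s x) (\<alpha> s y) \<le> 0" if "s \<in> carrier G" for s
    using that by (meson not_le)
  \<comment> \<open>The whole orbit of the pair is used, which makes the subalgebra
    invariant.\<close>
  define E where "E = (\<lambda>s. (\<alpha> s x, \<alpha> s y)) ` carrier G"
  let ?A = "{f \<in> cfun X. \<forall>x y. (x, y) \<in> E \<longrightarrow> f x = f y}"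
  have EX: "\<And>x y. (x, y) \<in> E \<Longrightarrow> x \<in> topspace X \<and> y \<in> topspace X"
    using xy by (auto simp: E_def)
  have "cfun_act G X \<alpha> s f \<in> ?A" if s: "s \<in> carrier G" and f: "f \<in> ?A" for s f
  proof -
    have "cfun_act G X \<alpha> s f (\<alpha> t x) = cfun_act G X \<alpha> s f (\<alpha> t y)" if t: "t \<in> carrier G" for t
    proof -
      have "inv\<^bsub>G\<^esub> s \<otimes>\<^bsub>G\<^esub> t \<in> carrier G" using s t by simp
      then have "f (\<alpha> (inv\<^bsub>G\<^esub> s \<otimes>\<^bsub>G\<^esub> t) x) = f (\<alpha> (inv\<^bsub>G\<^esub> s \<otimes>\<^bsub>G\<^esub> t) y)"
        using f by (auto simp: E_def)
      then show ?thesis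
        using s t xy by (simp add: cfun_act_def act_mult)
    qed
    with s f cfun_act_closed[of s f] show ?thesis by (auto simp: E_def)
  qed
  moreover have "p n \<in> ?A" for n
  proof -
    have "p n (\<alpha> s x) = p n (\<alpha> s y)" if s: "s \<in> carrier G" for s
    proof -
      have sX: "\<alpha> s x \<in> topspace X" "\<alpha> s y \<in> topspace X" using s xy by auto
      \<comment> \<open>A single nonnegative term is at most the whole series, so every term
        vanishes.\<close>
      have "sum (\<lambda>n. (1/2) ^ Suc n * cmod (p n (\<alpha> s x) - p n (\<alpha> s y))) {n} \<le> seq_pseudometric p (\<alpha> s x) (\<alpha> s y)"
        unfolding seq_pseudometric_def
        by (intro sum_le_suminf seq_pseudometric_summable[OF p sX]) auto
      then have "(1/2) ^ Suc n * cmod (p n (\<alpha> s x) - p n (\<alpha> s y)) \<le> 0"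
        using le0[OF s] by simp
      moreover have "(0::real) < (1/2) ^ Suc n"
        by simp
      ultimately have "cmod (p n (\<alpha> s x) - p n (\<alpha> s y)) \<le> 0"
        by (metis mult_le_0_iff not_less)
      then show ?thesis
        by simp
    qed
    then show ?thesis
      using p by (auto simp: E_def real_unit_ball_seq_def)
  qed
  ultimately have A: "?A = cfun X"
    using gen unital_cstar_subalgebra_equalizer[OF EX]
    unfolding dyn_generating_seq_def by (metis (no_types, lifting) image_subsetI)
  obtain m where m: "continuous_pseudometric X m"
    and pos: "\<And>x y. x \<in> topspace X \<Longrightarrow> y \<in> topspace X \<Longrightarrow> x \<noteq> y \<Longrightarrow> m x y > 0"
    using metrizable_continuous_pseudometric[OF X] by blast
  let ?f = "\<lambda>z\<in>topspace X. complex_of_real (m x z)"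
  have "?f \<in> ?A"
    unfolding A using pseudometric_continuous_right[OF m xy(1)] by (rule cfun_of_real)
  moreover have "(x, y) \<in> E"
    unfolding E_def using xy by (intro image_eqI[of _ _ "\<one>\<^bsub>G\<^esub>"]) (auto simp: act_one)
  ultimately have "?f x = ?f y" by blast
  then show False
    using xy pos[OF xy] pseudometric_self[OF m xy(1)] by simp
qed

end

section \<open>Homomorphisms into finite-dimensional algebras\<close>

text \<open>Both restrictions make the result extensional, so that a given homomorphism can be equal
  to it as a function.\<close>

definition eval_hom :: "'x topology \<Rightarrow> nat \<Rightarrow> (nat \<Rightarrow> 'x) \<Rightarrow> ('x \<Rightarrow> complex) \<Rightarrow> nat \<Rightarrow> complex" where
  "eval_hom X d \<phi> = (\<lambda>f\<in>cfun X. \<lambda>a\<in>{1..d}. f (\<phi> a))"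

lemma unital_star_hom_eval:
  assumes "\<phi> \<in> {1..d} \<rightarrow> topspace X"
  shows "unital_star_hom X (discrete_topology {1..d}) (eval_hom X d \<phi>)"
proof -
  have mem: "\<phi> a \<in> topspace X" if "a \<in> {1..d}" for a
    using assms that by (rule Pi_mem)
  have eval: "eval_hom X d \<phi> f = (\<lambda>a\<in>{1..d}. f (\<phi> a))" if "f \<in> cfun X" for f
    using that by (simp add: eval_hom_def)
  have "(\<lambda>a\<in>{1..d}. f (\<phi> a)) \<in> cpow d" for f
    by (simp add: cfun_def)
  then have "eval_hom X d \<phi> \<in> cfun X \<rightarrow>\<^sub>E cpow d"
    by (simp add: eval_hom_def)
  then show ?thesis
    unfolding unital_star_hom_def topspace_discrete_topology
    by (intro conjI ballI allI)
      (simp_all only: eval cfun_add cfun_mult cfun_scale cfun_cnj cfun_const,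
       (rule restrict_ext, simp only: mem restrict_apply' if_True)+)
qed

text \<open>Gelfand's argument for characters. If the kernel had no common zero, compactness would
  give finitely many kernel elements without one; the sum of their squared moduli lies in the kernel
  and is invertible, against \<Phi>(1) = 1. At a common zero \<open>x\<close>, subtracting the
  constant \<Phi>(f) from \<open>f\<close> yields the claim.\<close>

lemma unital_star_hom_point:
  assumes X: "compact_space X" and \<Phi>: "unital_star_hom X (discrete_topology {1..d}) \<Phi>" and a: "a \<in> {1..d}"
  shows "\<exists>x\<in>topspace X. \<forall>f\<in>cfun X. \<Phi> f a = f x"
proof -
  have one: "\<Phi> (\<lambda>x\<in>topspace X. 1) a = 1"
    and add: "\<And>f g. f \<in> cfun X \<Longrightarrow> g \<in> cfun X \<Longrightarrow> \<Phi> (\<lambda>x\<in>topspace X. f x + g x) a = \<Phi> f a + \<Phi> g a"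
    and mult: "\<And>f g. f \<in> cfun X \<Longrightarrow> g \<in> cfun X \<Longrightarrow> \<Phi> (\<lambda>x\<in>topspace X. f x * g x) a = \<Phi> f a * \<Phi> g a"
    and scale: "\<And>f c. f \<in> cfun X \<Longrightarrow> \<Phi> (\<lambda>x\<in>topspace X. c * f x) a = c * \<Phi> f a"
    using \<Phi> a unfolding unital_star_hom_def by (simp_all del: atLeastAtMost_iff)
  have "\<exists>x\<in>topspace X. \<forall>f\<in>cfun X. \<Phi> f a = 0 \<longrightarrow> f x = 0"
  proof (rule ccontr)
    assume no: "\<not> ?thesis"
    define U where "U f = {x \<in> topspace X. f x \<in> - {0::complex}}" for f
    let ?K = "{f \<in> cfun X. \<Phi> f a = 0}"
    have "openin X (U f)" if "f \<in> ?K" for f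
      unfolding U_def using that by (intro openin_continuous_map_preimage[OF cfun_continuous]) (auto simp: open_Compl)
    moreover have "topspace X \<subseteq> \<Union> (U ` ?K)"
      using no by (fastforce simp: U_def)
    moreover have "compactin X (topspace X)"
      using X by (simp add: compact_space_def)
    ultimately obtain \<F> where "finite \<F>" "\<F> \<subseteq> U ` ?K" "topspace X \<subseteq> \<Union>\<F>"
      using compactinD[of X "topspace X" "U ` ?K"] by (metis (no_types, lifting) imageE)
    then obtain J where J: "finite J" "J \<subseteq> ?K" "topspace X \<subseteq> \<Union> (U ` J)"
      by (metis (no_types, lifting) finite_subset_image)
    \<comment> \<open>The squared modulus of \<open>h\<close> is \<open>h\<close> times its
      conjugate, so it stays in the kernel, an ideal.\<close>
    have "\<exists>g\<in>cfun X. \<Phi> g a = 0 \<and> (\<forall>x\<in>topspace X. g x = complex_of_real (\<Sum>f\<in>J. (cmod (f x))\<^sup>2))"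
      using J(1,2)
    proof induction
      case empty
      show ?case
      proof (intro bexI conjI ballI)
        \<comment> \<open>Zero is written as a multiple of the unit so that the scaling law computes
          its value.\<close>
        show "\<Phi> (\<lambda>x\<in>topspace X. 0 * (\<lambda>x\<in>topspace X. 1) x) a = 0"
          unfolding scale[OF cfun_const] by simp
        show "(\<lambda>x\<in>topspace X. 0 * (\<lambda>x\<in>topspace X. 1) x) \<in> cfun X"
          by (rule cfun_scale[OF cfun_const])
      qed simp
    next
      case (insert h J)
      then obtain g where g: "g \<in> cfun X" "\<Phi> g a = 0"
        "\<And>x. x \<in> topspace X \<Longrightarrow> g x = complex_of_real (\<Sum>f\<in>J. (cmod (f x))\<^sup>2)"
        by auto
      have h: "h \<in> cfun X" "\<Phi> h a = 0" using insert by auto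
      define k where "k = (\<lambda>x\<in>topspace X. h x * (\<lambda>x\<in>topspace X. cnj (h x)) x)"
      have k: "k \<in> cfun X" "\<Phi> k a = 0"
        unfolding k_def mult[OF h(1) cfun_cnj[OF h(1)]] using h
        by (simp_all add: cfun_mult[OF h(1) cfun_cnj[OF h(1)]] del: restrict_apply)
      have "(\<lambda>x\<in>topspace X. k x + g x) \<in> cfun X" "\<Phi> (\<lambda>x\<in>topspace X. k x + g x) a = 0"
        using k g by (auto simp: add intro: cfun_add)
      moreover have "(\<lambda>x\<in>topspace X. k x + g x) x = complex_of_real (\<Sum>f\<in>insert h J. (cmod (f x))\<^sup>2)" if "x \<in> topspace X" for x
        using that insert g(3)[OF that] by (simp add: k_def complex_norm_square[symmetric])
      ultimately show ?case
        by blast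
    qed
    then obtain g where g: "g \<in> cfun X" "\<Phi> g a = 0"
      and gsum: "\<And>x. x \<in> topspace X \<Longrightarrow> g x = complex_of_real (\<Sum>f\<in>J. (cmod (f x))\<^sup>2)"
      by blast
    have nz: "g x \<noteq> 0" if x: "x \<in> topspace X" for x
    proof -
      obtain f where "f \<in> J" "f x \<noteq> 0"
        using J(3) x by (auto simp: U_def)
      then have "(\<Sum>f\<in>J. (cmod (f x))\<^sup>2) > 0"
        using J(1) by (intro sum_pos2[of _ f]) auto
      then show ?thesis
        using gsum[OF x] by (simp del: of_real_sum)
    qed
    define h where "h = (\<lambda>x\<in>topspace X. inverse (g x))"
    have h: "h \<in> cfun X"
      unfolding h_def using g(1) nz
      by (intro restrict_in_cfun) (auto simp: cfun_def continuous_map_atin intro!: tendsto_inverse)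
    have "(\<lambda>x\<in>topspace X. g x * h x) = (\<lambda>x\<in>topspace X. 1)"
      using nz by (auto simp: h_def)
    with mult[OF g(1) h] g(2) one show False by simp
  qed
  then obtain x where x: "x \<in> topspace X" and ker: "\<And>f. f \<in> cfun X \<Longrightarrow> \<Phi> f a = 0 \<Longrightarrow> f x = 0"
    by blast
  have "\<Phi> f a = f x" if f: "f \<in> cfun X" for f
  proof -
    define c where "c = (\<lambda>x\<in>topspace X. - \<Phi> f a * (\<lambda>x\<in>topspace X. 1) x)"
    have c: "c \<in> cfun X"
      unfolding c_def by (intro cfun_scale cfun_const)
    have "\<Phi> c a = - \<Phi> f a"
      unfolding c_def scale[OF cfun_const] one by simp
    then have "\<Phi> (\<lambda>x\<in>topspace X. f x + c x) a = 0"
      unfolding add[OF f c] by simp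
    with cfun_add[OF f c] have "(\<lambda>x\<in>topspace X. f x + c x) x = 0"
      by (rule ker)
    then show ?thesis
      using x by (simp add: c_def)
  qed
  with x show ?thesis by blast
qed

lemma unital_star_hom_cases:
  assumes X: "compact_space X" and \<Phi>: "unital_star_hom X (discrete_topology {1..d}) \<Phi>"
  obtains \<phi> where "\<phi> \<in> {1..d} \<rightarrow>\<^sub>E topspace X" "\<Phi> = eval_hom X d \<phi>"
proof -
  obtain x where x: "\<And>a. a \<in> {1..d} \<Longrightarrow> x a \<in> topspace X \<and> (\<forall>f\<in>cfun X. \<Phi> f a = f (x a))"
    using unital_star_hom_point[OF X \<Phi>] by metis
  have \<Phi>E: "\<Phi> \<in> cfun X \<rightarrow>\<^sub>E cpow d"
    using \<Phi> by (simp add: unital_star_hom_def)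
  show thesis
  proof (rule that[of "\<lambda>a\<in>{1..d}. x a"])
    show "(\<lambda>a\<in>{1..d}. x a) \<in> {1..d} \<rightarrow>\<^sub>E topspace X"
      using x by (simp add: PiE_iff)
    show "\<Phi> = eval_hom X d (\<lambda>a\<in>{1..d}. x a)"
    proof (rule PiE_ext[OF \<Phi>E])
      show "eval_hom X d (\<lambda>a\<in>{1..d}. x a) \<in> cfun X \<rightarrow>\<^sub>E cpow d"
        using unital_star_hom_eval[of "\<lambda>a\<in>{1..d}. x a" d X] x by (simp add: unital_star_hom_def Pi_iff)
      fix f assume f: "f \<in> cfun X"
      have "\<Phi> f \<in> extensional {1..d}"
        using PiE_mem[OF \<Phi>E f] by (simp add: cfun_def)
      then show "\<Phi> f = eval_hom X d (\<lambda>a\<in>{1..d}. x a) f"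
        using x f by (intro extensionalityI[of _ "{1..d}"]) (auto simp: eval_hom_def simp del: atLeastAtMost_iff)
    qed
  qed
qed

section \<open>Translation of approximate equivariance from homomorphisms to maps\<close>

context sofic_action begin

text \<open>Where \<sigma>(s) \<sigma>(t) fixes \<open>a\<close>, the inverse of \<sigma>(s) agrees
  with \<sigma>(t) at \<open>a\<close>. The exceptional indices have density below \<eta>, which
  accounts for the factor 2. In the applications \<open>t\<close> is the group inverse of
  \<open>s\<close>.\<close>

lemma close_in_measure_inverse:
  assumes \<rho>: "continuous_pseudometric X \<rho>" and s: "s \<in> carrier G" and t: "t \<in> carrier G"
    and defect: "proportion (d i) (\<lambda>a. \<sigma> i s (\<sigma> i t a) \<noteq> a) < \<eta>"
    and \<phi>: "\<phi> \<in> {1..d i} \<rightarrow> topspace X" and \<omega>: "\<omega> \<in> {1..d i} \<rightarrow> topspace X"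
  shows "close_in_measure \<rho> (d i) \<eta> (\<phi> \<circ> \<sigma> i t) \<omega> \<Longrightarrow> close_in_measure \<rho> (d i) (2 * \<eta>) \<omega> (\<phi> \<circ> inv' (\<sigma> i s))"
    and "close_in_measure \<rho> (d i) \<eta> \<omega> (\<phi> \<circ> inv' (\<sigma> i s)) \<Longrightarrow> close_in_measure \<rho> (d i) (2 * \<eta>) (\<phi> \<circ> \<sigma> i t) \<omega>"
proof -
  let ?B = "\<lambda>a. \<sigma> i s (\<sigma> i t a) \<noteq> a"
  have eq: "\<rho> (\<omega> a) (\<phi> (inv' (\<sigma> i s) a)) = \<rho> (\<phi> (\<sigma> i t a)) (\<omega> a)" if "a \<in> {1..d i}" "\<not> ?B a" for a
  proof -
    have "inv' (\<sigma> i s) a = \<sigma> i t a"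
      using that(2) permutes_inverses(2)[OF permutes[OF s]] by metis
    moreover have "\<phi> (\<sigma> i t a) \<in> topspace X" "\<omega> a \<in> topspace X"
      using Pi_mem[OF \<phi> permutes_closed[OF t that(1)]] Pi_mem[OF \<omega> that(1)] by auto
    ultimately show ?thesis
      using pseudometric_commute[OF \<rho>] by simp
  qed
  have "0 < \<eta>"
    using defect proportion_nonneg by (rule le_less_trans[rotated])
  have *: "proportion (d i) (\<lambda>a. 2 * \<eta> \<le> f a) < 2 * \<eta>"
    if g: "proportion (d i) (\<lambda>a. \<eta> \<le> g a) < \<eta>" and fg: "\<And>a. a \<in> {1..d i} \<Longrightarrow> \<not> ?B a \<Longrightarrow> f a = g a" for f g
  proof -
    have "proportion (d i) (\<lambda>a. 2 * \<eta> \<le> f a) \<le> proportion (d i) (\<lambda>a. ?B a \<or> \<eta> \<le> g a)"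
      using fg \<open>0 < \<eta>\<close> by (intro proportion_mono) force
    also have "\<dots> \<le> proportion (d i) ?B + proportion (d i) (\<lambda>a. \<eta> \<le> g a)"
      by (rule proportion_disj)
    finally show ?thesis
      using defect g by linarith
  qed
  show "close_in_measure \<rho> (d i) \<eta> (\<phi> \<circ> \<sigma> i t) \<omega> \<Longrightarrow> close_in_measure \<rho> (d i) (2 * \<eta>) \<omega> (\<phi> \<circ> inv' (\<sigma> i s))"
    unfolding close_in_measure_def o_def by (erule *) (rule eq)
  show "close_in_measure \<rho> (d i) \<eta> \<omega> (\<phi> \<circ> inv' (\<sigma> i s)) \<Longrightarrow> close_in_measure \<rho> (d i) (2 * \<eta>) (\<phi> \<circ> \<sigma> i t) \<omega>"
    unfolding close_in_measure_def o_def by (erule *) (rule eq[symmetric])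
qed

lemma eval_hom_seq:
  assumes "real_unit_ball_seq X p" "a \<in> {1..d i}"
  shows "eval_hom X (d i) \<phi> (p n) a = p n (\<phi> a)"
  using assms by (simp add: eval_hom_def real_unit_ball_seq_def)

text \<open>Both actions on functions compose with an inverse. On evaluations this becomes the
  inverse group element acting on the points and the inverse permutation acting on the
  indices.\<close>

lemma eval_hom_act:
  assumes p: "real_unit_ball_seq X p" and s: "s \<in> carrier G" and \<phi>: "\<phi> \<in> {1..d i} \<rightarrow> topspace X"
    and a: "a \<in> {1..d i}"
  shows "(eval_hom X (d i) \<phi> \<circ> cfun_act G X \<alpha> s) (p n) a = p n ((\<alpha> (inv\<^bsub>G\<^esub> s) \<circ> \<phi>) a)"
    and "(perm_act (d i) (\<sigma> i s) \<circ> eval_hom X (d i) \<phi>) (p n) a = p n ((\<phi> \<circ> inv' (\<sigma> i s)) a)"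
proof -
  have "p n \<in> cfun X" using p by (simp add: real_unit_ball_seq_def)
  then show "(eval_hom X (d i) \<phi> \<circ> cfun_act G X \<alpha> s) (p n) a = p n ((\<alpha> (inv\<^bsub>G\<^esub> s) \<circ> \<phi>) a)"
    using cfun_act_closed[OF s, of "p n"] a Pi_mem[OF \<phi> a] by (simp add: eval_hom_def cfun_act_def)
  have "inv' (\<sigma> i s) a \<in> {1..d i}"
    using a permutes_in_image[OF permutes_inv[OF permutes[OF s]]] by blast
  then show "(perm_act (d i) (\<sigma> i s) \<circ> eval_hom X (d i) \<phi>) (p n) a = p n ((\<phi> \<circ> inv' (\<sigma> i s)) a)"
    using a eval_hom_seq[OF p, of "inv' (\<sigma> i s) a" i \<phi> n] by (simp add: perm_act_def)
qed

lemma act_maps: "s \<in> carrier G \<Longrightarrow> \<phi> \<in> {1..d i} \<rightarrow> topspace X \<Longrightarrow> \<alpha> s \<circ> \<phi> \<in> {1..d i} \<rightarrow> topspace X"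
  by (auto simp: Pi_iff)

lemma inv_perm_maps:
  assumes "s \<in> carrier G" "\<phi> \<in> {1..d i} \<rightarrow> topspace X"
  shows "\<phi> \<circ> inv' (\<sigma> i s) \<in> {1..d i} \<rightarrow> topspace X"
proof
  fix a assume "a \<in> {1..d i}"
  then have "inv' (\<sigma> i s) a \<in> {1..d i}"
    using permutes_in_image[OF permutes_inv[OF permutes[OF assms(1)]]] by blast
  with assms(2) show "(\<phi> \<circ> inv' (\<sigma> i s)) a \<in> topspace X"
    by (simp add: Pi_iff del: atLeastAtMost_iff)
qed

lemma inv_fin_subsets: "F \<in> fin_subsets G \<Longrightarrow> (\<lambda>s. inv\<^bsub>G\<^esub> s) ` F \<in> fin_subsets G"
  by (auto simp: fin_subsets_def)

lemma eventually_inv_defect: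
  assumes "F \<in> fin_subsets G" "\<eta> > 0"
  shows "\<forall>\<^sub>F i in sequentially. \<forall>s\<in>F. proportion (d i) (\<lambda>a. \<sigma> i s (\<sigma> i (inv\<^bsub>G\<^esub> s) a) \<noteq> a) < \<eta>"
  using assms order_tendstoD(2)[OF proportion_inv_defect]
  by (intro eventually_ball_finite ballI) (auto simp: fin_subsets_def)

text \<open>Unital homomorphisms are evaluations, so the parametrization is onto. The condition on
  homomorphisms at \<open>s\<close> corresponds to the one on maps at the inverse of
  \<open>s\<close>, and therefore both inclusions pass to the set of inverses of
  \<open>F'\<close>.\<close>

lemma represented_Hom_space:
  assumes p: "real_unit_ball_seq X p"
  shows "represented (seq_pseudometric p) (\<lambda>F \<delta> i. Hom_space G X \<alpha> p F \<delta> (d i) (\<sigma> i))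
     (\<lambda>i. rho_seq p (d i)) (\<lambda>i. eval_hom X (d i))"
  unfolding represented_def
proof (intro conjI ballI allI impI)
  let ?\<rho> = "seq_pseudometric p"
  note \<rho> = continuous_pseudometric_seq[OF p]
  fix F' and \<eta> :: real assume F': "F' \<in> fin_subsets G" and "\<eta> > 0"
  define F where "F = (\<lambda>s. inv\<^bsub>G\<^esub> s) ` F'"
  have F: "F \<in> fin_subsets G" and FG: "F \<subseteq> carrier G" and FG': "F' \<subseteq> carrier G"
    using inv_fin_subsets[OF F'] F' by (auto simp: F_def fin_subsets_def)
  \<comment> \<open>The tolerance \<open>(\<eta> / 2)\<^sup>2\<close> yields closeness \<eta>/2,
    which doubles when the inverse permutation is replaced.\<close>
  have "\<forall>\<^sub>F i in sequentially. Hom_space G X \<alpha> p F ((\<eta> / 2)\<^sup>2) (d i) (\<sigma> i) \<subseteq> eval_hom X (d i) ` approx_maps ?\<rho> F' \<eta> i"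
    using eventually_inv_defect[OF F half_gt_zero[OF \<open>\<eta> > 0\<close>]]
  proof eventually_elim
    case (elim i)
    show ?case
    proof
      fix \<Phi> assume \<Phi>: "\<Phi> \<in> Hom_space G X \<alpha> p F ((\<eta> / 2)\<^sup>2) (d i) (\<sigma> i)"
      then obtain \<phi> where \<phi>: "\<phi> \<in> {1..d i} \<rightarrow>\<^sub>E topspace X" and eq: "\<Phi> = eval_hom X (d i) \<phi>"
        using unital_star_hom_cases[OF compact] by (auto simp: Hom_space_def)
      have \<phi>X: "\<phi> \<in> {1..d i} \<rightarrow> topspace X" using \<phi> by auto
      have "close_in_measure ?\<rho> (d i) \<eta> (\<phi> \<circ> \<sigma> i s) (\<alpha> s \<circ> \<phi>)" if s: "s \<in> F'" for s
      proof -
        have sG: "s \<in> carrier G" and tF: "inv\<^bsub>G\<^esub> s \<in> F"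
          using s FG' by (auto simp: F_def)
        then have tG: "inv\<^bsub>G\<^esub> s \<in> carrier G" by simp
        have "rho_seq p (d i) (\<Phi> \<circ> cfun_act G X \<alpha> (inv\<^bsub>G\<^esub> s)) (perm_act (d i) (\<sigma> i (inv\<^bsub>G\<^esub> s)) \<circ> \<Phi>) < (\<eta> / 2)\<^sup>2"
          using \<Phi> tF by (simp add: Hom_space_def)
        then have less: "rho_seq p (d i) (eval_hom X (d i) \<phi> \<circ> cfun_act G X \<alpha> (inv\<^bsub>G\<^esub> s))
            (perm_act (d i) (\<sigma> i (inv\<^bsub>G\<^esub> s)) \<circ> eval_hom X (d i) \<phi>) < (\<eta> / 2)\<^sup>2"
          by (simp only: eq)
        have "close_in_measure ?\<rho> (d i) (\<eta> / 2) (\<alpha> (inv\<^bsub>G\<^esub> (inv\<^bsub>G\<^esub> s)) \<circ> \<phi>) (\<phi> \<circ> inv' (\<sigma> i (inv\<^bsub>G\<^esub> s)))"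
          by (rule rho_seq_imp_close[OF p act_maps[OF inv_closed[OF tG] \<phi>X] inv_perm_maps[OF tG \<phi>X] _ _ less half_gt_zero[OF \<open>\<eta> > 0\<close>]])
            (intro eval_hom_act[OF p tG \<phi>X]; assumption)+
        then have "close_in_measure ?\<rho> (d i) (\<eta> / 2) (\<alpha> s \<circ> \<phi>) (\<phi> \<circ> inv' (\<sigma> i (inv\<^bsub>G\<^esub> s)))"
          using sG by simp
        then have "close_in_measure ?\<rho> (d i) (2 * (\<eta> / 2)) (\<phi> \<circ> \<sigma> i s) (\<alpha> s \<circ> \<phi>)"
          using elim tF sG by (intro close_in_measure_inverse(2)[OF \<rho> tG sG _ \<phi>X act_maps[OF sG \<phi>X]]) force
        then show ?thesis by simp
      qed
      with \<phi> eq show "\<Phi> \<in> eval_hom X (d i) ` approx_maps ?\<rho> F' \<eta> i"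
        by (auto simp: approx_maps_def)
    qed
  qed
  with F \<open>\<eta> > 0\<close> show "\<exists>F\<in>fin_subsets G. \<exists>\<delta>>0. \<forall>\<^sub>F i in sequentially.
      Hom_space G X \<alpha> p F \<delta> (d i) (\<sigma> i) \<subseteq> eval_hom X (d i) ` approx_maps ?\<rho> F' \<eta> i"
    by (intro bexI[of _ F] exI[of _ "(\<eta> / 2)\<^sup>2"]) auto
next
  let ?\<rho> = "seq_pseudometric p"
  note \<rho> = continuous_pseudometric_seq[OF p]
  fix F' and \<delta> :: real assume F': "F' \<in> fin_subsets G" and "\<delta> > 0"
  define F where "F = (\<lambda>s. inv\<^bsub>G\<^esub> s) ` F'"
  \<comment> \<open>Half of the closeness \<open>\<delta>\<^sup>2 / 12\<close> that bounds
    \<open>rho_seq\<close> by \<delta>, since replacing the permutation doubles it.\<close>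
  define \<eta> where "\<eta> = \<delta>\<^sup>2 / 24"
  have "\<eta> > 0" using \<open>\<delta> > 0\<close> by (simp add: \<eta>_def)
  have F: "F \<in> fin_subsets G" and FG: "F \<subseteq> carrier G" and FG': "F' \<subseteq> carrier G"
    using inv_fin_subsets[OF F'] F' by (auto simp: F_def fin_subsets_def)
  have "\<forall>\<^sub>F i in sequentially. eval_hom X (d i) ` approx_maps ?\<rho> F \<eta> i \<subseteq> Hom_space G X \<alpha> p F' \<delta> (d i) (\<sigma> i)"
    using eventually_inv_defect[OF F' \<open>\<eta> > 0\<close>]
  proof eventually_elim
    case (elim i)
    show ?case
    proof (rule image_subsetI)
      fix \<phi> assume \<phi>: "\<phi> \<in> approx_maps ?\<rho> F \<eta> i"
      then have \<phi>X: "\<phi> \<in> {1..d i} \<rightarrow> topspace X" by (auto simp: approx_maps_def)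
      have "rho_seq p (d i) (eval_hom X (d i) \<phi> \<circ> cfun_act G X \<alpha> s) (perm_act (d i) (\<sigma> i s) \<circ> eval_hom X (d i) \<phi>) < \<delta>"
        if s: "s \<in> F'" for s
      proof -
        have sG: "s \<in> carrier G" and tF: "inv\<^bsub>G\<^esub> s \<in> F"
          using s FG' by (auto simp: F_def)
        then have tG: "inv\<^bsub>G\<^esub> s \<in> carrier G" by simp
        have "close_in_measure ?\<rho> (d i) \<eta> (\<phi> \<circ> \<sigma> i (inv\<^bsub>G\<^esub> s)) (\<alpha> (inv\<^bsub>G\<^esub> s) \<circ> \<phi>)"
          using \<phi> tF by (simp add: approx_maps_def)
        then have "close_in_measure ?\<rho> (d i) (2 * \<eta>) (\<alpha> (inv\<^bsub>G\<^esub> s) \<circ> \<phi>) (\<phi> \<circ> inv' (\<sigma> i s))"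
          using elim s by (intro close_in_measure_inverse(1)[OF \<rho> sG tG _ \<phi>X act_maps[OF tG \<phi>X]]) auto
        then have cl: "close_in_measure ?\<rho> (d i) (\<delta>\<^sup>2 / 12) (\<alpha> (inv\<^bsub>G\<^esub> s) \<circ> \<phi>) (\<phi> \<circ> inv' (\<sigma> i s))"
          by (simp add: \<eta>_def)
        show ?thesis
          by (rule close_imp_rho_seq[OF p act_maps[OF tG \<phi>X] inv_perm_maps[OF sG \<phi>X] _ _ cl \<open>\<delta> > 0\<close>])
            (intro eval_hom_act[OF p sG \<phi>X]; assumption)+
      qed
      then show "eval_hom X (d i) \<phi> \<in> Hom_space G X \<alpha> p F' \<delta> (d i) (\<sigma> i)"
        using unital_star_hom_eval[OF \<phi>X] by (simp add: Hom_space_def)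
    qed
  qed
  with F \<open>\<eta> > 0\<close> show "\<exists>F\<in>fin_subsets G. \<exists>\<eta>>0. \<forall>\<^sub>F i in sequentially.
      eval_hom X (d i) ` approx_maps ?\<rho> F \<eta> i \<subseteq> Hom_space G X \<alpha> p F' \<delta> (d i) (\<sigma> i)"
    by (intro bexI[of _ F] exI[of _ \<eta>]) auto
next
  fix \<eta> :: real assume \<eta>: "\<eta> > 0"
  have "close_in_measure (seq_pseudometric p) (d i) \<eta> \<phi> \<psi>"
    if "\<phi> \<in> {1..d i} \<rightarrow>\<^sub>E topspace X" "\<psi> \<in> {1..d i} \<rightarrow>\<^sub>E topspace X"
      and "rho_seq p (d i) (eval_hom X (d i) \<phi>) (eval_hom X (d i) \<psi>) < \<eta>\<^sup>2" for i \<phi> \<psi>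
  proof (rule rho_seq_imp_close[OF p _ _ _ _ that(3) \<eta>])
    show "\<phi> \<in> {1..d i} \<rightarrow> topspace X" "\<psi> \<in> {1..d i} \<rightarrow> topspace X"
      using that by auto
  qed (intro eval_hom_seq[OF p]; assumption)+
  then show "\<exists>\<epsilon>>0. \<forall>i. \<forall>\<phi>\<in>{1..d i} \<rightarrow>\<^sub>E topspace X. \<forall>\<psi>\<in>{1..d i} \<rightarrow>\<^sub>E topspace X.
     rho_seq p (d i) (eval_hom X (d i) \<phi>) (eval_hom X (d i) \<psi>) < \<epsilon> \<longrightarrow>
     close_in_measure (seq_pseudometric p) (d i) \<eta> \<phi> \<psi>"
    using \<eta> by (intro exI[of _ "\<eta>\<^sup>2"]) simp
next
  fix \<epsilon> :: real assume \<epsilon>: "\<epsilon> > 0"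
  have "rho_seq p (d i) (eval_hom X (d i) \<phi>) (eval_hom X (d i) \<psi>) < \<epsilon>"
    if "\<phi> \<in> {1..d i} \<rightarrow>\<^sub>E topspace X" "\<psi> \<in> {1..d i} \<rightarrow>\<^sub>E topspace X"
      and "close_in_measure (seq_pseudometric p) (d i) (\<epsilon>\<^sup>2 / 12) \<phi> \<psi>" for i \<phi> \<psi>
  proof (rule close_imp_rho_seq[OF p _ _ _ _ that(3) \<epsilon>])
    show "\<phi> \<in> {1..d i} \<rightarrow> topspace X" "\<psi> \<in> {1..d i} \<rightarrow> topspace X"
      using that by auto
  qed (intro eval_hom_seq[OF p]; assumption)+
  then show "\<exists>\<eta>>0. \<forall>i. \<forall>\<phi>\<in>{1..d i} \<rightarrow>\<^sub>E topspace X. \<forall>\<psi>\<in>{1..d i} \<rightarrow>\<^sub>E topspace X.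
     close_in_measure (seq_pseudometric p) (d i) \<eta> \<phi> \<psi> \<longrightarrow>
     rho_seq p (d i) (eval_hom X (d i) \<phi>) (eval_hom X (d i) \<psi>) < \<epsilon>"
    using \<epsilon> by (intro exI[of _ "\<epsilon>\<^sup>2 / 12"]) simp
qed

end

section \<open>Generating sequences\<close>

lemma unital_cstar_subalgebra_linear_combination:
  assumes A: "unital_cstar_subalgebra X A" and "finite J" and "\<And>j. j \<in> J \<Longrightarrow> g j \<in> A"
  shows "(\<lambda>x\<in>topspace X. \<Sum>j\<in>J. c j * g j x) \<in> A"
  using assms(2,3)
proof induction
  case empty
  have "(\<lambda>x\<in>topspace X. 0 * (\<lambda>x\<in>topspace X. 1) x) \<in> A"
    using A unfolding unital_cstar_subalgebra_def by blast
  also have "(\<lambda>x\<in>topspace X. 0 * (\<lambda>x\<in>topspace X. 1) x) = (\<lambda>x\<in>topspace X. \<Sum>j\<in>{}. c j * g j x)"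
    by (rule restrict_ext) simp
  finally show ?case .
next
  case (insert i J)
  then have IH: "(\<lambda>x\<in>topspace X. \<Sum>j\<in>J. c j * g j x) \<in> A"
    by (intro insert.IH insert.prems) simp
  have ci: "(\<lambda>x\<in>topspace X. c i * g i x) \<in> A"
    using A insert.prems[of i] unfolding unital_cstar_subalgebra_def by blast
  have "\<forall>f\<in>A. \<forall>g\<in>A. (\<lambda>x\<in>topspace X. f x + g x) \<in> A"
    using A unfolding unital_cstar_subalgebra_def by blast
  from this[rule_format, OF ci IH]
  have "(\<lambda>x\<in>topspace X. (\<lambda>x\<in>topspace X. c i * g i x) x + (\<lambda>x\<in>topspace X. \<Sum>j\<in>J. c j * g j x) x) \<in> A" .
  also have "(\<lambda>x\<in>topspace X. (\<lambda>x\<in>topspace X. c i * g i x) x + (\<lambda>x\<in>topspace X. \<Sum>j\<in>J. c j * g j x) x)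
      = (\<lambda>x\<in>topspace X. \<Sum>j\<in>insert i J. c j * g j x)"
    by (rule restrict_ext) (simp add: insert.hyps)
  finally show ?case .
qed

text \<open>The pseudometric \<open>cmod (f x - f y)\<close> is compared with the one-element
  separating family consisting of \<open>m\<close>.\<close>

lemma cfun_uniformly_continuous:
  assumes X: "compact_space X" and m: "continuous_pseudometric X m"
    and pos: "\<And>x y. x \<in> topspace X \<Longrightarrow> y \<in> topspace X \<Longrightarrow> x \<noteq> y \<Longrightarrow> m x y > 0"
    and f: "f \<in> cfun X" and "\<epsilon> > 0"
  obtains \<theta> where "\<theta> > 0" "\<And>x y. x \<in> topspace X \<Longrightarrow> y \<in> topspace X \<Longrightarrow> m x y < \<theta> \<Longrightarrow> cmod (f x - f y) < \<epsilon>"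
proof -
  have "continuous_map (prod_topology X X) euclideanreal (\<lambda>z. cmod (f (fst z) - f (snd z)))"
    using continuous_map_compose[OF continuous_map_fst cfun_continuous[OF f]]
      continuous_map_compose[OF continuous_map_snd cfun_continuous[OF f]]
    by (intro continuous_map_norm continuous_map_diff) (auto simp: o_def)
  then have \<rho>': "continuous_pseudometric X (\<lambda>x y. cmod (f x - f y))"
    using norm_triangle_ineq[of "f x - f y" "f y - f z" for x y z]
    by (simp add: continuous_pseudometric_def case_prod_beta' norm_minus_commute)
  have mc: "continuous_map (prod_topology X X) euclideanreal (\<lambda>z. m (fst z) (snd z))"
    using m by (simp add: continuous_pseudometric_def case_prod_beta')
  obtain K \<theta> where "K \<subseteq> {()}" "\<theta> > 0" and
    *: "\<And>x y. x \<in> topspace X \<Longrightarrow> y \<in> topspace X \<Longrightarrow> \<forall>s\<in>K. m x y < \<theta> \<Longrightarrow> cmod (f x - f y) < \<epsilon>"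
    by (rule separating_family_uniform[OF X \<rho>' _ _ \<open>\<epsilon> > 0\<close>, where I = "{()}" and r = "\<lambda>_. m"])
      (use mc pos in auto)
  then show thesis
    by (intro that[of \<theta>]) auto
qed

text \<open>
  Partitions of unity subordinate to finite covers by balls of radius \<open>1/(n+1)\<close> generate \<open>C(X)\<close>:
  a function \<open>f\<close> is the uniform limit of \<open>\<Sum>\<^sub>c f(c) g\<^sub>c\<close>, \<open>c\<close> running over the centers of the balls.
\<close>

lemma generating_seq_exists:
  assumes X: "compact_space X" and "metrizable_space X"
  obtains p where "real_unit_ball_seq X p"
    "\<And>A. unital_cstar_subalgebra X A \<Longrightarrow> range p \<subseteq> A \<Longrightarrow> A = cfun X"
proof -
  obtain m where m: "continuous_pseudometric X m"
    and pos: "\<And>x y. x \<in> topspace X \<Longrightarrow> y \<in> topspace X \<Longrightarrow> x \<noteq> y \<Longrightarrow> m x y > 0"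
    using metrizable_continuous_pseudometric[OF assms(2)] by blast
  have "\<exists>C. finite C \<and> C \<subseteq> topspace X \<and> (\<forall>x\<in>topspace X. \<exists>c\<in>C. m c x < 1 / real (Suc n))" for n
    using continuous_pseudometric_totally_bounded[OF X m, of "1 / real (Suc n)"] by (metis of_nat_0_less_iff zero_less_Suc zero_less_divide_1_iff)
  then obtain C where C: "\<And>n. finite (C n)" "\<And>n. C n \<subseteq> topspace X"
    "\<And>n x. x \<in> topspace X \<Longrightarrow> \<exists>c\<in>C n. m c x < 1 / real (Suc n)"
    by metis
  \<comment> \<open>Tent functions, positive exactly on the balls of radius 1/(n+1). The balls of
    each level cover the space, so the sum \<open>S\<close> is positive and can be divided
    by.\<close>
  define h where "h n c x = max 0 (1 / real (Suc n) - m c x)" for n c x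
  define S where "S n x = (\<Sum>c\<in>C n. h n c x)" for n x
  define g where "g n c = (\<lambda>x\<in>topspace X. complex_of_real (h n c x / S n x))" for n c
  \<comment> \<open>The constant keeps \<open>P\<close> nonempty over an empty space, where there
    are no centers, so that \<open>P\<close> can be enumerated by a sequence.\<close>
  define P where "P = insert (\<lambda>x\<in>topspace X. 1) (\<Union>n. g n ` C n)"
  have h_nonneg: "0 \<le> h n c x" for n c x
    by (simp add: h_def)
  have S_pos: "S n x > 0" if x: "x \<in> topspace X" for n x
  proof -
    obtain c where "c \<in> C n" "m c x < 1 / real (Suc n)"
      using C(3)[OF x] by blast
    then show ?thesis
      unfolding S_def by (intro sum_pos2[of _ c] C h_nonneg) (auto simp: h_def)
  qed
  have g_sum: "(\<Sum>c\<in>C n. h n c x / S n x) = 1" if "x \<in> topspace X" for n x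
    using S_pos[OF that, of n] by (simp add: S_def sum_divide_distrib[symmetric])
  have h_cont: "continuous_map X euclideanreal (h n c)" if "c \<in> C n" for n c
    unfolding h_def using pseudometric_continuous_right[OF m subsetD[OF C(2) that]]
    by (intro continuous_map_real_max continuous_map_diff) auto
  then have S_cont: "continuous_map X euclideanreal (S n)" for n
    unfolding S_def using C by (intro continuous_map_sum)
  have g_ball: "g n c \<in> cfun X \<and> (\<forall>x\<in>topspace X. g n c x \<in> \<real> \<and> cmod (g n c x) \<le> 1)" if c: "c \<in> C n" for n c
  proof (intro conjI ballI)
    show "g n c \<in> cfun X"
      unfolding g_def by (intro cfun_of_real continuous_map_real_divide h_cont[OF c] S_cont less_imp_neq[THEN not_sym] S_pos)
    fix x assume x: "x \<in> topspace X"
    show "g n c x \<in> \<real>" using x by (simp add: g_def)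
    have "h n c x \<le> S n x"
      unfolding S_def using c C h_nonneg by (intro member_le_sum) auto
    then have "\<bar>h n c x / S n x\<bar> \<le> 1"
      using h_nonneg[of n c x] S_pos[OF x, of n] by simp
    then show "cmod (g n c x) \<le> 1"
      using x by (simp add: g_def del: of_real_divide)
  qed
  have "countable P" "P \<noteq> {}"
    using C by (auto simp: P_def intro: countable_finite)
  then have range: "range (from_nat_into P) = P"
    by (simp add: range_from_nat_into)
  show thesis
  proof (rule that)
    have "f \<in> cfun X \<and> (\<forall>x\<in>topspace X. f x \<in> \<real> \<and> cmod (f x) \<le> 1)" if "f \<in> P" for f
      using that g_ball cfun_const unfolding P_def by fastforce
    then show "real_unit_ball_seq X (from_nat_into P)"
      unfolding real_unit_ball_seq_def using range by (metis rangeI)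
    fix A assume A: "unital_cstar_subalgebra X A" and "range (from_nat_into P) \<subseteq> A"
    then have gA: "g n c \<in> A" if "c \<in> C n" for n c
      using that range by (auto simp: P_def)
    show "A = cfun X"
    proof
      show "A \<subseteq> cfun X" using A by (simp add: unital_cstar_subalgebra_def)
      show "cfun X \<subseteq> A"
      proof
        fix f assume f: "f \<in> cfun X"
        define u where "u n = (\<lambda>x\<in>topspace X. \<Sum>c\<in>C n. f c * g n c x)" for n
        have "u n \<in> A" for n
          unfolding u_def using gA C by (intro unital_cstar_subalgebra_linear_combination[OF A])
        moreover have "uniform_limit (topspace X) u f sequentially"
        proof (rule uniform_limitI)
          fix \<epsilon> :: real assume "\<epsilon> > 0"
          then obtain \<theta> where "\<theta> > 0" and \<theta>: "\<And>x y. x \<in> topspace X \<Longrightarrow> y \<in> topspace X \<Longrightarrow> m x y < \<theta> \<Longrightarrow> cmod (f x - f y) < \<epsilon> / 2"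
            using cfun_uniformly_continuous[OF X m pos f, of "\<epsilon> / 2"] by (metis half_gt_zero)
          obtain N where N: "1 / real (Suc N) < \<theta>"
            using reals_Archimedean[OF \<open>\<theta> > 0\<close>] by (metis inverse_eq_divide)
          have "dist (u n x) (f x) < \<epsilon>" if "n \<ge> N" and x: "x \<in> topspace X" for n x
          proof -
            have "1 / real (Suc n) \<le> 1 / real (Suc N)"
              using \<open>n \<ge> N\<close> by (simp add: frac_le)
            with N have n: "1 / real (Suc n) < \<theta>" by simp
            have w: "complex_of_real (\<Sum>c\<in>C n. h n c x / S n x) = 1"
              using g_sum[OF x] by simp
            \<comment> \<open>The weights sum to 1, so \<open>f x\<close> is written as their
              combination with constant coefficient.\<close>
            have "u n x - f x = (\<Sum>c\<in>C n. f c * complex_of_real (h n c x / S n x)) - f x * complex_of_real (\<Sum>c\<in>C n. h n c x / S n x)"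
              unfolding w using x by (simp add: u_def g_def)
            also have "\<dots> = (\<Sum>c\<in>C n. (f c - f x) * complex_of_real (h n c x / S n x))"
              by (simp only: of_real_sum sum_distrib_left sum_subtractf[symmetric] left_diff_distrib)
            finally have "cmod (u n x - f x) \<le> (\<Sum>c\<in>C n. cmod ((f c - f x) * complex_of_real (h n c x / S n x)))"
              using norm_sum by metis
            \<comment> \<open>Only centers within \<theta> of \<open>x\<close> carry weight, and
              there \<open>f\<close> varies by less than \<epsilon>/2.\<close>
            also have "\<dots> \<le> (\<Sum>c\<in>C n. \<epsilon> / 2 * (h n c x / S n x))"
            proof (rule sum_mono)
              fix c assume c: "c \<in> C n"
              show "cmod ((f c - f x) * complex_of_real (h n c x / S n x)) \<le> \<epsilon> / 2 * (h n c x / S n x)"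
              proof (cases "m c x < 1 / real (Suc n)")
                case True
                then have "cmod (f c - f x) \<le> \<epsilon> / 2"
                  using \<theta>[of c x] c C(2) x n by force
                moreover have "0 \<le> h n c x / S n x"
                  using h_nonneg[of n c x] S_pos[OF x, of n] by simp
                ultimately show ?thesis
                  unfolding norm_mult norm_of_real using \<open>\<epsilon> > 0\<close> by (intro mult_mono) auto
              next
                case False
                then have "h n c x = 0" by (simp add: h_def)
                then show ?thesis by simp
              qed
            qed
            also have "\<dots> = \<epsilon> / 2"
              by (simp only: sum_distrib_left[symmetric] g_sum[OF x] mult_1_right)
            finally show ?thesis
              using \<open>\<epsilon> > 0\<close> by (simp add: dist_norm)
          qed
          then show "\<forall>\<^sub>F n in sequentially. \<forall>x\<in>topspace X. dist (u n x) (f x) < \<epsilon>"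
            by (auto simp: eventually_sequentially)
        qed
        moreover have "\<forall>u f. (\<forall>n. u n \<in> A) \<and> f \<in> cfun X \<and> uniform_limit (topspace X) u f sequentially \<longrightarrow> f \<in> A"
          using A unfolding unital_cstar_subalgebra_def by (elim conjE)
        ultimately show "f \<in> A"
          using f by blast
      qed
    qed
  qed
qed

text \<open>Homomorphism spaces of a generating sequence and map spaces of \<rho> are both
  represented, over generating pseudometrics, so two growth inequalities identify each sequence
  entropy with the spatial one. This also proves that the sequence entropy is the same for all
  generating sequences.\<close>

theorem proposition2p4:
  fixes G :: "('g, 'b) monoid_scheme"
    and X :: "'x topology"
    and \<alpha> :: "'g \<Rightarrow> 'x \<Rightarrow> 'x"
    and d :: "nat \<Rightarrow> nat"
    and \<sigma> :: "nat \<Rightarrow> 'g \<Rightarrow> nat \<Rightarrow> nat"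
    and \<rho> :: "'x \<Rightarrow> 'x \<Rightarrow> real"
  assumes "group G" and "countable (carrier G)"
    and "sofic_approximation G d \<sigma>"
    and "compact_space X" and "metrizable_space X"
    and "group_action G (topspace X) \<alpha>"
    and "\<And>s. s \<in> carrier G \<Longrightarrow> continuous_map X X (\<alpha> s)"
    and "continuous_pseudometric X \<rho>"
    and "dyn_generating_pseudometric G X \<alpha> \<rho>"
  shows "sofic_entropy G X \<alpha> d \<sigma> = spatial_entropy_2 G X \<alpha> d \<sigma> \<rho>
       \<and> spatial_entropy_2 G X \<alpha> d \<sigma> \<rho> = spatial_entropy_inf G X \<alpha> d \<sigma> \<rho>"
proof
  interpret sofic_action G X \<alpha> d \<sigma>
    using assms by (intro sofic_action.intro)
  show "spatial_entropy_2 G X \<alpha> d \<sigma> \<rho> = spatial_entropy_inf G X \<alpha> d \<sigma> \<rho>"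
    by (rule spatial_entropy_2_eq_inf) fact
  let ?P = "{p. real_unit_ball_seq X p \<and> dyn_generating_seq G X \<alpha> p}"
  have eq: "sofic_entropy_seq G X \<alpha> d \<sigma> p = spatial_entropy_2 G X \<alpha> d \<sigma> \<rho>" if "p \<in> ?P" for p
  proof -
    have p: "real_unit_ball_seq X p" "dyn_generating_seq G X \<alpha> p"
      using that by auto
    have \<rho>p: "continuous_pseudometric X (seq_pseudometric p)" "dyn_generating_pseudometric G X \<alpha> (seq_pseudometric p)"
      using p continuous_pseudometric_seq dyn_generating_seq_pseudometric \<open>metrizable_space X\<close> by blast+
    show ?thesis
      unfolding sofic_entropy_seq_def spatial_entropy_2_def
      by (rule antisym[OF
            sofic_growth_le_represented[OF \<rho>p assms(8,9) represented_Hom_space[OF p(1)] represented_Map_space[OF assms(8)]]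
            sofic_growth_le_represented[OF assms(8,9) \<rho>p represented_Map_space[OF assms(8)] represented_Hom_space[OF p(1)]]])
  qed
  obtain p where "real_unit_ball_seq X p"
    and "\<And>A. unital_cstar_subalgebra X A \<Longrightarrow> range p \<subseteq> A \<Longrightarrow> A = cfun X"
    using generating_seq_exists[OF \<open>compact_space X\<close> \<open>metrizable_space X\<close>] by blast
  \<comment> \<open>A sequence that generates the algebra by itself is a fortiori dynamically
    generating.\<close>
  then have p: "p \<in> ?P"
    by (simp add: dyn_generating_seq_def)
  \<comment> \<open>\<open>the_elem\<close> is determined here because the set of values is
    nonempty, by \<open>p\<close>, and constant, by \<open>eq\<close>.\<close>
  have "sofic_entropy G X \<alpha> d \<sigma> = sofic_entropy_seq G X \<alpha> d \<sigma> p"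
    unfolding sofic_entropy_def
  proof (rule the_elem_image_unique)
    show "?P \<noteq> {}" using p by (metis emptyE)
    show "sofic_entropy_seq G X \<alpha> d \<sigma> q = sofic_entropy_seq G X \<alpha> d \<sigma> p" if "q \<in> ?P" for q
      unfolding eq[OF p] eq[OF that] ..
  qed
  with eq[OF p] show "sofic_entropy G X \<alpha> d \<sigma> = spatial_entropy_2 G X \<alpha> d \<sigma> \<rho>"
    by simp
qed

end
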